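(* Consider the first follower (agent $3$) of a twin-leader-follower network, under the standing assumptions described in the context, with orientation estimator $$\dot{\hat{\mathbf R}}_3=\hat{\mathbf R}_3(\omega_3^3-\tilde\Omega_3)^\wedge,\qquad \dot{\tilde\Omega}_3=-k_\omega\tilde\Omega_3+\mathbf e_3,\qquad k_\omega>0,$$ where $\mathbf e_3=\sum_{j\in\mathcal N_3}k_{3j}(\hat{\mathbf R}_3^\top\mathbf b_{3j}\times\mathbf b_{3j}^3)$. Let $\tilde{\mathbf Q}_3=\hat{\mathbf R}_3\mathbf R_3^\top$. Then: (i) The equilibrium points of this system, in the variables $(\tilde{\mathbf Q}_3,\tilde\Omega_3)\in SO(3)\times\mathbb R^3$, are $$\{(\tilde{\mathbf Q}_3,\tilde\Omega_3)\mid \tilde{\mathbf Q}_3\in\{\mathbf I_3,\mathbf U\mathbf D_1\mathbf U^\top,\mathbf U\mathbf D_2\mathbf U^\top,\mathbf U\mathbf D_3\mathbf U^\top\},\ \tilde\Omega_3=\mathbf 0\}.$$ (ii) The desired equilibrium $(\tilde{\mathbf Q}_3=\mathbf I_3,\tilde\Omega_3=\mathbf 0)$ is almost globally asymptotically stable, $\tilde{\mathbf Q}_3=\mathbf I_3$ is the global minimum of $\Phi_3(\tilde{\mathbf Q}_3)$, and the three undesired equilibria are unstable.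
   Context: Notation. For $\omega\in\mathbb R^3$, $\omega^\wedge$ is the skew-symmetric matrix with $\omega^\wedge v=\omega\times v$ for all $v\in\mathbb R^3$. $O(3)$ is the group of real orthogonal $3\times3$ matrices and $SO(3)$ the rotation group. Setting. A network of agents in $\mathbb R^3$; agent $i$ has a fixed position $\mathbf p_i\in\mathbb R^3$ and a true orientation $\mathbf R_i(t)\in SO(3)$ satisfying $\dot{\mathbf R}_i=\mathbf R_i(\omega_i^i)^\wedge$, where the body angular velocity $\omega_i^i(t)$ (known to agent $i$) and its derivative are bounded, $\|\omega_i^i\|\le\bar\omega_i$. The leader agents (at least two, labelled $1,2$, and possibly redundant leaders $1',2',\dots$) know their true poses; the followers are $3,4,\dots,n$. Each follower $i$ has a neighbor set $\mathcal N_i$ of at least two agents, all preceding $i$ in the order $1,2,1',2',\dots,3,4,\dots,n$; in particular all neighbors of agent $3$ are leaders. No two agents are collocated, and each follower has at least one pair of neighbors with which it is not collinear. Directions. $\mathbf b_{ij}=(\mathbf p_j-\mathbf p_i)/\|\mathbf p_j-\mathbf p_i\|$ and $\mathbf b_{ij}^i=\mathbf R_i^\top\mathbf b_{ij}$ for $j\in\mathcal N_i$. Convention: if $|\mathcal N_i|=2$, a third direction constraint is added whose unit vector is the normalized cross product of the two directions to the neighbors, and sums over $j\in\mathcal N_i$ include this third term. Error function. Gains $k_{ij}>0$ are given, $\mathbf K_i=\sum_{j\in\mathcal N_i}k_{ij}\mathbf b_{ij}\mathbf b_{ij}^\top$; it is assumed that the directions $\{\mathbf b_{ij}\}_{j\in\mathcal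 N_i}$ are non-coplanar, so $\mathbf K_i$ is positive definite, and that the gains are chosen so that $\mathbf K_i$ has distinct eigenvalues $\lambda_1,\lambda_2,\lambda_3$. Write $\mathbf K_i=\mathbf U\mathbf G\mathbf U^\top$ with $\mathbf G=\mathrm{diag}(\lambda_1,\lambda_2,\lambda_3)$, $\mathbf U\in O(3)$ (here $i=3$). The error function is $\Phi_i=\frac12\sum_{j\in\mathcal N_i}k_{ij}\|\hat{\mathbf R}_i\mathbf b_{ij}^i-\mathbf b_{ij}\|^2=\mathrm{tr}\big(\mathbf G(\mathbf I_3-\mathbf U^\top\tilde{\mathbf Q}_i\mathbf U)\big)$ with $\tilde{\mathbf Q}_i=\hat{\mathbf R}_i\mathbf R_i^\top$. For $m=1,2,3$, $\mathbf D_m=2[\mathbf I_3]_m[\mathbf I_3]_m^\top-\mathbf I_3$, where $[\mathbf I_3]_m$ is the $m$-th column of $\mathbf I_3$. "Almost globally asymptotically stable" means asymptotically stable, with convergence to the equilibrium from all initial conditions outside a set of measure zero. *)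

theory Defs
  imports "HOL-Analysis.Analysis"
begin

definition skew :: "real^3 \<Rightarrow> real^3^3" where
  "skew w = matrix (\<lambda>v. cross3 w v)"

definition outer :: "real^3 \<Rightarrow> real^3 \<Rightarrow> real^3^3" where
  "outer v w = (\<chi> i j. v $ i * w $ j)"

definition diag :: "real^3 \<Rightarrow> real^3^3" where
  "diag l = (\<chi> i j. if i = j then l $ i else 0)"

definition eigenvalues :: "real^3^3 \<Rightarrow> real set" where
  "eigenvalues A = {l. \<exists>v. v \<noteq> 0 \<and> A *v v = l *\<^sub>R v}"

definition D :: "3 \<Rightarrow> real^3^3" where
  "D m = 2 *\<^sub>R outer (column m (mat 1)) (column m (mat 1)) - mat 1"

text \<open>
  A (possibly time-varying) system on a state space \<open>X\<close> is given by the predicate \<open>sol\<close> of its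
  trajectories on \<open>{t0..}\<close>, where \<open>t0\<close> is the initial time. As \<open>lyapunov_stable\<close> is stated for a given
  \<open>t0\<close>, the bound \<open>d\<close> may depend on the initial time.
\<close>

definition lyapunov_stable :: "((real \<Rightarrow> 'x::metric_space) \<Rightarrow> bool) \<Rightarrow> real \<Rightarrow> 'x \<Rightarrow> bool" where
  "lyapunov_stable sol t0 xe \<longleftrightarrow>
     (\<forall>e>0. \<exists>d>0. \<forall>x. sol x \<and> dist (x t0) xe < d \<longrightarrow> (\<forall>t\<ge>t0. dist (x t) xe < e))"

text \<open>Existence of a trajectory is demanded so that convergence never holds vacuously.\<close>

definition converges_from ::
    "((real \<Rightarrow> 'x::metric_space) \<Rightarrow> bool) \<Rightarrow> real \<Rightarrow> 'x \<Rightarrow> 'x \<Rightarrow> bool" where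
  "converges_from sol t0 xe x0 \<longleftrightarrow>
     (\<exists>x. sol x \<and> x t0 = x0) \<and> (\<forall>x. sol x \<and> x t0 = x0 \<longrightarrow> (x \<longlongrightarrow> xe) at_top)"

definition asymptotically_stable ::
    "'x::metric_space set \<Rightarrow> ((real \<Rightarrow> 'x) \<Rightarrow> bool) \<Rightarrow> real \<Rightarrow> 'x \<Rightarrow> bool" where
  "asymptotically_stable X sol t0 xe \<longleftrightarrow>
     lyapunov_stable sol t0 xe \<and> (\<exists>c>0. \<forall>x0\<in>X. dist x0 xe < c \<longrightarrow> converges_from sol t0 xe x0)"

text \<open>
  \<open>S\<close> has \<open>d\<close>-dimensional Hausdorff measure zero. Boundedness of the covering sets is needed
  because \<open>diameter\<close> is unspecified on unbounded sets.
\<close>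

definition hausdorff_null :: "nat \<Rightarrow> 'x::metric_space set \<Rightarrow> bool" where
  "hausdorff_null d S \<longleftrightarrow>
     (\<forall>e>0. \<exists>C :: nat \<Rightarrow> 'x set. S \<subseteq> (\<Union>i. C i) \<and> (\<forall>i. bounded (C i)) \<and>
        summable (\<lambda>i. diameter (C i) ^ d) \<and> (\<Sum>i. diameter (C i) ^ d) < e)"

definition almost_globally_asymptotically_stable ::
    "nat \<Rightarrow> 'x::metric_space set \<Rightarrow> ((real \<Rightarrow> 'x) \<Rightarrow> bool) \<Rightarrow> real \<Rightarrow> 'x \<Rightarrow> bool" where
  "almost_globally_asymptotically_stable d X sol t0 xe \<longleftrightarrow>
     asymptotically_stable X sol t0 xe \<and>
     hausdorff_null d {x0 \<in> X. \<not> converges_from sol t0 xe x0}"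

text \<open>
  The state space has dimension 6. On this embedded submanifold 6-dimensional Hausdorff measure
  is, up to a constant factor, the product of Haar measure on the rotation group (the metric on
  matrices is invariant under rotations) and Lebesgue measure, so the null sets are the usual ones.
\<close>

definition state_space :: "((real^3^3) \<times> (real^3)) set" where
  "state_space = {(Q, W). rotation_matrix Q}"

text \<open>
  \<open>Plain i\<close> is agent $i$ and \<open>Primed i\<close> is the redundant leader $i'$. A network has plain agents
  $1,\dots,n$ and redundant leaders $1',\dots,r'$.
\<close>

datatype agent = Plain nat | Primed nat

text \<open>
  A direction constraint of a follower: the direction to a neighbor, or the normalized cross
  product of the two directions to the neighbors if there are exactly two of them.
\<close>

datatype constr = Toward agent | Normal

record network =
  num_plain :: nat
  num_redundant :: nat
  nbrs :: "agent \<Rightarrow> agent set"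
  pos :: "agent \<Rightarrow> real^3"
  orient :: "agent \<Rightarrow> real \<Rightarrow> real^3^3"
  angvel :: "agent \<Rightarrow> real \<Rightarrow> real^3"  \<comment> \<open>in the body frame\<close>
  gain :: "agent \<Rightarrow> constr \<Rightarrow> real"

definition leaders :: "network \<Rightarrow> agent set" where
  "leaders net = {Plain 1, Plain 2} \<union> Primed ` {1..num_redundant net}"

definition agents :: "network \<Rightarrow> agent set" where
  "agents net = leaders net \<union> Plain ` {3..num_plain net}"

text \<open>The agents preceding follower \<open>Plain i\<close> in the order $1,2,1',2',\dots,r',3,4,\dots,n$.\<close>

definition predecessors :: "network \<Rightarrow> nat \<Rightarrow> agent set" where
  "predecessors net i = leaders net \<union> Plain ` {3..<i}"

definition dir :: "network \<Rightarrow> agent \<Rightarrow> agent \<Rightarrow> real^3" where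
  "dir net i j = (pos net j - pos net i) /\<^sub>R norm (pos net j - pos net i)"

definition constrs :: "network \<Rightarrow> agent \<Rightarrow> constr set" where
  "constrs net i = Toward ` nbrs net i \<union> (if card (nbrs net i) = 2 then {Normal} else {})"

text \<open>
  The order of the two factors in the cross product is irrelevant: the direction enters \<open>K\<close>,
  \<open>innovation\<close> and \<open>error_function\<close> only through expressions that are even in it.
\<close>

fun constr_dir :: "network \<Rightarrow> agent \<Rightarrow> constr \<Rightarrow> real^3" where
  "constr_dir net i (Toward j) = dir net i j"
| "constr_dir net i Normal =
     (let (j, l) = (SOME (j, l). j \<noteq> l \<and> nbrs net i = {j, l});
          c = cross3 (dir net i j) (dir net i l)
      in c /\<^sub>R norm c)"

definition body_dir :: "network \<Rightarrow> agent \<Rightarrow> real \<Rightarrow> constr \<Rightarrow> real^3" where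
  "body_dir net i t c = transpose (orient net i t) *v constr_dir net i c"

definition K :: "network \<Rightarrow> agent \<Rightarrow> real^3^3" where
  "K net i = (\<Sum>c\<in>constrs net i. gain net i c *\<^sub>R outer (constr_dir net i c) (constr_dir net i c))"

definition twin_leader_follower :: "network \<Rightarrow> bool" where
  "twin_leader_follower net \<longleftrightarrow>
     num_plain net \<ge> 3 \<and>
     inj_on (pos net) (agents net) \<and>
     (\<forall>i\<in>agents net.
        (\<forall>t\<ge>0. rotation_matrix (orient net i t) \<and>
           (orient net i has_vector_derivative orient net i t ** skew (angvel net i t))
             (at t within {0..})) \<and>
        (\<exists>B. \<forall>t\<ge>0. norm (angvel net i t) \<le> B) \<and>
        (\<exists>w' B. \<forall>t\<ge>0. (angvel net i has_vector_derivative w' t) (at t within {0..}) \<and>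
           norm (w' t) \<le> B)) \<and>
     (\<forall>m\<in>{3..num_plain net}. let i = Plain m in
        nbrs net i \<subseteq> predecessors net m \<and>
        card (nbrs net i) \<ge> 2 \<and>
        (\<exists>j\<in>nbrs net i. \<exists>l\<in>nbrs net i. \<not> collinear {pos net i, pos net j, pos net l}) \<and>
        (\<forall>c\<in>constrs net i. gain net i c > 0) \<and>
        \<not> coplanar (insert 0 (constr_dir net i ` constrs net i)) \<and>
        card (eigenvalues (K net i)) = 3)"

text \<open>
  The error function, for the estimate \<open>Rhat\<close> of the orientation of agent \<open>i\<close> at time \<open>t\<close>. As a
  function of the error \<open>Q = Rhat ** transpose (orient net i t)\<close>, it is evaluated at
  \<open>Rhat = Q ** orient net i t\<close>.
\<close>

definition error_function :: "network \<Rightarrow> agent \<Rightarrow> real \<Rightarrow> real^3^3 \<Rightarrow> real" where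
  "error_function net i t Rhat =
     (1/2) * (\<Sum>c\<in>constrs net i.
        gain net i c * (norm (Rhat *v body_dir net i t c - constr_dir net i c))\<^sup>2)"

definition innovation :: "network \<Rightarrow> agent \<Rightarrow> real \<Rightarrow> real^3^3 \<Rightarrow> real^3" where
  "innovation net i t Rhat =
     (\<Sum>c\<in>constrs net i.
        gain net i c *\<^sub>R cross3 (transpose Rhat *v constr_dir net i c) (body_dir net i t c))"

definition estimator_solution ::
    "network \<Rightarrow> agent \<Rightarrow> real \<Rightarrow> real \<Rightarrow> (real \<Rightarrow> real^3^3) \<Rightarrow> (real \<Rightarrow> real^3) \<Rightarrow> bool" where
  "estimator_solution net i kw t0 Rhat W \<longleftrightarrow>
     (\<forall>t\<ge>t0. rotation_matrix (Rhat t) \<and>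
        (Rhat has_vector_derivative Rhat t ** skew (angvel net i t - W t)) (at t within {t0..}) \<and>
        (W has_vector_derivative - kw *\<^sub>R W t + innovation net i t (Rhat t)) (at t within {t0..}))"

text \<open>The trajectories of the estimator in the error variables.\<close>

definition error_solution ::
    "network \<Rightarrow> agent \<Rightarrow> real \<Rightarrow> real \<Rightarrow> (real \<Rightarrow> (real^3^3) \<times> (real^3)) \<Rightarrow> bool" where
  "error_solution net i kw t0 x \<longleftrightarrow>
     (\<exists>Rhat W. estimator_solution net i kw t0 Rhat W \<and>
        (\<forall>t\<ge>t0. x t = (Rhat t ** transpose (orient net i t), W t)))"

text \<open>
  In the error variables the system depends on time through the true orientation; an equilibrium
  is a point at which it can rest for all times.
\<close>

definition equilibria :: "network \<Rightarrow> agent \<Rightarrow> real \<Rightarrow> ((real^3^3) \<times> (real^3)) set" where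
  "equilibria net i kw = {xe. error_solution net i kw 0 (\<lambda>t. xe)}"

end

theory Submission
  imports Defs
begin

text \<open>
  The proof works in coordinates in which the estimator is almost autonomous. Write
  \<open>G = diag l\<close> for the eigenvalues of \<open>K\<close>, \<open>F = U\<^sup>T R\<close> for the true orientation \<open>R\<close> seen in the
  eigenbasis, and replace the error \<open>(Q, \<Omega>)\<close> by \<open>(U\<^sup>T Q U, V)\<close> with \<open>V = F \<Omega>\<close>. Renaming the first
  component to \<open>Q\<close> again, the error dynamics become
  \<open>Q' = - Q [V]\<close> and \<open>V' = a \<times> V - k V + \<tau>(Q)\<close>, where \<open>[V]\<close> is the skew matrix of \<open>V\<close>, where \<open>\<tau>(Q)\<close>
  is the vector of the skew matrix \<open>G Q - Q\<^sup>T G\<close>, and where \<open>a = F \<omega>\<close> is bounded. Time enters only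
  through the gyroscopic term \<open>a \<times> V\<close>, which does no work. The change of coordinates is, at each
  time, an isometry of the state space, so all properties in question carry over
  (\<open>isometric_conjugacy\<close>, \<open>error_solution_imp_sol\<close>, \<open>sol_imp_error_solution\<close>).

  Equilibria: \<open>\<tau>(Q) = 0\<close> says that \<open>G Q\<close> is symmetric, which forces \<open>Q\<close> to commute with \<open>G\<^sup>2\<close>.
  As the \<open>l $ i\<close> are positive and distinct, \<open>Q\<close> is diagonal, hence the identity or a half-turn
  \<open>D m\<close> (\<open>equilibrium_rotations\<close>).

  Convergence: the energy \<open>E = \<Phi>(Q) + \<bar>V\<bar>\<^sup>2/2\<close> with \<open>\<Phi>(Q) = tr (G (I - Q))\<close> satisfies
  \<open>E' = - k \<bar>V\<bar>\<^sup>2\<close>. Subtracting a small multiple of \<open>V \<bullet> \<tau>(Q)\<close> gives a function that also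
  dissipates \<open>\<bar>\<tau>\<bar>\<^sup>2\<close>, so that \<open>V\<close> and \<open>\<tau>(Q)\<close> tend to zero. The critical values of \<open>\<Phi>\<close> are distinct
  and \<open>\<Phi>(Q)\<close> converges, hence every trajectory converges to one of the four equilibria
  (\<open>sol_converges\<close>). The rest of the stability statement follows from the energy: \<open>\<Phi>\<close> is comparable to
  \<open>\<bar>Q - I\<bar>\<^sup>2\<close>, and near each \<open>D m\<close> there are rotations of smaller potential, from which no
  trajectory can converge to \<open>D m\<close>.

  The exceptional set: no invariant manifold is constructed. For two trajectories that stay near
  \<open>(D m, 0)\<close> and converge to it, a quadratic form in the differences \<open>u\<close> of their torques and \<open>v\<close> of
  their velocities decreases along the motion and tends to zero, so it is nonnegative
  (\<open>pair_form_nonneg\<close>). The form is negative along the \<open>m\<close>-th axis of \<open>u\<close>. Therefore the \<open>m\<close>-th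
  coordinate of \<open>u\<close> is bounded by the other five, and a state on such a trajectory is a Lipschitz function
  of five real numbers. As trajectories can be followed backwards in time in a Lipschitz manner,
  the initial states that converge to \<open>(D m, 0)\<close> form a countable union of sets that are covered
  by Lipschitz images of five-dimensional sets, and these are null in dimension six
  (\<open>hausdorff_null_trapped\<close>). Global existence of trajectories, needed for the notion of
  convergence, comes from a contraction argument for a truncated field (\<open>solution_exists\<close>).
\<close>

section \<open>Null sets of Hausdorff measure\<close>

lemma hausdorff_null_subset:
  assumes "hausdorff_null d T" "S \<subseteq> T"
  shows "hausdorff_null d S"
  using assms unfolding hausdorff_null_def by (meson subset_trans)

text \<open>
  The \<open>n\<close>-th set gets a cover of total weight below \<open>e / 4 / 2^n\<close>. The covers are enumerated
  along pairs of indices, and the initial segments of this enumeration have bounded sums.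
\<close>

lemma hausdorff_null_UN:
  assumes "\<And>n::nat. hausdorff_null d (S n)"
  shows "hausdorff_null d (\<Union>n. S n)"
  unfolding hausdorff_null_def
proof (intro allI impI)
  fix e :: real assume "e > 0"
  have "\<forall>n. \<exists>C :: nat \<Rightarrow> 'a set. S n \<subseteq> (\<Union>i. C i) \<and> (\<forall>i. bounded (C i)) \<and>
        summable (\<lambda>i. diameter (C i) ^ d) \<and> (\<Sum>i. diameter (C i) ^ d) < e / 4 * (1/2) ^ n" (is "\<forall>n. ?P n")
  proof
    fix n
    have "e / 4 * (1/2) ^ n > 0" using \<open>e > 0\<close> by simp
    then show "?P n" using assms[of n] unfolding hausdorff_null_def by blast
  qed
  then obtain C :: "nat \<Rightarrow> nat \<Rightarrow> 'a set" where C: "\<And>n. S n \<subseteq> (\<Union>i. C n i)"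
      "\<And>n i. bounded (C n i)" "\<And>n. summable (\<lambda>i. diameter (C n i) ^ d)"
      "\<And>n. (\<Sum>i. diameter (C n i) ^ d) < e / 4 * (1/2) ^ n"
    by metis
  define f where "f p = diameter (C (fst p) (snd p)) ^ d" for p
  have f0: "f p \<ge> 0" for p unfolding f_def by (simp add: C(2) diameter_ge_0)
  have bd: "(\<Sum>k<N. f (prod_decode k)) \<le> e / 2" for N
  proof -
    have M: "prod_decode ` {..<N} \<subseteq> {..<N} \<times> {..<N}"
    proof (rule image_subsetI)
      fix k assume k: "k \<in> {..<N}"
      obtain a b where ab: "prod_decode k = (a, b)" by fastforce
      then have "k = prod_encode (a, b)" by (metis prod_decode_inverse)
      then show "prod_decode k \<in> {..<N} \<times> {..<N}"
        using le_prod_encode_1[of a b] le_prod_encode_2[of b a] k ab by auto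
    qed
    have "(\<Sum>k<N. f (prod_decode k)) = sum f (prod_decode ` {..<N})"
      by (subst sum.reindex) (auto intro: inj_on_subset[OF inj_prod_decode])
    also have "\<dots> \<le> sum f ({..<N} \<times> {..<N})"
      by (rule sum_mono2) (use M f0 in auto)
    also have "\<dots> = (\<Sum>n<N. \<Sum>i<N. f (n, i))"
      by (simp add: sum.cartesian_product)
    also have "\<dots> \<le> (\<Sum>n<N. e / 4 * (1/2) ^ n)"
    proof (rule sum_mono)
      fix n
      have "(\<Sum>i<N. f (n, i)) \<le> (\<Sum>i. diameter (C n i) ^ d)"
        unfolding f_def fst_conv snd_conv
        by (rule sum_le_suminf[OF C(3)]) (auto simp: C(2) diameter_ge_0)
      then show "(\<Sum>i<N. f (n, i)) \<le> e / 4 * (1/2) ^ n" using C(4)[of n] by simp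
    qed
    also have "\<dots> = e / 4 * (\<Sum>n<N. (1/2) ^ n)" by (simp add: sum_distrib_left)
    also have "\<dots> \<le> e / 4 * 2"
    proof -
      have "(\<Sum>n<N. (1/2::real) ^ n) \<le> (\<Sum>n. (1/2) ^ n)"
        by (rule sum_le_suminf) auto
      then show ?thesis using \<open>e > 0\<close> by (simp add: suminf_geometric)
    qed
    finally show ?thesis by simp
  qed
  have sm: "summable (\<lambda>k. f (prod_decode k))"
    by (rule summableI_nonneg_bounded[OF _ bd]) (simp add: f0)
  have "(\<Sum>k. f (prod_decode k)) \<le> e / 2"
    by (rule suminf_le_const[OF sm bd])
  moreover have "(\<Union>n. S n) \<subseteq> (\<Union>k. C (fst (prod_decode k)) (snd (prod_decode k)))"
  proof
    fix x assume "x \<in> (\<Union>n. S n)"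
    then obtain n i where "x \<in> C n i" using C(1) by blast
    then have "x \<in> C (fst (prod_decode (prod_encode (n,i)))) (snd (prod_decode (prod_encode (n,i))))" by simp
    then show "x \<in> (\<Union>k. C (fst (prod_decode k)) (snd (prod_decode k)))" by blast
  qed
  ultimately show "\<exists>C. (\<Union>n. S n) \<subseteq> (\<Union>i. C i) \<and> (\<forall>i. bounded (C i)) \<and>
        summable (\<lambda>i. diameter (C i) ^ d) \<and> (\<Sum>i. diameter (C i) ^ d) < e"
    using sm C(2) \<open>e > 0\<close> unfolding f_def
    by (intro exI[of _ "\<lambda>k. C (fst (prod_decode k)) (snd (prod_decode k))"]) auto
qed

lemma hausdorff_null_UN_countable:
  assumes "countable I" "I \<noteq> {}" "\<And>i. i \<in> I \<Longrightarrow> hausdorff_null d (S i)"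
  shows "hausdorff_null d (\<Union>i\<in>I. S i)"
proof -
  have "hausdorff_null d (\<Union>n. S (from_nat_into I n))"
    by (rule hausdorff_null_UN) (use assms in \<open>simp add: from_nat_into\<close>)
  moreover have "(\<Union>n. S (from_nat_into I n)) = (\<Union>i\<in>I. S i)"
    using range_from_nat_into[OF assms(2,1)] by (metis image_image)
  ultimately show ?thesis by simp
qed

text \<open>
  The main source of null sets: \<open>f\<close> has a Lipschitz inverse on a bounded set of smaller
  dimension \<open>n\<close>. A grid of mesh \<open>1 / N\<close> has of the order of \<open>N^n\<close> cells there, whose preimages have
  diameter of the order of \<open>1 / N\<close>; their \<open>d\<close>-th powers add up to the order of \<open>N^(n - d)\<close>, which is at most \<open>1 / N\<close>.
\<close>

lemma hausdorff_null_co_lipschitz: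
  fixes f :: "'x::metric_space \<Rightarrow> 'b::euclidean_space"
  assumes bdd: "\<And>x. x \<in> S \<Longrightarrow> norm (f x) \<le> A"
    and lip: "\<And>x y. x \<in> S \<Longrightarrow> y \<in> S \<Longrightarrow> dist x y \<le> C * dist (f x) (f y)"
    and dim: "DIM('b) < d"
  shows "hausdorff_null d S"
  unfolding hausdorff_null_def
proof (intro allI impI)
  fix e :: real assume "e > 0"
  define n where "n = DIM('b)"
  have n0: "n > 0" unfolding n_def by simp
  obtain a :: nat where a: "A \<le> real a" "a \<ge> 1"
    by (metis max.bounded_iff max.cobounded1 nle_le of_nat_mono order_trans real_arch_simple)
  define C' where "C' = max C 0"
  \<comment> \<open>the cover built from mesh \<open>1 / N\<close> will have total weight at most \<open>c / N\<close>\<close>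
  define c where "c = (3 * real a + 3) ^ n * (C' * n) ^ d"
  have "C' \<ge> 0" "C \<le> C'" unfolding C'_def by auto
  have "c \<ge> 0" unfolding c_def using \<open>C' \<ge> 0\<close> by auto
  obtain N :: nat where N: "N > 0" "c / real N < e"
  proof -
    obtain N :: nat where "c / e < real N" using reals_Archimedean2 by blast
    moreover have "0 \<le> c / e" using \<open>c \<ge> 0\<close> \<open>e > 0\<close> by simp
    ultimately have "N > 0" by linarith
    then show ?thesis using that \<open>e > 0\<close> \<open>c / e < real N\<close> by (simp add: field_simps)
  qed
  \<comment> \<open>sort the points by the cell of the grid of mesh \<open>1 / N\<close> that contains their image\<close>
  define ix where "ix x = restrict (\<lambda>b. \<lfloor>real N * (f x \<bullet> b)\<rfloor>) Basis" for x
  define J where "J = (PiE Basis (\<lambda>b::'b. {- int (a * N) .. int (a * N)}))"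
  have finJ: "finite J" unfolding J_def by (intro finite_PiE) auto
  have cardJ: "card J = (2 * a * N + 1) ^ n"
  proof -
    have "card {- int (a * N) .. int (a * N)} = 2 * a * N + 1"
      unfolding card_atLeastAtMost_int by (simp flip: of_nat_mult of_nat_add of_nat_Suc)
    then show ?thesis unfolding J_def n_def by (subst card_PiE) auto
  qed
  have ixJ: "ix x \<in> J" if "x \<in> S" for x
  proof -
    have "\<bar>f x \<bullet> b\<bar> \<le> real a" if "b \<in> Basis" for b
      using Basis_le_norm[OF that, of "f x"] bdd[OF \<open>x \<in> S\<close>] a by linarith
    then have *: "\<bar>real N * (f x \<bullet> b)\<bar> \<le> real (a * N)" if "b \<in> Basis" for b
      unfolding abs_mult of_nat_mult using that by (simp add: mult.commute mult_left_mono)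
    have "- int (a * N) \<le> \<lfloor>real N * (f x \<bullet> b)\<rfloor> \<and> \<lfloor>real N * (f x \<bullet> b)\<rfloor> \<le> int (a * N)" if "b \<in> Basis" for b
      using *[OF that] unfolding abs_le_iff by (simp add: le_floor_iff floor_le_iff)
    then show ?thesis unfolding ix_def J_def by auto
  qed
  define cell where "cell j = {x \<in> S. ix x = j}" for j
  define r where "r = C' * n / N"
  have r0: "r \<ge> 0" unfolding r_def using \<open>C' \<ge> 0\<close> by simp
  have cell_dist: "dist x y \<le> r" if "x \<in> cell j" "y \<in> cell j" for x y j
  proof -
    have xy: "x \<in> S" "y \<in> S" "ix x = ix y" using that unfolding cell_def by auto
    have "\<bar>(f x - f y) \<bullet> b\<bar> \<le> 1 / N" if "b \<in> Basis" for b
    proof -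
      have "\<lfloor>real N * (f x \<bullet> b)\<rfloor> = \<lfloor>real N * (f y \<bullet> b)\<rfloor>"
        using fun_cong[OF xy(3), of b] that unfolding ix_def by simp
      then have "\<bar>real N * (f x \<bullet> b) - real N * (f y \<bullet> b)\<bar> \<le> 1" by linarith
      then have "real N * \<bar>(f x - f y) \<bullet> b\<bar> \<le> 1"
        using N by (simp add: inner_diff_left abs_mult flip: right_diff_distrib)
      then show ?thesis using N by (simp add: field_simps)
    qed
    then have "norm (f x - f y) \<le> (\<Sum>b\<in>(Basis::'b set). 1 / N)"
      using norm_le_l1[of "f x - f y"] by (meson order_trans sum_mono)
    then have "dist (f x) (f y) \<le> real n / N" by (simp add: dist_norm n_def)
    then have "C' * dist (f x) (f y) \<le> r" unfolding r_def
      using \<open>C' \<ge> 0\<close> by (metis mult_left_mono times_divide_eq_right)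
    moreover have "C * dist (f x) (f y) \<le> C' * dist (f x) (f y)"
      using \<open>C \<le> C'\<close> by (simp add: mult_right_mono)
    ultimately show ?thesis using lip[OF xy(1,2)] by linarith
  qed
  have cell_bdd: "bounded (cell j)" for j
    unfolding bounded_def using cell_dist by metis
  have cell_diam: "diameter (cell j) \<le> r" for j
    unfolding diameter_def using r0 cell_dist by (auto intro!: cSUP_least)
  obtain g where g: "bij_betw g {0..<card J} J"
    using ex_bij_betw_nat_finite[OF finJ] by blast
  define B where "B i = (if i < card J then cell (g i) else {})" for i
  have B0: "diameter (B i) ^ d = 0" if "i \<notin> {..<card J}" for i
    using that dim unfolding B_def by simp
  have sms: "(\<lambda>i. diameter (B i) ^ d) sums (\<Sum>i<card J. diameter (B i) ^ d)"
    by (rule sums_finite) (use B0 in auto)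
  have "(\<Sum>i<card J. diameter (B i) ^ d) \<le> (\<Sum>i<card J. r ^ d)"
    by (intro sum_mono power_mono) (auto simp: B_def cell_diam cell_bdd diameter_ge_0)
  also have "\<dots> = (1 + 2 * real a * real N) ^ n * r ^ d"
    by (simp add: cardJ)
  also have "\<dots> \<le> ((3 * real a + 3) * real N) ^ n * r ^ d"
  proof -
    have "1 + 2 * real a * real N \<le> (3 * real a + 3) * real N"
      using N a by (simp add: algebra_simps) (smt (verit) mult_nonneg_nonneg of_nat_0_le_iff of_nat_1 of_nat_mono Suc_leI One_nat_def)
    then show ?thesis using r0 by (intro mult_right_mono power_mono) auto
  qed
  also have "\<dots> = c * (real N ^ n / real N ^ d)"
    unfolding c_def r_def power_mult_distrib[of _ "real N"] power_divide by simp
  also have "\<dots> \<le> c * (1 / real N)"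
  proof -
    have "real N ^ n * real N \<le> real N ^ d"
      using dim N unfolding n_def by (metis One_nat_def Suc_leI of_nat_1 of_nat_mono power_Suc2 power_increasing)
    then have "real N ^ n / real N ^ d \<le> 1 / real N" using N by (simp add: field_simps)
    then show ?thesis using \<open>c \<ge> 0\<close> mult_left_mono by blast
  qed
  finally have "(\<Sum>i<card J. diameter (B i) ^ d) < e" using N by simp
  moreover have "S \<subseteq> (\<Union>i. B i)"
  proof
    fix x assume x: "x \<in> S"
    then obtain i where "i < card J" "g i = ix x"
      using ixJ[OF x] g unfolding bij_betw_def by (metis atLeastLessThan_iff imageE)
    then have "x \<in> B i" unfolding B_def cell_def using x by simp
    then show "x \<in> (\<Union>i. B i)" by blast
  qed
  moreover have "bounded (B i)" for i unfolding B_def by (simp add: cell_bdd)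
  ultimately show "\<exists>C. S \<subseteq> (\<Union>i. C i) \<and> (\<forall>i. bounded (C i)) \<and>
        summable (\<lambda>i. diameter (C i) ^ d) \<and> (\<Sum>i. diameter (C i) ^ d) < e"
    using sms by (intro exI[of _ B]) (auto simp: sums_iff)
qed

section \<open>Differential equations on a half-line\<close>

lemma norm_fst_component_le: "norm (fst z) \<le> norm z"
  by (metis norm_fst_le prod.collapse)

lemma norm_snd_component_le: "norm (snd z) \<le> norm z"
  by (metis norm_snd_le prod.collapse)

lemma norm_le_sum_components: "norm z \<le> norm (fst z) + norm (snd z)"
  by (metis norm_Pair_le prod.collapse)

lemma antimono_if_derivative_nonpos:
  fixes f :: "real \<Rightarrow> real"
  assumes d: "\<And>t. t \<ge> t0 \<Longrightarrow> (f has_real_derivative f' t) (at t within {t0..})"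
    and np: "\<And>t. t \<ge> t0 \<Longrightarrow> f' t \<le> 0"
    and st: "t0 \<le> s" "s \<le> t"
  shows "f t \<le> f s"
proof (cases "s = t")
  case False
  then have "s < t" using st by simp
  have "(f has_derivative (\<lambda>h. f' x * h)) (at x within {s..t})" if "s \<le> x" "x \<le> t" for x
    using d[of x] that st unfolding has_field_derivative_def
    by (auto intro: has_derivative_subset)
  then obtain x where "x \<in> {s<..<t}" "f t - f s = f' x * (t - s)"
    using mvt_simple[OF \<open>s < t\<close>, of f "\<lambda>x h. f' x * h"] by auto
  then show ?thesis using np[of x] st \<open>s < t\<close>
    by (smt (verit) greaterThanLessThan_iff mult_nonpos_nonneg)
qed simp

lemma derivative_half_norm_square:
  fixes V :: "real \<Rightarrow> 'a::real_inner"
  assumes "(V has_vector_derivative v) (at t within S)"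
  shows "((\<lambda>t. (norm (V t))\<^sup>2 / 2) has_real_derivative V t \<bullet> v) (at t within S)"
proof -
  have "((\<lambda>t. V t \<bullet> V t) has_real_derivative 2 * (V t \<bullet> v)) (at t within S)"
    using bounded_bilinear.has_vector_derivative[OF bounded_bilinear_inner assms assms]
    by (simp add: has_real_derivative_iff_has_vector_derivative inner_commute)
  from DERIV_cdivide[OF this, of 2] show ?thesis by (simp add: power2_norm_eq_inner)
qed

lemma derivative_inner:
  fixes V :: "real \<Rightarrow> 'a::real_inner"
  assumes "(V has_vector_derivative v) (at t within S)" "(W has_vector_derivative w) (at t within S)"
  shows "((\<lambda>t. V t \<bullet> W t) has_real_derivative V t \<bullet> w + v \<bullet> W t) (at t within S)"
  using bounded_bilinear.has_vector_derivative[OF bounded_bilinear_inner assms]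
  by (simp add: has_real_derivative_iff_has_vector_derivative)

text \<open>
  An instance of Barbalat's principle. Since \<open>g\<close> changes at a bounded rate, each time at which \<open>g\<close> is at
  least \<open>e\<close> is followed by an interval of fixed length \<open>h\<close> on which \<open>g \<ge> e / 2\<close>, and there \<open>f\<close> drops
  by \<open>e h / 2\<close>. As \<open>f\<close> decreases and is bounded below, such drops become impossible eventually.
\<close>

lemma dissipation_tendsto_0:
  fixes f g :: "real \<Rightarrow> real"
  assumes d: "\<And>t. t \<ge> t0 \<Longrightarrow> (f has_real_derivative f' t) (at t within {t0..})"
    and diss: "\<And>t. t \<ge> t0 \<Longrightarrow> f' t \<le> - g t"
    and g0: "\<And>t. t \<ge> t0 \<Longrightarrow> 0 \<le> g t"
    and bdd: "\<And>t. t \<ge> t0 \<Longrightarrow> m \<le> f t"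
    and dg: "\<And>t. t \<ge> t0 \<Longrightarrow> (g has_real_derivative g' t) (at t within {t0..})"
    and dg_bdd: "\<And>t. t \<ge> t0 \<Longrightarrow> \<bar>g' t\<bar> \<le> C"
  shows "(g \<longlongrightarrow> 0) at_top"
proof (rule tendstoI)
  have lip: "g s - g t \<le> C * (t - s)" if "t0 \<le> s" "s \<le> t" for s t
  proof -
    have "- g t - C * t \<le> - g s - C * s"
    proof (rule antimono_if_derivative_nonpos[OF _ _ that])
      show "((\<lambda>t. - g t - C * t) has_real_derivative - g' t - C) (at t within {t0..})" if "t \<ge> t0" for t
        using dg[OF that] by (auto intro!: derivative_eq_intros)
      show "- g' t - C \<le> 0" if "t \<ge> t0" for t using dg_bdd[OF that] by linarith
    qed
    then show ?thesis by (simp add: algebra_simps)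
  qed
  fix e :: real assume "e > 0"
  define h where "h = e / (2 * (\<bar>C\<bar> + 1))"
  have h: "h > 0" "C * h \<le> e / 2"
  proof -
    show "h > 0" unfolding h_def using \<open>e > 0\<close> by simp
    then have "C * h \<le> (\<bar>C\<bar> + 1) * h" by (intro mult_right_mono) auto
    also have "\<dots> = e / 2" unfolding h_def by (simp add: field_simps)
    finally show "C * h \<le> e / 2" .
  qed
  define \<mu> where "\<mu> = Inf (f ` {t0..})"
  have bb: "bdd_below (f ` {t0..})" by (rule bdd_belowI2[of _ m]) (use bdd in auto)
  have low: "\<mu> \<le> f t" if "t \<ge> t0" for t unfolding \<mu>_def
    by (rule cInf_lower) (use that bb in auto)
  obtain T where T: "T \<ge> t0" "f T < \<mu> + e / 2 * h"
  proof -
    have "\<mu> < \<mu> + e / 2 * h" using h \<open>e > 0\<close> by simp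
    then have "\<exists>y\<in>f ` {t0..}. y < \<mu> + e / 2 * h"
      unfolding \<mu>_def by (intro cInf_lessD) auto
    then show ?thesis using that by auto
  qed
  have "g t < e" if "t \<ge> T" for t
  proof (rule ccontr)
    assume "\<not> g t < e"
    then have gt: "g t \<ge> e" by simp
    have t: "t \<ge> t0" using that T by simp
    have gs: "g s \<ge> e / 2" if "t \<le> s" "s \<le> t + h" for s
    proof -
      have "C * (s - t) \<le> \<bar>C\<bar> * h"
        using that by (intro mult_mono) auto
      also have "\<dots> \<le> (\<bar>C\<bar> + 1) * h" using h by (simp add: mult_right_mono)
      also have "\<dots> = e / 2" unfolding h_def by (simp add: field_simps)
      finally show ?thesis using lip[of t s] t that gt by linarith
    qed
    have "(f has_derivative (\<lambda>k. f' x * k)) (at x within {t..t+h})" if "t \<le> x" "x \<le> t + h" for x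
      using d[of x] that t unfolding has_field_derivative_def
      by (auto intro: has_derivative_subset)
    then obtain x where x: "x \<in> {t<..<t+h}" "f (t + h) - f t = f' x * h"
      using mvt_simple[of t "t + h" f "\<lambda>x k. f' x * k"] h by auto
    have np: "f' s \<le> 0" if "t0 \<le> s" for s using diss[OF that] g0[OF that] by linarith
    have "f' x \<le> - (e / 2)" using diss[of x] gs[of x] x t by auto
    then have "f' x * h \<le> - (e / 2) * h" using h by (intro mult_right_mono) auto
    moreover have "f t \<le> f T"
      by (rule antimono_if_derivative_nonpos[of t0 f f'])
         (use d np T that in auto)
    moreover have "\<mu> \<le> f (t + h)" using low t h by simp
    ultimately show False using x T by (simp add: algebra_simps)
  qed
  then have "\<forall>t\<ge>max T t0. dist (g t) 0 < e" using g0 by auto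
  then show "\<forall>\<^sub>F t in at_top. dist (g t) 0 < e" unfolding eventually_at_top_linorder by blast
qed

lemma tendsto_bounded_antimono:
  fixes f :: "real \<Rightarrow> real"
  assumes anti: "\<And>s t. t0 \<le> s \<Longrightarrow> s \<le> t \<Longrightarrow> f t \<le> f s"
    and bdd: "\<And>t. t0 \<le> t \<Longrightarrow> m \<le> f t"
  obtains c where "(f \<longlongrightarrow> c) at_top"
proof
  define c where "c = Inf (f ` {t0..})"
  have bb: "bdd_below (f ` {t0..})" by (rule bdd_belowI2[of _ m]) (use bdd in auto)
  show "(f \<longlongrightarrow> c) at_top"
  proof (rule order_tendstoI)
    fix y assume "y < c"
    moreover have "c \<le> f t" if "t \<ge> t0" for t unfolding c_def
      by (rule cInf_lower) (use that bb in auto)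
    ultimately have "\<forall>t\<ge>t0. y < f t" by fastforce
    then show "\<forall>\<^sub>F t in at_top. y < f t" unfolding eventually_at_top_linorder by blast
  next
    fix y assume "c < y"
    then have "\<exists>z\<in>f ` {t0..}. z < y" unfolding c_def by (intro cInf_lessD) auto
    then obtain s where "s \<ge> t0" "f s < y" by auto
    then have "\<forall>t\<ge>s. f t < y" using anti by (meson order_le_less_trans)
    then show "\<forall>\<^sub>F t in at_top. f t < y" unfolding eventually_at_top_linorder by blast
  qed
qed

text \<open>
  Outside every neighbourhood of its only zero \<open>q\<close>, the function \<open>\<bar>f\<bar>\<close> has a positive minimum on
  the compact set.
\<close>

lemma compact_tendsto_zero:
  fixes f :: "'a::metric_space \<Rightarrow> real"
  assumes C: "compact C" and f: "continuous_on C f"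
    and zero: "\<And>x. x \<in> C \<Longrightarrow> f x = 0 \<Longrightarrow> x = q"
    and ev: "\<forall>\<^sub>F t in at_top. Q t \<in> C" and lim: "((\<lambda>t :: real. f (Q t)) \<longlongrightarrow> 0) at_top"
  shows "(Q \<longlongrightarrow> q) at_top"
proof (rule topological_tendstoI)
  fix N assume N: "open N" "q \<in> N"
  show "\<forall>\<^sub>F t in at_top. Q t \<in> N"
  proof (cases "C - N = {}")
    case True
    then show ?thesis using ev by (auto elim: eventually_mono)
  next
    case False
    have "compact (C - N)" using C N by (simp add: compact_diff)
    moreover have "continuous_on (C - N) (\<lambda>x. \<bar>f x\<bar>)"
      using f by (auto intro: continuous_intros continuous_on_subset)
    ultimately obtain x where x: "x \<in> C - N" "\<And>y. y \<in> C - N \<Longrightarrow> \<bar>f x\<bar> \<le> \<bar>f y\<bar>"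
      using continuous_attains_inf[of "C - N" "\<lambda>x. \<bar>f x\<bar>"] False by blast
    then have "\<bar>f x\<bar> > 0" using zero N by auto
    then have "\<forall>\<^sub>F t in at_top. \<bar>f (Q t)\<bar> < \<bar>f x\<bar>"
      using tendstoD[OF lim] by (auto simp: dist_norm)
    then show ?thesis using ev
      by eventually_elim (use x in force)
  qed
qed

text \<open>
  The exponential weight lets the Picard operator of a globally Lipschitz field be a contraction
  on a whole half-line, so that solutions need not be continued from interval to interval.
\<close>

lemma exp_weighted_integral_bound:
  fixes f :: "real \<Rightarrow> 'a::euclidean_space"
  assumes "continuous_on {t0..t} f" "a > 0" "t0 \<le> t" "B \<ge> 0"
    and f: "\<And>s. t0 \<le> s \<Longrightarrow> s \<le> t \<Longrightarrow> norm (f s) \<le> B * exp (a * (s - t0))"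
  shows "norm (exp (- (a * (t - t0))) *\<^sub>R integral {t0..t} f) \<le> B / a"
proof -
  have int: "((\<lambda>s. B * exp (a * (s - t0))) has_integral
      B / a * exp (a * (t - t0)) - B / a * exp (a * (t0 - t0))) {t0..t}"
    by (rule fundamental_theorem_of_calculus[OF assms(3)])
       (use \<open>a > 0\<close> in \<open>auto intro!: derivative_eq_intros
          simp flip: has_real_derivative_iff_has_vector_derivative\<close>)
  have "norm (integral {t0..t} f) \<le> integral {t0..t} (\<lambda>s. B * exp (a * (s - t0)))"
    by (rule integral_norm_bound_integral)
       (use assms int in \<open>auto intro: integrable_continuous_real\<close>)
  also have "\<dots> \<le> B / a * exp (a * (t - t0))"
    unfolding integral_unique[OF int] using assms by simp
  finally have "exp (- (a * (t - t0))) * norm (integral {t0..t} f)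
      \<le> exp (- (a * (t - t0))) * (B / a * exp (a * (t - t0)))"
    by (intro mult_left_mono) auto
  also have "\<dots> = B / a"
  proof -
    have "exp (- z) * (c * exp z) = c" for z c :: real by (simp add: exp_minus field_simps)
    then show ?thesis .
  qed
  finally show ?thesis by simp
qed

lemma integral_has_vector_derivative_halfline:
  fixes f :: "real \<Rightarrow> 'a::euclidean_space"
  assumes "continuous_on {t0..} f" "t0 \<le> t"
  shows "((\<lambda>t. integral {t0..t} f) has_vector_derivative f t) (at t within {t0..})"
proof -
  have "((\<lambda>t. integral {t0..t} f) has_vector_derivative f t) (at t within {t0..t+1})"
    by (rule integral_has_vector_derivative)
       (use assms in \<open>auto intro: continuous_on_subset\<close>)
  moreover have "at t within {t0..t+1} = at t within {t0..}"
    by (rule at_within_nhd[of t "{..<t+1}"]) auto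
  ultimately show ?thesis by simp
qed

text \<open>
  Solutions are sought in the form \<open>x t = x0 + exp (a (t - t0)) u t\<close> with \<open>u\<close> bounded and
  continuous. With \<open>a\<close> twice the Lipschitz constant, the integral equation becomes a fixed-point
  equation for \<open>u\<close> with contraction constant \<open>1 / 2\<close>.
\<close>

lemma global_lipschitz_ode_existence:
  fixes F :: "real \<Rightarrow> 'a::euclidean_space \<Rightarrow> 'a"
  assumes cont: "\<And>x. continuous_on {t0..} x \<Longrightarrow> continuous_on {t0..} (\<lambda>t. F t (x t))"
    and lip: "\<And>t x y. t \<ge> t0 \<Longrightarrow> norm (F t x - F t y) \<le> L * norm (x - y)"
    and bdd: "\<And>t. t \<ge> t0 \<Longrightarrow> norm (F t x0) \<le> C"
  shows "\<exists>x. x t0 = x0 \<and> (\<forall>t\<ge>t0. (x has_vector_derivative F t (x t)) (at t within {t0..}))"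
proof -
  define M where "M = max L 1"
  have M: "M \<ge> 1" "M > 0" unfolding M_def by auto
  have lipM: "norm (F t x - F t y) \<le> M * norm (x - y)" if "t \<ge> t0" for t x y
    using lip[OF that, of x y] unfolding M_def
    by (smt (verit) max_def mult_right_mono norm_ge_zero)
  have C0: "C \<ge> 0" using bdd[of t0] norm_ge_zero[of "F t0 x0"] by linarith
  define a where "a = 2 * M"
  have a: "a > 0" unfolding a_def using M by simp
  define y where "y u s = x0 + exp (a * (s - t0)) *\<^sub>R apply_bcontfun u s" for u :: "real \<Rightarrow>\<^sub>C 'a" and s
  \<comment> \<open>\<open>max t0 t\<close> extends the operator to all of \<open>real\<close>, the domain of the bounded continuous functions\<close>
  define G where "G u t = exp (- (a * (max t0 t - t0))) *\<^sub>R integral {t0..max t0 t} (\<lambda>s. F s (y u s))" for u t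
  have ycont: "continuous_on {t0..} (\<lambda>s. F s (y u s))" for u
    by (rule cont) (auto simp: y_def intro!: continuous_intros)
  have ycont_Icc: "continuous_on {t0..t} (\<lambda>s. F s (y u s))" for u t
    by (rule continuous_on_subset[OF ycont]) auto
  have Gcont: "continuous_on UNIV (G u)" for u
  proof -
    have "continuous_on {t0..} (\<lambda>t. integral {t0..t} (\<lambda>s. F s (y u s)))"
      using integral_has_vector_derivative_halfline[OF ycont]
      by (meson atLeast_iff continuous_on_eq_continuous_within has_vector_derivative_continuous)
    then have "continuous_on UNIV (\<lambda>t. integral {t0..max t0 t} (\<lambda>s. F s (y u s)))"
      by (rule continuous_on_compose2[where f = "max t0"]) (auto intro!: continuous_intros)
    then show ?thesis unfolding G_def by (auto intro!: continuous_intros)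
  qed
  have Gbdd: "norm (G u t) \<le> (C + M * norm u) / a" for u t
    unfolding G_def
  proof (rule exp_weighted_integral_bound)
    fix s assume s: "t0 \<le> s"
    have e1: "1 \<le> exp (a * (s - t0))" using s a by simp
    have "norm (F s (y u s)) \<le> norm (F s x0) + norm (F s (y u s) - F s x0)"
      by (metis add.commute norm_triangle_sub)
    also have "\<dots> \<le> C + M * norm (y u s - x0)" using bdd[OF s] lipM[OF s] by (intro add_mono) auto
    also have "norm (y u s - x0) = exp (a * (s - t0)) * norm (apply_bcontfun u s)" unfolding y_def by simp
    also have "C + M * (exp (a * (s - t0)) * norm (apply_bcontfun u s))
        \<le> C * exp (a * (s - t0)) + M * (exp (a * (s - t0)) * norm u)"
      using C0 e1 M norm_bounded[of u s] by (intro add_mono mult_left_mono) (auto simp: mult_le_cancel_left1)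
    also have "\<dots> = (C + M * norm u) * exp (a * (s - t0))" by (simp add: algebra_simps)
    finally show "norm (F s (y u s)) \<le> (C + M * norm u) * exp (a * (s - t0))" .
  qed (use a C0 M ycont_Icc in auto)
  define H where "H u = Bcontfun (G u)" for u
  have H: "apply_bcontfun (H u) = G u" for u
    unfolding H_def by (rule Bcontfun_inverse) (use Gcont Gbdd in \<open>auto intro: bcontfun_normI\<close>)
  have contr: "dist (H u) (H v) \<le> 1 / 2 * dist u v" for u v
  proof (rule dist_bound)
    fix t
    have int: "(\<lambda>s. F s (y u s)) integrable_on {t0..max t0 t}" for u
      by (rule integrable_continuous_real) (rule continuous_on_subset[OF ycont], auto)
    have "dist (G u t) (G v t) = norm (exp (- (a * (max t0 t - t0))) *\<^sub>R
        integral {t0..max t0 t} (\<lambda>s. F s (y u s) - F s (y v s)))"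
      unfolding G_def dist_norm by (simp add: integral_diff[OF int int] scaleR_diff_right)
    also have "\<dots> \<le> M * dist u v / a"
    proof (rule exp_weighted_integral_bound)
      fix s assume s: "t0 \<le> s"
      have "norm (F s (y u s) - F s (y v s)) \<le> M * norm (y u s - y v s)" by (rule lipM[OF s])
      also have "norm (y u s - y v s) = exp (a * (s - t0)) * dist (apply_bcontfun u s) (apply_bcontfun v s)"
        unfolding y_def by (simp add: dist_norm flip: scaleR_diff_right)
      also have "M * \<dots> \<le> M * (exp (a * (s - t0)) * dist u v)"
        using M by (intro mult_left_mono dist_bounded) auto
      finally show "norm (F s (y u s) - F s (y v s)) \<le> M * dist u v * exp (a * (s - t0))"
        by (simp add: algebra_simps)
    qed (use a M ycont_Icc in \<open>auto intro!: continuous_on_diff\<close>)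
    also have "\<dots> = 1 / 2 * dist u v" unfolding a_def using M by simp
    finally show "dist (apply_bcontfun (H u) t) (apply_bcontfun (H v) t) \<le> 1 / 2 * dist u v"
      unfolding H .
  qed
  obtain u where u: "H u = u"
    using banach_fix_type[of "1/2" H] contr by auto
  have yu: "y u t = x0 + integral {t0..t} (\<lambda>s. F s (y u s))" if "t \<ge> t0" for t
  proof -
    have "apply_bcontfun u t = G u t" using H[of u] u by simp
    then show ?thesis unfolding y_def[of u t] using that
      by (simp add: G_def max_absorb2 exp_minus)
  qed
  have "y u t0 = x0" using yu[of t0] by simp
  moreover have "(y u has_vector_derivative F t (y u t)) (at t within {t0..})" if "t \<ge> t0" for t
  proof (rule has_vector_derivative_transform[where f = "\<lambda>t. x0 + integral {t0..t} (\<lambda>s. F s (y u s))"])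
    show "((\<lambda>t. x0 + integral {t0..t} (\<lambda>s. F s (y u s))) has_vector_derivative F t (y u t)) (at t within {t0..})"
      using has_vector_derivative_add[OF has_vector_derivative_const[of x0]
          integral_has_vector_derivative_halfline[OF ycont that]] by simp
  qed (use that yu in auto)
  ultimately show ?thesis by blast
qed

definition clamp_ball :: "real \<Rightarrow> 'a::euclidean_space \<Rightarrow> 'a" where
  "clamp_ball r = closest_point (cball 0 r)"

lemma clamp_ball:
  assumes "r > 0"
  shows "norm (clamp_ball r x - clamp_ball r y) \<le> norm (x - y)" "norm (clamp_ball r x) \<le> r"
    "continuous_on S (clamp_ball r)" "norm x \<le> r \<Longrightarrow> clamp_ball r x = x"
  unfolding clamp_ball_def
  using assms closest_point_lipschitz[of "cball 0 r" x y] closest_point_in_set[of "cball 0 r" x]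
    continuous_on_closest_point[of "cball 0 r" S] by (simp_all add: dist_norm closest_point_self)

text \<open>
  Truncation by projection onto a ball only rescales its argument. This is what makes a truncated
  linear field \<open>A \<mapsto> A ** skew w\<close> tangent to the spheres, as the original field is.
\<close>

lemma clamp_radial:
  fixes x :: "'a::euclidean_space"
  assumes "r > 0"
  obtains c where "clamp_ball r x = c *\<^sub>R x"
proof (cases "norm x \<le> r")
  case True
  then show ?thesis using that[of 1] assms by (simp add: clamp_ball(4))
next
  case False
  have "(r / norm x) *\<^sub>R x = closest_point (cball 0 r) x"
  proof (rule closest_point_unique)
    show "(r / norm x) *\<^sub>R x \<in> cball 0 r" using False assms by (auto simp: norm_divide)
    show "\<forall>z\<in>cball 0 r. dist x ((r / norm x) *\<^sub>R x) \<le> dist x z"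
    proof
      fix z :: 'a assume "z \<in> cball 0 r"
      have "x - (r / norm x) *\<^sub>R x = (1 - r / norm x) *\<^sub>R x" by (simp add: algebra_simps)
      then have "dist x ((r / norm x) *\<^sub>R x) = \<bar>1 - r / norm x\<bar> * norm x" by (simp add: dist_norm)
      also have "\<dots> = norm x - r" using False assms
        by (subst abs_of_nonneg) (auto simp: field_simps divide_le_eq)
      also have "\<dots> \<le> dist x z" using \<open>z \<in> cball 0 r\<close> norm_triangle_ineq2[of x z] by (simp add: dist_norm)
      finally show "dist x ((r / norm x) *\<^sub>R x) \<le> dist x z" .
    qed
  qed auto
  then show ?thesis using that unfolding clamp_ball_def by metis
qed

section \<open>Rotations and skew-symmetric matrices\<close>

declare transpose_matrix_vector [simp del]

lemma cross3_component [simp]: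
  "cross3 v w $ 1 = v $ 2 * w $ 3 - v $ 3 * w $ 2"
  "cross3 v w $ 2 = v $ 3 * w $ 1 - v $ 1 * w $ 3"
  "cross3 v w $ 3 = v $ 1 * w $ 2 - v $ 2 * w $ 1"
  by (simp_all add: cross3_def)

lemma skew_mult_vec [simp]: "skew w *v v = cross3 w v"
proof -
  have "linear (\<lambda>v. cross3 w v)"
    using bilinear_cross unfolding bilinear_def by blast
  then show ?thesis unfolding skew_def by (simp add: matrix_works)
qed

lemma skew_component [simp]:
  "skew w $ 1 $ 1 = 0" "skew w $ 1 $ 2 = - w $ 3" "skew w $ 1 $ 3 = w $ 2"
  "skew w $ 2 $ 1 = w $ 3" "skew w $ 2 $ 2 = 0" "skew w $ 2 $ 3 = - w $ 1"
  "skew w $ 3 $ 1 = - w $ 2" "skew w $ 3 $ 2 = w $ 1" "skew w $ 3 $ 3 = 0"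
  by (simp_all add: skew_def matrix_def axis_def)

lemma matrix3_mult_component:
  "((A :: real^3^3) ** B) $ i $ j = A $ i $ 1 * B $ 1 $ j + A $ i $ 2 * B $ 2 $ j + A $ i $ 3 * B $ 3 $ j"
  by (simp add: matrix_matrix_mult_def sum_3)

lemma matrix3_mult_vec_component:
  "((A :: real^3^3) *v v) $ i = A $ i $ 1 * v $ 1 + A $ i $ 2 * v $ 2 + A $ i $ 3 * v $ 3"
  by (simp add: matrix_vector_mult_def sum_3)

lemma transpose_component [simp]: "transpose A $ i $ j = A $ j $ i"
  by (simp add: transpose_def)

lemma mat_component [simp]: "mat c $ i $ j = (if i = j then c else 0)"
  by (simp add: mat_def)

lemma D_component: "D m $ i $ j = (if i = j then (if i = m then 1 else -1) else 0)"
  by (simp add: D_def outer_def column_def)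

lemma mult_D_component:
  "(A ** D m) $ i $ j = A $ i $ j * (if j = m then 1 else - 1)"
  "(D m ** A) $ i $ j = (if i = m then 1 else - 1) * A $ i $ j"
  using exhaust_3[of i] exhaust_3[of j] by (auto simp: matrix3_mult_component D_component)

lemma transpose_skew: "transpose (skew w) = - skew w"
  by (simp add: vec_eq_iff forall_3)

lemma inner_matrix3:
  "(A :: real^3^3) \<bullet> B = A$1$1 * B$1$1 + A$1$2 * B$1$2 + A$1$3 * B$1$3
     + A$2$1 * B$2$1 + A$2$2 * B$2$2 + A$2$3 * B$2$3
     + A$3$1 * B$3$1 + A$3$2 * B$3$2 + A$3$3 * B$3$3"
  by (simp add: inner_vec_def sum_3)

lemma inner_vec3: "(v :: real^3) \<bullet> w = v$1 * w$1 + v$2 * w$2 + v$3 * w$3"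
  by (simp add: inner_vec_def sum_3)

lemma inner_mult_skew_self: "(A :: real^3^3) \<bullet> (A ** skew w) = 0"
  by (simp add: inner_matrix3 matrix3_mult_component algebra_simps)

lemma inner_cross3_self [simp]: "w \<bullet> cross3 v w = 0"
  by (simp add: inner_vec3 algebra_simps)

lemma norm_cross3_le: "norm (cross3 v w) \<le> norm v * norm w"
proof -
  have "(norm (cross3 v w))\<^sup>2 \<le> (norm v * norm w)\<^sup>2"
    using norm_cross[of v w] by (simp add: power_mult_distrib)
  then show ?thesis by (simp add: power2_le_iff_abs_le)
qed

lemma bounded_linear_skew: "bounded_linear skew"
  unfolding linear_conv_bounded_linear[symmetric]
  by (rule linearI) (simp_all add: vec_eq_iff forall_3)

lemma bounded_linear_transpose: "bounded_linear (transpose :: real^3^3 \<Rightarrow> real^3^3)"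
  unfolding linear_conv_bounded_linear[symmetric]
  by (rule linearI) (simp_all add: vec_eq_iff)

lemma bounded_bilinear_matrix_mult: "bounded_bilinear ((**) :: real^3^3 \<Rightarrow> real^3^3 \<Rightarrow> real^3^3)"
  unfolding bilinear_conv_bounded_bilinear[symmetric] bilinear_def
  by (auto intro!: linearI simp: vec_eq_iff matrix3_mult_component algebra_simps)

lemma bounded_bilinear_matrix_vec_mult: "bounded_bilinear ((*v) :: real^3^3 \<Rightarrow> real^3 \<Rightarrow> real^3)"
  unfolding bilinear_conv_bounded_bilinear[symmetric] bilinear_def
  by (auto intro!: linearI simp: vec_eq_iff matrix3_mult_vec_component algebra_simps)

lemma bounded_bilinear_cross3: "bounded_bilinear cross3"
  using bilinear_cross bilinear_conv_bounded_bilinear by blast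

lemma bounded_bilinear_mult_skew: "bounded_bilinear (\<lambda>(A :: real^3^3) w. A ** skew w)"
  by (rule bounded_bilinear.comp[OF bounded_bilinear_matrix_mult bounded_linear_ident bounded_linear_skew])

lemmas vector_derivative_mult =
  bounded_bilinear.has_vector_derivative[OF bounded_bilinear_matrix_mult]
lemmas vector_derivative_mult_vec =
  bounded_bilinear.has_vector_derivative[OF bounded_bilinear_matrix_vec_mult]
lemmas vector_derivative_transpose =
  bounded_linear.has_vector_derivative[OF bounded_linear_transpose]

lemma rotation_matrix_mult_transpose:
  assumes "rotation_matrix Q"
  shows "Q ** transpose Q = mat 1" "transpose Q ** Q = mat 1"
  using assms unfolding rotation_matrix_def orthogonal_matrix_def by auto

lemma rotation_matrix_mul: "rotation_matrix (P :: real^3^3) \<Longrightarrow> rotation_matrix Q \<Longrightarrow> rotation_matrix (P ** Q)"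
  unfolding rotation_matrix_def using orthogonal_matrix_mul[of P Q] by (simp add: det_mul)

lemma rotation_matrix_transpose: "rotation_matrix (transpose Q) \<longleftrightarrow> rotation_matrix Q"
  unfolding rotation_matrix_def by (simp add: orthogonal_matrix_transpose)

lemma rotation_matrix_one: "rotation_matrix (mat 1)"
  unfolding rotation_matrix_def by (simp add: orthogonal_matrix_id)

lemma rotation_matrix_D: "rotation_matrix (D m)"
  unfolding rotation_matrix_def orthogonal_matrix det_3
  using exhaust_3[of m] by (auto simp: vec_eq_iff forall_3 matrix3_mult_component D_component)

lemma norm_rotation_mult_vec: "rotation_matrix (Q :: real^3^3) \<Longrightarrow> norm (Q *v v) = norm v"
  using orthogonal_transformation_matrix[of "(*v) Q"] orthogonal_transformation[of "(*v) Q"]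
  unfolding rotation_matrix_def by simp

lemma norm_power2_rotation:
  assumes "rotation_matrix (Q :: real^3^3)"
  shows "(norm Q)\<^sup>2 = 3"
proof -
  have e: "(Q ** transpose Q) $ i $ i = 1" for i
    using rotation_matrix_mult_transpose[OF assms] by simp
  show ?thesis unfolding power2_norm_eq_inner inner_matrix3
    using e[of 1] e[of 2] e[of 3] by (simp add: matrix3_mult_component)
qed

lemma norm_rotation_le: "rotation_matrix (Q :: real^3^3) \<Longrightarrow> norm Q \<le> 2"
  using norm_power2_rotation[of Q] power2_le_imp_le[of "norm Q" 2] by simp

lemma rotation_diag_le_1:
  assumes "rotation_matrix (Q :: real^3^3)"
  shows "Q $ i $ i \<le> 1"
proof -
  have "(Q ** transpose Q) $ i $ i = 1"
    using rotation_matrix_mult_transpose[OF assms] by simp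
  then have "(Q$i$1)\<^sup>2 + (Q$i$2)\<^sup>2 + (Q$i$3)\<^sup>2 = 1"
    by (simp add: matrix3_mult_component power2_eq_square)
  then have "(Q$i$i)\<^sup>2 \<le> 1" using exhaust_3[of i]
    by (elim disjE) (simp_all add: algebra_simps, (smt (verit) zero_le_power2)+)
  then show ?thesis by (simp add: power2_le_iff_abs_le abs_le_iff abs_square_le_1)
qed

lemma norm_power2_rotation_minus_one:
  assumes "rotation_matrix (Q :: real^3^3)"
  shows "(norm (Q - mat 1))\<^sup>2 = 2 * (\<Sum>i\<in>UNIV. 1 - Q $ i $ i)"
proof -
  have "(norm (Q - mat 1))\<^sup>2 = (norm Q)\<^sup>2 - 2 * (Q \<bullet> mat 1) + (mat 1 :: real^3^3) \<bullet> mat 1"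
    unfolding power2_norm_eq_inner by (simp add: inner_diff_left inner_diff_right inner_commute)
  also have "\<dots> = 2 * (\<Sum>i\<in>UNIV. 1 - Q $ i $ i)"
    unfolding norm_power2_rotation[OF assms] by (simp add: inner_matrix3 sum_3)
  finally show ?thesis .
qed

lemma continuous_on_det3: "continuous_on S (det :: real^3^3 \<Rightarrow> real)"
  unfolding det_3 by (intro continuous_intros)

lemma compact_rotations: "compact {Q :: real^3^3. rotation_matrix Q}"
  unfolding compact_eq_bounded_closed
proof
  show "bounded {Q :: real^3^3. rotation_matrix Q}"
    unfolding bounded_iff using norm_rotation_le by blast
  have eq: "{Q :: real^3^3. rotation_matrix Q} = {Q. Q ** transpose Q = mat 1} \<inter> {Q. det Q = 1}"
    unfolding rotation_matrix_def using orthogonal_matrix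
    by (auto simp: orthogonal_matrix_def matrix_left_right_inverse)
  have "closed {Q :: real^3^3. Q ** transpose Q = mat 1}"
    by (intro closed_Collect_eq continuous_on_const
        bounded_bilinear.continuous_on[OF bounded_bilinear_matrix_mult] continuous_on_id
        bounded_linear.continuous_on[OF bounded_linear_transpose])
  moreover have "closed {Q :: real^3^3. det Q = 1}"
    by (intro closed_Collect_eq continuous_on_const continuous_on_det3)
  ultimately show "closed {Q :: real^3^3. rotation_matrix Q}" unfolding eq by (rule closed_Int)
qed

text \<open>
  \<open>Q Q\<^sup>T\<close> is constant because \<open>skew w\<close> is antisymmetric, and the determinant is continuous with
  values in \<open>{1, - 1}\<close>.
\<close>

lemma rotation_invariant:
  assumes d: "\<And>t. t \<ge> t0 \<Longrightarrow> (Q has_vector_derivative Q t ** skew (w t)) (at t within {t0..})"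
    and init: "rotation_matrix (Q t0 :: real^3^3)" and "t \<ge> t0"
  shows "rotation_matrix (Q t)"
proof -
  have "((\<lambda>t. Q t ** transpose (Q t)) has_vector_derivative 0) (at t within {t0..})" if "t \<ge> t0" for t
  proof -
    have "((\<lambda>t. Q t ** transpose (Q t)) has_vector_derivative
        Q t ** transpose (Q t ** skew (w t)) + (Q t ** skew (w t)) ** transpose (Q t)) (at t within {t0..})" (is "(_ has_vector_derivative ?d) _")
      by (intro vector_derivative_mult vector_derivative_transpose d that)
    also have "?d = 0"
      unfolding matrix_transpose_mul transpose_skew
      by (simp add: vec_eq_iff matrix3_mult_component algebra_simps)
    finally show ?thesis .
  qed
  then obtain C where "\<And>t. t \<in> {t0..} \<Longrightarrow> Q t ** transpose (Q t) = C"
    using has_vector_derivative_zero_constant[of "{t0..}" "\<lambda>t. Q t ** transpose (Q t)"] by auto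
  then have QQ: "Q t ** transpose (Q t) = mat 1" if "t \<ge> t0" for t
    using that rotation_matrix_mult_transpose[OF init] by fastforce
  then have orth: "orthogonal_matrix (Q t)" if "t \<ge> t0" for t
    using that by (auto simp: orthogonal_matrix_def matrix_left_right_inverse)
  have "continuous_on {t0..} Q"
    using d by (meson atLeast_iff continuous_on_eq_continuous_within has_vector_derivative_continuous)
  then have "continuous_on {t0..} (\<lambda>t. det (Q t))"
    by (rule continuous_on_compose2[OF continuous_on_det3]) auto
  then have con: "connected ((\<lambda>t. det (Q t)) ` {t0..})"
    by (rule connected_continuous_image) simp
  have "(\<lambda>t. det (Q t)) ` {t0..} \<subseteq> {1, -1}" using orth det_orthogonal_matrix by blast
  then have "finite ((\<lambda>t. det (Q t)) ` {t0..})" by (rule finite_subset) auto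
  then obtain c where "(\<lambda>t. det (Q t)) ` {t0..} = {c}"
    using connected_finite_iff_sing[OF con] by auto
  then have "det (Q t) = det (Q t0)" using \<open>t \<ge> t0\<close> by (metis atLeast_iff image_eqI order_refl singletonD)
  then show ?thesis using orth \<open>t \<ge> t0\<close> init unfolding rotation_matrix_def by simp
qed

text \<open>
  Conjugation by a rotation turns the skew matrix of \<open>w\<close> into that of \<open>R *v w\<close>, since rotations
  preserve cross products.
\<close>

lemma rotation_mult_skew:
  assumes "rotation_matrix R"
  shows "R ** skew w = skew (R *v w) ** R"
proof -
  have "(R ** skew w) *v x = (skew (R *v w) ** R) *v x" for x
    using cross_rotation_matrix[OF assms, of w x] by (simp flip: matrix_vector_mul_assoc)
  then show ?thesis using matrix_eq by blast
qed

lemma norm_transpose: "norm (transpose A :: real^3^3) = norm A"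
  unfolding norm_eq_sqrt_inner inner_matrix3 by (simp add: algebra_simps)

lemma norm_mult_rotation:
  assumes "rotation_matrix P"
  shows "norm (A ** P) = norm (A :: real^3^3)" "norm (P ** A) = norm A"
proof -
  have right: "norm (A ** P) = norm A" if "rotation_matrix P" for A P :: "real^3^3"
  proof -
    have "(A ** P) $ i = transpose P *v (A $ i)" for i
      by (simp add: vec_eq_iff forall_3 matrix3_mult_component matrix3_mult_vec_component algebra_simps)
    then have "norm ((A ** P) $ i) = norm (A $ i)" for i
      using norm_rotation_mult_vec[of "transpose P"] that
      by (simp add: rotation_matrix_transpose)
    then show ?thesis unfolding norm_vec_def by simp
  qed
  show "norm (A ** P) = norm A" by (rule right[OF assms])
  have "norm (P ** A) = norm (transpose A ** transpose P)"
    using norm_transpose[of "P ** A"] by (simp add: matrix_transpose_mul)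
  also have "\<dots> = norm A" using right[of "transpose P"] assms by (simp add: rotation_matrix_transpose norm_transpose)
  finally show "norm (P ** A) = norm A" .
qed

lemma rotation_cancel:
  assumes "rotation_matrix (R :: real^3^3)"
  shows "X ** R ** transpose R = X" "X ** transpose R ** R = X"
    "transpose R *v (R *v v) = v" "R *v (transpose R *v v) = v"
  using rotation_matrix_mult_transpose[OF assms]
  by (simp_all add: matrix_vector_mul_assoc flip: matrix_mul_assoc)

lemmas matrix_mult_simps =
  bounded_bilinear.add_left[OF bounded_bilinear_matrix_mult]
  bounded_bilinear.add_right[OF bounded_bilinear_matrix_mult]
  bounded_bilinear.diff_left[OF bounded_bilinear_matrix_mult]
  bounded_bilinear.diff_right[OF bounded_bilinear_matrix_mult]
  bounded_bilinear.minus_left[OF bounded_bilinear_matrix_mult]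
  bounded_bilinear.minus_right[OF bounded_bilinear_matrix_mult]

lemmas matrix_vec_mult_simps =
  bounded_bilinear.add_left[OF bounded_bilinear_matrix_vec_mult]
  bounded_bilinear.add_right[OF bounded_bilinear_matrix_vec_mult]
  bounded_bilinear.diff_left[OF bounded_bilinear_matrix_vec_mult]
  bounded_bilinear.diff_right[OF bounded_bilinear_matrix_vec_mult]
  bounded_bilinear.minus_left[OF bounded_bilinear_matrix_vec_mult]
  bounded_bilinear.minus_right[OF bounded_bilinear_matrix_vec_mult]
  bounded_bilinear.scaleR_left[OF bounded_bilinear_matrix_vec_mult]
  bounded_bilinear.scaleR_right[OF bounded_bilinear_matrix_vec_mult]

lemma skew_diff: "skew (v - w) = skew v - skew w"
  by (rule linear_diff[OF bounded_linear.linear[OF bounded_linear_skew]])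

lemma skew_mult_rotation_transpose:
  assumes "rotation_matrix R"
  shows "transpose R ** skew (R *v w) = skew w ** transpose R"
proof -
  have "transpose R ** (R ** skew w) ** transpose R = transpose R ** (skew (R *v w) ** R) ** transpose R"
    by (simp only: rotation_mult_skew[OF assms])
  then show ?thesis
    by (simp add: matrix_mul_assoc rotation_matrix_mult_transpose[OF assms] rotation_cancel[OF assms])
qed

lemma outer_mult: "A ** outer v v ** transpose A = outer (A *v v) (A *v v)"
  by (simp add: vec_eq_iff forall_3 matrix3_mult_component matrix3_mult_vec_component outer_def algebra_simps)

section \<open>The attitude error system in principal coordinates\<close>

text \<open>
  The vector whose skew matrix is \<open>G Q - Q\<^sup>T G\<close> with \<open>G = diag l\<close>. It is the innovation of the
  estimator in the eigenbasis of \<open>K\<close>, and the force that the potential \<open>tr (G (I - Q))\<close> exerts.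
\<close>

definition torque :: "real^3 \<Rightarrow> real^3^3 \<Rightarrow> real^3" where
  "torque l Q = vector [l$3 * Q$3$2 - l$2 * Q$2$3, l$1 * Q$1$3 - l$3 * Q$3$1, l$2 * Q$2$1 - l$1 * Q$1$2]"

definition potential :: "real^3 \<Rightarrow> real^3^3 \<Rightarrow> real" where
  "potential l Q = (\<Sum>i\<in>UNIV. l $ i * (1 - Q $ i $ i))"

lemma torque_component [simp]:
  "torque l Q $ 1 = l$3 * Q$3$2 - l$2 * Q$2$3"
  "torque l Q $ 2 = l$1 * Q$1$3 - l$3 * Q$3$1"
  "torque l Q $ 3 = l$2 * Q$2$1 - l$1 * Q$1$2"
  by (simp_all add: torque_def)

lemma bounded_linear_torque: "bounded_linear (torque l)"
  unfolding linear_conv_bounded_linear[symmetric]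
  by (rule linearI) (simp_all add: vec_eq_iff forall_3 algebra_simps)

lemma torque_diff: "torque l (P - Q) = torque l P - torque l Q"
  by (rule linear_diff[OF bounded_linear.linear[OF bounded_linear_torque]])

lemma torque_minus: "torque l (- Q) = - torque l Q"
  by (rule linear_neg[OF bounded_linear.linear[OF bounded_linear_torque]])

lemma torque_D: "torque l (D m) = 0"
  by (simp add: vec_eq_iff forall_3 D_component)

lemma torque_one: "torque l (mat 1) = 0"
  by (simp add: vec_eq_iff forall_3)

lemma continuous_on_potential: "continuous_on S (potential l)"
  unfolding potential_def by (intro continuous_intros)

lemma potential_one: "potential l (mat 1) = 0"
  by (simp add: potential_def)

lemma potential_D: "potential l (D m) = 2 * (l$1 + l$2 + l$3 - l$m)"
  using exhaust_3[of m] by (auto simp: potential_def sum_3 D_component)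

lemma sum_UNIV_minus_3:
  fixes f :: "3 \<Rightarrow> real"
  shows "(\<Sum>j\<in>UNIV - {1}. f j) = f 2 + f 3" "(\<Sum>j\<in>UNIV - {2}. f j) = f 1 + f 3"
    "(\<Sum>j\<in>UNIV - {3}. f j) = f 1 + f 2"
proof -
  have "UNIV - {1} = {2, 3 :: 3}" "UNIV - {2} = {1, 3 :: 3}" "UNIV - {3} = {1, 2 :: 3}"
    using exhaust_3 by fastforce+
  then show "(\<Sum>j\<in>UNIV - {1}. f j) = f 2 + f 3" "(\<Sum>j\<in>UNIV - {2}. f j) = f 1 + f 3"
    "(\<Sum>j\<in>UNIV - {3}. f j) = f 1 + f 2" by simp_all
qed

text \<open>
  The torque at \<open>D m ** skew v\<close>, a tangent vector at the half-turn \<open>D m\<close>, is \<open>v\<close> with coordinates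
  scaled by these factors. They are nonzero, and the \<open>m\<close>-th one is negative: along the axis of the
  half-turn the torque repels.
\<close>

definition stiffness :: "real^3 \<Rightarrow> 3 \<Rightarrow> 3 \<Rightarrow> real" where
  "stiffness l m i = (\<Sum>j\<in>UNIV - {i}. l $ j * (if j = m then 1 else - 1))"

lemma torque_D_skew: "torque l (D m ** skew v) = (\<chi> i. stiffness l m i * v $ i)"
  using exhaust_3[of m]
  by (auto simp: vec_eq_iff forall_3 stiffness_def sum_UNIV_minus_3 matrix3_mult_component D_component algebra_simps)

lemma vector_derivative_torque:
  assumes "(Q has_vector_derivative - (Q t ** skew v)) F"
  shows "((\<lambda>t. torque l (Q t)) has_vector_derivative - torque l (Q t ** skew v)) F"
  using bounded_linear.has_vector_derivative[OF bounded_linear_torque assms, of l]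
  by (simp add: torque_minus)

lemma derivative_potential:
  assumes "(Q has_vector_derivative - (Q t ** skew v)) (at t within S)"
  shows "((\<lambda>t. potential l (Q t)) has_real_derivative - (torque l (Q t) \<bullet> v)) (at t within S)"
proof -
  have comp: "((\<lambda>t. Q t $ i $ i) has_real_derivative - (Q t ** skew v) $ i $ i) (at t within S)" for i
    using bounded_linear.has_vector_derivative[OF bounded_linear_vec_nth
        bounded_linear.has_vector_derivative[OF bounded_linear_vec_nth assms, of i], of i]
    by (simp add: has_real_derivative_iff_has_vector_derivative)
  define d where "d i = - (Q t ** skew v) $ i $ i" for i
  have "((\<lambda>t. potential l (Q t)) has_real_derivative
      l $ 1 * (0 - d 1) + l $ 2 * (0 - d 2) + l $ 3 * (0 - d 3)) (at t within S)"
    unfolding potential_def sum_3 d_def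
    by (intro DERIV_add DERIV_cmult DERIV_diff DERIV_const comp)
  moreover have "l $ 1 * (0 - d 1) + l $ 2 * (0 - d 2) + l $ 3 * (0 - d 3) = - (torque l (Q t) \<bullet> v)"
    unfolding d_def by (simp add: inner_vec3 matrix3_mult_component algebra_simps)
  ultimately show ?thesis by simp
qed

text \<open>
  If \<open>G Q\<close> is symmetric, then \<open>Q G Q = G\<close>, whence \<open>G Q\<^sup>T = Q G\<close> and \<open>G\<^sup>2 Q = G Q\<^sup>T G = Q G\<^sup>2\<close>. The
  entries of \<open>G\<^sup>2\<close> are distinct, so the rotation \<open>Q\<close> is diagonal, with an even number of entries \<open>- 1\<close>.
\<close>

lemma equilibrium_rotations:
  assumes rot: "rotation_matrix Q" and pos: "\<And>i. l $ i > 0"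
    and distinct: "\<And>i j. i \<noteq> j \<Longrightarrow> l $ i \<noteq> l $ j"
    and zero: "torque l Q = 0"
  shows "Q = mat 1 \<or> (\<exists>m. Q = D m)"
proof -
  let ?G = "diag l"
  have G_left: "(?G ** A) $ i $ j = l $ i * A $ i $ j" for A :: "real^3^3" and i j
    using exhaust_3[of i] by (auto simp: matrix3_mult_component diag_def)
  have G_right: "(A ** ?G) $ i $ j = A $ i $ j * l $ j" for A :: "real^3^3" and i j
    using exhaust_3[of j] by (auto simp: matrix3_mult_component diag_def)
  have sym: "?G ** Q = transpose Q ** ?G"
    using zero by (simp add: vec_eq_iff forall_3 G_left G_right algebra_simps)
  note QQ = rotation_matrix_mult_transpose[OF rot]
  have "Q ** ?G ** Q = ?G"
    by (metis QQ(1) matrix_mul_assoc matrix_mul_lid sym)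
  then have GQt: "?G ** transpose Q = Q ** ?G"
    by (metis QQ(1) matrix_mul_assoc matrix_mul_rid)
  have comm: "?G ** (?G ** Q) = (Q ** ?G) ** ?G"
    by (metis GQt matrix_mul_assoc sym)
  have off: "Q $ i $ j = 0" if "i \<noteq> j" for i j
  proof -
    have "l $ i * (l $ i * Q $ i $ j) = (Q $ i $ j * l $ j) * l $ j"
      using arg_cong[OF comm, of "\<lambda>A. A $ i $ j"] by (simp add: G_left G_right)
    then have "((l $ i)\<^sup>2 - (l $ j)\<^sup>2) * Q $ i $ j = 0" by (simp add: power2_eq_square algebra_simps)
    moreover have "(l $ i)\<^sup>2 \<noteq> (l $ j)\<^sup>2"
      using pos[of i] pos[of j] distinct[OF that] by (simp add: power2_eq_iff_nonneg less_imp_le)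
    ultimately show ?thesis by simp
  qed
  have "(Q $ i $ i)\<^sup>2 = 1" for i
  proof -
    have "(Q ** transpose Q) $ i $ i = 1" using QQ by simp
    then show ?thesis using exhaust_3[of i] off by (auto simp: matrix3_mult_component power2_eq_square)
  qed
  then have pm: "Q $ i $ i = 1 \<or> Q $ i $ i = -1" for i by (simp add: power2_eq_1_iff)
  have "Q $ 1 $ 1 * Q $ 2 $ 2 * Q $ 3 $ 3 = 1"
    using rot off unfolding rotation_matrix_def det_3 by simp
  then consider "Q$1$1 = 1" "Q$2$2 = 1" "Q$3$3 = 1" | "Q$1$1 = 1" "Q$2$2 = -1" "Q$3$3 = -1"
    | "Q$1$1 = -1" "Q$2$2 = 1" "Q$3$3 = -1" | "Q$1$1 = -1" "Q$2$2 = -1" "Q$3$3 = 1"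
    using pm[of 1] pm[of 2] pm[of 3] by fastforce
  then show ?thesis
  proof cases
    case 1
    then have "Q = mat 1" using off by (simp add: vec_eq_iff forall_3)
    then show ?thesis ..
  next
    case 2
    then have "Q = D 1" using off by (simp add: vec_eq_iff forall_3 D_component)
    then show ?thesis by blast
  next
    case 3
    then have "Q = D 2" using off by (simp add: vec_eq_iff forall_3 D_component)
    then show ?thesis by blast
  next
    case 4
    then have "Q = D 3" using off by (simp add: vec_eq_iff forall_3 D_component)
    then show ?thesis by blast
  qed
qed

text \<open>
  Both sides are weighted sums of the nonnegative numbers \<open>1 - Q $ i $ i\<close>, by \<open>norm_power2_rotation_minus_one\<close>.
\<close>

lemma potential_lower_bound:
  assumes rot: "rotation_matrix Q" and c: "\<And>i. c \<le> l $ i"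
  shows "c / 2 * (norm (Q - mat 1))\<^sup>2 \<le> potential l Q"
proof -
  have "c / 2 * (norm (Q - mat 1))\<^sup>2 = (\<Sum>i\<in>UNIV. c * (1 - Q $ i $ i))"
    unfolding norm_power2_rotation_minus_one[OF rot] by (simp flip: sum_distrib_left)
  also have "\<dots> \<le> potential l Q"
    unfolding potential_def using c rotation_diag_le_1[OF rot] by (intro sum_mono mult_right_mono) auto
  finally show ?thesis .
qed

lemma vec3_lower_bound:
  assumes "\<And>i. (l :: real^3) $ i > 0"
  obtains c where "c > 0" "\<And>i. c \<le> l $ i"
proof
  show "Min (range (($) l)) > 0" using assms by (subst Min_gr_iff) auto
  show "Min (range (($) l)) \<le> l $ i" for i by (rule Min_le) auto
qed

lemma potential_pos:
  assumes "rotation_matrix Q" "\<And>i. l $ i > 0" "Q \<noteq> mat 1"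
  shows "potential l Q > 0"
proof -
  obtain c where c: "c > 0" "\<And>i. c \<le> l $ i" using vec3_lower_bound assms(2) by blast
  have "0 < c / 2 * (norm (Q - mat 1))\<^sup>2" using c assms(3) by simp
  then show ?thesis using potential_lower_bound[OF assms(1) c(2)] by linarith
qed

lemma potential_nonneg:
  assumes "rotation_matrix Q" "\<And>i. l $ i > 0"
  shows "potential l Q \<ge> 0"
  using potential_pos[OF assms] potential_one[of l] by (cases "Q = mat 1") auto

text \<open>
  The error dynamics in the coordinates of the eigenbasis of \<open>K\<close>. The function \<open>a\<close> is the true angular velocity in
  these coordinates, and \<open>k\<close> is the damping.
\<close>

locale attitude_error_system =
  fixes l :: "real^3" and a :: "real \<Rightarrow> real^3" and k B :: real
  assumes l_pos: "l $ i > 0"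
    and l_distinct: "i \<noteq> j \<Longrightarrow> l $ i \<noteq> l $ j"
    and k_pos: "k > 0"
    and a_cont: "continuous_on {0..} a"
    and a_bound: "t \<ge> 0 \<Longrightarrow> norm (a t) \<le> B"
begin

lemma B_nonneg: "B \<ge> 0"
  using a_bound[of 0] norm_ge_zero[of "a 0"] by linarith

definition sol :: "real \<Rightarrow> (real \<Rightarrow> (real^3^3) \<times> (real^3)) \<Rightarrow> bool" where
  "sol t0 x \<longleftrightarrow> (\<forall>t\<ge>t0. rotation_matrix (fst (x t)) \<and>
     ((\<lambda>t. fst (x t)) has_vector_derivative - (fst (x t) ** skew (snd (x t)))) (at t within {t0..}) \<and>
     ((\<lambda>t. snd (x t)) has_vector_derivative
        cross3 (a t) (snd (x t)) - k *\<^sub>R snd (x t) + torque l (fst (x t))) (at t within {t0..}))"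

text \<open>
  The field is quadratic, hence not globally Lipschitz. Truncating both components in its nonlinear terms makes it so,
  and the solution of the truncated system never leaves the region where nothing is truncated:
  \<open>norm (Q t)\<close> is constant, as the truncation is radial, and the damping bounds the
  velocity, as the truncated torque is bounded.
\<close>

lemma solution_exists:
  assumes "t0 \<ge> 0" and rot: "rotation_matrix Q0"
  shows "\<exists>x. sol t0 x \<and> x t0 = (Q0, V0)"
proof -
  obtain c1 where c1: "c1 > 0" "\<And>(A :: real^3^3) w. norm (A ** skew w) \<le> norm A * norm w * c1"
    using bounded_bilinear.pos_bounded[OF bounded_bilinear_mult_skew] by blast
  obtain c2 where c2: "c2 > 0" "\<And>A. norm (torque l A) \<le> norm A * c2"
    using bounded_linear.pos_bounded[OF bounded_linear_torque] by blast
  define g where "g = 2 * c2"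
  have "g > 0" using c2 unfolding g_def by simp
  \<comment> \<open>the truncated torque is bounded by \<open>g\<close>, so the damping keeps \<open>norm (V t)\<close> below \<open>M\<close>\<close>
  define M where "M = sqrt ((norm V0)\<^sup>2 + (g / k)\<^sup>2)"
  have M0: "M > 0" "M\<^sup>2 = (norm V0)\<^sup>2 + (g / k)\<^sup>2"
    unfolding M_def using \<open>g > 0\<close> k_pos by (auto intro!: add_nonneg_pos)
  define p :: "real^3^3 \<Rightarrow> real^3^3" where "p = clamp_ball 2"
  define q :: "real^3 \<Rightarrow> real^3" where "q = clamp_ball M"
  have p: "norm (p A - p A') \<le> norm (A - A')" "norm (p A) \<le> 2" "continuous_on S p" for A A' S
    unfolding p_def by (simp_all add: clamp_ball)
  note pL = p(1) and pB = p(2) and pC = p(3)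
  have q: "norm (q v - q w) \<le> norm (v - w)" "norm (q v) \<le> M" "continuous_on S q" for v w S
    unfolding q_def using M0 by (simp_all add: clamp_ball)
  note qL = q(1) and qB = q(2) and qC = q(3)
  define F where "F t x = (- (p (fst x) ** skew (q (snd x))),
      cross3 (a t) (snd x) - k *\<^sub>R snd x + torque l (p (fst x)))" for t x
  define L where "L = c1 * M + 2 * c1 + B + k + c2"
  have "\<exists>x. x t0 = (Q0, V0) \<and> (\<forall>t\<ge>t0. (x has_vector_derivative F t (x t)) (at t within {t0..}))"
  proof (rule global_lipschitz_ode_existence)
    fix x :: "real \<Rightarrow> (real^3^3) \<times> (real^3)" assume x: "continuous_on {t0..} x"
    have xf: "continuous_on {t0..} (\<lambda>t. fst (x t))" and xs: "continuous_on {t0..} (\<lambda>t. snd (x t))"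
      using x by (auto intro: continuous_intros)
    have px: "continuous_on {t0..} (\<lambda>t. p (fst (x t)))"
      by (rule continuous_on_compose2[OF pC xf]) auto
    have qx: "continuous_on {t0..} (\<lambda>t. q (snd (x t)))"
      by (rule continuous_on_compose2[OF qC xs]) auto
    have ax: "continuous_on {t0..} a" by (rule continuous_on_subset[OF a_cont]) (use assms in auto)
    show "continuous_on {t0..} (\<lambda>t. F t (x t))" unfolding F_def
      by (intro continuous_intros xs bounded_bilinear.continuous_on[OF bounded_bilinear_mult_skew px qx]
          bounded_bilinear.continuous_on[OF bounded_bilinear_cross3 ax xs]
          bounded_linear.continuous_on[OF bounded_linear_torque px])
  next
    fix t :: real and x y :: "(real^3^3) \<times> (real^3)" assume "t \<ge> t0"
    then have aB: "norm (a t) \<le> B" using a_bound assms by simp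
    let ?d = "norm (x - y)"
    have d1: "norm (fst x - fst y) \<le> ?d" and d2: "norm (snd x - snd y) \<le> ?d"
      using norm_fst_component_le[of "x - y"] norm_snd_component_le[of "x - y"] by auto
    have "norm (p (fst x) ** skew (q (snd x)) - p (fst y) ** skew (q (snd y)))
        = norm ((p (fst x) - p (fst y)) ** skew (q (snd x)) + p (fst y) ** skew (q (snd x) - q (snd y)))"
      by (simp add: matrix_mult_simps skew_diff)
    also have "\<dots> \<le> norm (p (fst x) - p (fst y)) * norm (q (snd x)) * c1
        + norm (p (fst y)) * norm (q (snd x) - q (snd y)) * c1"
      by (rule order_trans[OF norm_triangle_ineq]) (intro add_mono c1)
    also have "\<dots> \<le> ?d * M * c1 + 2 * ?d * c1"
      using order_trans[OF pL d1] order_trans[OF qL d2] c1 M0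
      by (intro add_mono mult_right_mono mult_mono pB qB) auto
    finally have 1: "norm (p (fst x) ** skew (q (snd x)) - p (fst y) ** skew (q (snd y))) \<le> ?d * M * c1 + 2 * ?d * c1" .
    have "norm (cross3 (a t) (snd x - snd y)) \<le> B * ?d"
      by (rule order_trans[OF norm_cross3_le]) (intro mult_mono aB d2 B_nonneg norm_ge_zero)
    moreover have "norm (k *\<^sub>R (snd x - snd y)) \<le> k * ?d" using k_pos d2 by simp
    moreover have "norm (torque l (p (fst x) - p (fst y))) \<le> ?d * c2"
      using c2(2)[of "p (fst x) - p (fst y)"] order_trans[OF pL d1] c2(1)
      by (meson less_imp_le mult_right_mono order_trans)
    ultimately have "norm (cross3 (a t) (snd x - snd y) - k *\<^sub>R (snd x - snd y) + torque l (p (fst x) - p (fst y)))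
        \<le> B * ?d + k * ?d + ?d * c2"
      by (meson add_mono norm_triangle_ineq norm_triangle_ineq4 order_trans)
    also have "cross3 (a t) (snd x - snd y) - k *\<^sub>R (snd x - snd y) + torque l (p (fst x) - p (fst y))
        = (cross3 (a t) (snd x) - k *\<^sub>R snd x + torque l (p (fst x)))
          - (cross3 (a t) (snd y) - k *\<^sub>R snd y + torque l (p (fst y)))"
      by (simp add: torque_diff algebra_simps bounded_bilinear.diff_right[OF bounded_bilinear_cross3])
    finally have 2: "norm (snd (F t x) - snd (F t y)) \<le> B * ?d + k * ?d + ?d * c2"
      unfolding F_def by simp
    have 3: "norm (fst (F t x) - fst (F t y)) \<le> ?d * M * c1 + 2 * ?d * c1"
      using 1 unfolding F_def by (simp add: norm_minus_commute)
    have "norm (F t x - F t y) \<le> norm (fst (F t x - F t y)) + norm (snd (F t x - F t y))"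
      by (rule norm_le_sum_components)
    also have "\<dots> \<le> L * ?d" using 2 3 unfolding L_def by (simp add: algebra_simps)
    finally show "norm (F t x - F t y) \<le> L * norm (x - y)" .
  next
    fix t assume "t \<ge> t0"
    then have aB: "norm (a t) \<le> B" using a_bound assms by simp
    have "norm (F t (Q0, V0)) \<le> norm (fst (F t (Q0, V0))) + norm (snd (F t (Q0, V0)))"
      by (rule norm_le_sum_components)
    also have "norm (fst (F t (Q0, V0))) \<le> norm (p Q0 ** skew (q V0))" unfolding F_def by simp
    also have "norm (snd (F t (Q0, V0))) \<le> B * norm V0 + k * norm V0 + norm (torque l (p Q0))"
    proof -
      have "norm (cross3 (a t) V0) \<le> B * norm V0"
        by (rule order_trans[OF norm_cross3_le]) (intro mult_right_mono aB norm_ge_zero)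
      moreover have "norm (k *\<^sub>R V0) = k * norm V0" using k_pos by simp
      ultimately show ?thesis unfolding F_def snd_conv fst_conv
        by (smt (verit) norm_triangle_ineq norm_triangle_ineq4)
    qed
    finally show "norm (F t (Q0, V0)) \<le> norm (p Q0 ** skew (q V0)) + (B * norm V0 + k * norm V0 + norm (torque l (p Q0)))"
      by simp
  qed
  then obtain x where x0: "x t0 = (Q0, V0)"
    and xd: "\<And>t. t \<ge> t0 \<Longrightarrow> (x has_vector_derivative F t (x t)) (at t within {t0..})" by blast
  define Q where "Q t = fst (x t)" for t
  define V where "V t = snd (x t)" for t
  have Qd: "(Q has_vector_derivative - (p (Q t) ** skew (q (V t)))) (at t within {t0..})" if "t \<ge> t0" for t
    using bounded_linear.has_vector_derivative[OF bounded_linear_fst xd[OF that]] unfolding Q_def V_def F_def by simp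
  have Vd: "(V has_vector_derivative cross3 (a t) (V t) - k *\<^sub>R V t + torque l (p (Q t))) (at t within {t0..})"
    if "t \<ge> t0" for t
    using bounded_linear.has_vector_derivative[OF bounded_linear_snd xd[OF that]] unfolding Q_def V_def F_def by simp
  \<comment> \<open>the truncated field is still tangent to the spheres in the space of matrices\<close>
  have "((\<lambda>t. Q t \<bullet> Q t) has_vector_derivative 0) (at t within {t0..})" if "t \<ge> t0" for t
  proof -
    obtain c where c: "p (Q t) = c *\<^sub>R Q t" using clamp_radial[of 2 "Q t"] unfolding p_def by auto
    have "((\<lambda>t. Q t \<bullet> Q t) has_vector_derivative
        Q t \<bullet> - (p (Q t) ** skew (q (V t))) + - (p (Q t) ** skew (q (V t))) \<bullet> Q t) (at t within {t0..})"
      by (rule bounded_bilinear.has_vector_derivative[OF bounded_bilinear_inner Qd[OF that] Qd[OF that]])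
    moreover have "Q t \<bullet> (p (Q t) ** skew (q (V t))) = 0"
      unfolding c by (simp add: bounded_bilinear.scaleR_left[OF bounded_bilinear_mult_skew] inner_mult_skew_self)
    ultimately show ?thesis by (simp add: inner_commute)
  qed
  then obtain C where C: "\<And>t. t \<in> {t0..} \<Longrightarrow> Q t \<bullet> Q t = C"
    using has_vector_derivative_zero_constant[of "{t0..}" "\<lambda>t. Q t \<bullet> Q t"] by auto
  have "Q t \<bullet> Q t = 3" if "t \<ge> t0" for t
    using C[of t] C[of t0] that norm_power2_rotation[OF rot] x0 by (simp add: Q_def power2_norm_eq_inner)
  then have "norm (Q t) \<le> 2" if "t \<ge> t0" for t
    using that power2_le_imp_le[of "norm (Q t)" 2] by (simp add: power2_norm_eq_inner)
  then have pQ: "p (Q t) = Q t" if "t \<ge> t0" for t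
    unfolding p_def using that by (simp add: clamp_ball(4))
  define v where "v t = cross3 (a t) (V t) - k *\<^sub>R V t + torque l (p (Q t))" for t
  have VV: "(norm (V t))\<^sup>2 \<le> M\<^sup>2" if "t \<ge> t0" for t
  proof -
    \<comment> \<open>Gronwall: \<open>(norm V)\<^sup>2\<close> relaxes at rate \<open>k\<close> towards values below \<open>(g / k)\<^sup>2\<close>\<close>
    define f where "f t = ((V t \<bullet> V t) - (g / k)\<^sup>2) * exp (k * (t - t0))" for t
    define f' where "f' t = (2 * (V t \<bullet> v t) - 0) * exp (k * (t - t0))
      + k * exp (k * (t - t0)) * ((V t \<bullet> V t) - (g / k)\<^sup>2)" for t
    have "f t \<le> f t0"
    proof (rule antimono_if_derivative_nonpos[of t0 f f'])
      fix s assume s: "s \<ge> t0"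
      have "((\<lambda>t. V t \<bullet> V t) has_real_derivative 2 * (V s \<bullet> v s)) (at s within {t0..})"
        using bounded_bilinear.has_vector_derivative[OF bounded_bilinear_inner Vd[OF s] Vd[OF s], folded v_def]
        by (simp add: has_real_derivative_iff_has_vector_derivative inner_commute)
      moreover have "((\<lambda>t. exp (k * (t - t0))) has_real_derivative k * exp (k * (s - t0))) (at s within {t0..})"
        by (auto intro!: derivative_eq_intros)
      ultimately show "(f has_real_derivative f' s) (at s within {t0..})"
        unfolding f_def f'_def by (intro DERIV_mult DERIV_diff DERIV_const)
      have "norm (torque l (p (Q s))) \<le> g"
        unfolding g_def
        by (rule order_trans[OF c2(2)]) (use c2 pB in \<open>auto intro: mult_right_mono\<close>)
      then have "V s \<bullet> torque l (p (Q s)) \<le> norm (V s) * g"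
        by (intro order_trans[OF norm_cauchy_schwarz] mult_left_mono) auto
      have "2 * (norm (V s) * g) \<le> k * (norm (V s))\<^sup>2 + g\<^sup>2 / k"
      proof -
        have "0 \<le> (k * norm (V s) - g)\<^sup>2 / k" using k_pos by simp
        also have "\<dots> = k * (norm (V s))\<^sup>2 + g\<^sup>2 / k - 2 * (norm (V s) * g)"
          using k_pos by (simp add: power2_eq_square field_simps)
        finally show ?thesis by simp
      qed
      have "2 * (V s \<bullet> v s) + ((V s \<bullet> V s) - (g / k)\<^sup>2) * k \<le> 0"
      proof -
        have "(g / k)\<^sup>2 * k = g\<^sup>2 / k" using k_pos by (simp add: power2_eq_square)
        moreover have "V s \<bullet> V s = (norm (V s))\<^sup>2" by (simp add: power2_norm_eq_inner)
        ultimately show ?thesis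
          using \<open>V s \<bullet> torque l (p (Q s)) \<le> norm (V s) * g\<close>
            \<open>2 * (norm (V s) * g) \<le> k * (norm (V s))\<^sup>2 + g\<^sup>2 / k\<close>
          by (simp add: v_def inner_add_right inner_diff_right algebra_simps)
      qed
      then have "(2 * (V s \<bullet> v s) + ((V s \<bullet> V s) - (g / k)\<^sup>2) * k) * exp (k * (s - t0)) \<le> 0"
        by (simp add: mult_nonpos_nonneg)
      then show "f' s \<le> 0" unfolding f'_def by (simp add: algebra_simps)
    qed (use that in auto)
    also have "f t0 \<le> (norm V0)\<^sup>2"
      unfolding f_def using x0 by (simp add: V_def power2_norm_eq_inner)
    finally have decay: "(V t \<bullet> V t - (g / k)\<^sup>2) * exp (k * (t - t0)) \<le> (norm V0)\<^sup>2" unfolding f_def .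
    have e1: "1 \<le> exp (k * (t - t0))" using k_pos that by simp
    have "V t \<bullet> V t - (g / k)\<^sup>2 \<le> (norm V0)\<^sup>2"
    proof (cases "V t \<bullet> V t - (g / k)\<^sup>2 \<le> 0")
      case True
      then show ?thesis using zero_le_power2[of "norm V0"] by linarith
    next
      case False
      then have "(V t \<bullet> V t - (g / k)\<^sup>2) * 1 \<le> (V t \<bullet> V t - (g / k)\<^sup>2) * exp (k * (t - t0))"
        using e1 by (intro mult_left_mono) auto
      from order_trans[OF this decay] show ?thesis by (simp only: mult_1_right)
    qed
    then show ?thesis unfolding M0 by (simp add: power2_norm_eq_inner)
  qed
  have qV: "q (V t) = V t" if "t \<ge> t0" for t
    unfolding q_def using power2_le_imp_le[OF VV[OF that]] M0 by (simp add: clamp_ball(4))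
  have Qd': "(Q has_vector_derivative - (Q t ** skew (V t))) (at t within {t0..})" if "t \<ge> t0" for t
    using Qd[OF that] by (simp add: pQ[OF that] qV[OF that])
  have rotQ: "rotation_matrix (Q t)" if "t \<ge> t0" for t
  proof (rule rotation_invariant[of t0 Q "\<lambda>t. - V t"])
    show "(Q has_vector_derivative Q t ** skew (- V t)) (at t within {t0..})" if "t \<ge> t0" for t
      using Qd'[OF that] by (simp add: bounded_bilinear.minus_right[OF bounded_bilinear_mult_skew])
  qed (use that rot x0 in \<open>auto simp: Q_def\<close>)
  have "sol t0 x"
  proof -
    have QV: "Q = (\<lambda>t. fst (x t))" "V = (\<lambda>t. snd (x t))" by (auto simp: Q_def V_def)
    show ?thesis unfolding sol_def using rotQ Qd' Vd pQ by (simp add: QV)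
  qed
  then show ?thesis using x0 by blast
qed

end

section \<open>Energy, convergence and equilibria\<close>

context attitude_error_system
begin

definition energy :: "(real^3^3) \<times> (real^3) \<Rightarrow> real" where
  "energy z = potential l (fst z) + (norm (snd z))\<^sup>2 / 2"

lemma continuous_on_energy: "continuous_on S energy"
  unfolding energy_def
  by (intro continuous_intros continuous_on_compose2[OF continuous_on_potential[of UNIV]]) auto

lemma energy_nonneg: "rotation_matrix (fst z) \<Longrightarrow> energy z \<ge> 0"
  unfolding energy_def using potential_nonneg[of "fst z" l] l_pos by simp

lemma norm_le_energy: "rotation_matrix (fst z) \<Longrightarrow> norm (snd z) \<le> sqrt (2 * energy z)"
  using potential_nonneg[of "fst z" l] l_pos unfolding energy_def by (intro real_le_rsqrt) simp

context
  fixes t0 x Q V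
  assumes sol: "sol t0 x" and Q_def: "Q = (\<lambda>t. fst (x t))" and V_def: "V = (\<lambda>t. snd (x t))"
begin

lemma sol_rotation: "t \<ge> t0 \<Longrightarrow> rotation_matrix (Q t)"
  using sol unfolding sol_def Q_def by blast

lemma sol_Q: "t \<ge> t0 \<Longrightarrow> (Q has_vector_derivative - (Q t ** skew (V t))) (at t within {t0..})"
  using sol unfolding sol_def Q_def V_def by blast

lemma sol_V: "t \<ge> t0 \<Longrightarrow>
    (V has_vector_derivative cross3 (a t) (V t) - k *\<^sub>R V t + torque l (Q t)) (at t within {t0..})"
  using sol unfolding sol_def Q_def V_def by blast

lemma derivative_energy:
  assumes "t \<ge> t0"
  shows "((\<lambda>t. energy (x t)) has_real_derivative - k * (norm (V t))\<^sup>2) (at t within {t0..})"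
proof -
  have "((\<lambda>t. potential l (Q t) + (norm (V t))\<^sup>2 / 2) has_real_derivative - (torque l (Q t) \<bullet> V t)
      + V t \<bullet> (cross3 (a t) (V t) - k *\<^sub>R V t + torque l (Q t))) (at t within {t0..})"
    by (intro DERIV_add derivative_potential sol_Q derivative_half_norm_square sol_V assms)
  then show ?thesis unfolding energy_def Q_def V_def
    by (simp add: inner_add_right inner_diff_right inner_commute power2_norm_eq_inner)
qed

lemma energy_antimono:
  assumes "t0 \<le> s" "s \<le> t"
  shows "energy (x t) \<le> energy (x s)"
  by (rule antimono_if_derivative_nonpos[OF derivative_energy _ assms]) (use k_pos in auto)

lemma velocity_bound:
  assumes "t0 \<le> t"
  shows "norm (V t) \<le> sqrt (2 * energy (x t0))"
proof -
  have "norm (V t) \<le> sqrt (2 * energy (x t))"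
    using norm_le_energy[of "x t"] sol_rotation[OF assms] unfolding Q_def V_def by simp
  also have "\<dots> \<le> sqrt (2 * energy (x t0))" using energy_antimono[of t0 t] assms by simp
  finally show ?thesis .
qed

text \<open>
  The energy dissipates \<open>(norm V)\<^sup>2\<close> only. The derivative of \<open>V \<bullet> \<tau>\<close> contains \<open>(norm \<tau>)\<^sup>2\<close>, and its other terms are
  bounded by multiples of \<open>(norm V)\<^sup>2\<close> and \<open>norm V * norm \<tau>\<close>, uniformly in time because \<open>a\<close> is bounded.
  So \<open>E - \<eta> V \<bullet> \<tau>\<close> dissipates both squares if \<open>\<eta>\<close> is small.
\<close>

lemma velocity_and_torque_vanish:
  assumes "t0 \<ge> 0"
  shows "(V \<longlongrightarrow> 0) at_top" "((\<lambda>t. torque l (Q t)) \<longlongrightarrow> 0) at_top"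
proof -
  define T where "T t = torque l (Q t)" for t
  define v where "v t = cross3 (a t) (V t) - k *\<^sub>R V t + T t" for t
  define w where "w t = - torque l (Q t ** skew (V t))" for t
  obtain c1 where c1: "c1 > 0" "\<And>(A :: real^3^3) w. norm (A ** skew w) \<le> norm A * norm w * c1"
    using bounded_bilinear.pos_bounded[OF bounded_bilinear_mult_skew] by blast
  obtain c2 where c2: "c2 > 0" "\<And>A. norm (torque l A) \<le> norm A * c2"
    using bounded_linear.pos_bounded[OF bounded_linear_torque] by blast
  define c where "c = 2 * c1 * c2"
  have c: "c > 0" unfolding c_def using c1 c2 by simp
  have w_le: "norm (w t) \<le> c * norm (V t)" if "t \<ge> t0" for t
  proof -
    have "norm (w t) \<le> norm (Q t) * norm (V t) * c1 * c2"
      unfolding w_def norm_minus_cancel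
      by (rule order_trans[OF c2(2)]) (intro mult_right_mono c1(2) less_imp_le c2(1))
    also have "\<dots> \<le> 2 * norm (V t) * c1 * c2"
      using norm_rotation_le[OF sol_rotation[OF that]] c1 c2 by (intro mult_right_mono) auto
    finally show ?thesis unfolding c_def by (simp add: algebra_simps)
  qed
  have T_le: "norm (T t) \<le> 2 * c2" if "t \<ge> t0" for t
    unfolding T_def
    by (rule order_trans[OF c2(2)])
       (use c2 norm_rotation_le[OF sol_rotation[OF that]] in \<open>auto intro: mult_right_mono\<close>)
  define M where "M = sqrt (2 * energy (x t0))"
  have V_le: "norm (V t) \<le> M" if "t \<ge> t0" for t unfolding M_def by (rule velocity_bound[OF that])
  have M0: "M \<ge> 0" using V_le[of t0] norm_ge_zero[of "V t0"] by linarith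
  have drag_le: "norm (cross3 (a t) (V t) - k *\<^sub>R V t) \<le> (B + k) * norm (V t)" if "t \<ge> t0" for t
  proof -
    have "norm (cross3 (a t) (V t)) \<le> B * norm (V t)"
      by (rule order_trans[OF norm_cross3_le]) (use a_bound assms that in \<open>auto intro: mult_right_mono\<close>)
    then show ?thesis using norm_triangle_ineq4[of "cross3 (a t) (V t)" "k *\<^sub>R V t"] k_pos
      by (simp add: algebra_simps)
  qed
  have dT: "(T has_vector_derivative w t) (at t within {t0..})" if "t \<ge> t0" for t
    unfolding T_def w_def by (rule vector_derivative_torque[OF sol_Q[OF that]])
  have dV: "(V has_vector_derivative v t) (at t within {t0..})" if "t \<ge> t0" for t
    unfolding T_def v_def by (rule sol_V[OF that])
  \<comment> \<open>with this \<open>\<eta>\<close> the unwanted terms use up at most half of the damping\<close>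
  define \<eta> where "\<eta> = k / (2 * ((B + k)\<^sup>2 / 2 + c))"
  have den: "(B + k)\<^sup>2 / 2 + c > 0" using c by (simp add: add_nonneg_pos)
  have \<eta>: "\<eta> > 0" "\<eta> * ((B + k)\<^sup>2 / 2 + c) = k / 2"
    unfolding \<eta>_def using den k_pos by (auto simp: field_simps)
  define \<mu> where "\<mu> = min k \<eta> / 2"
  have \<mu>: "\<mu> > 0" "\<mu> \<le> k / 2" "\<mu> \<le> \<eta> / 2" unfolding \<mu>_def using k_pos \<eta> by auto
  define f where "f t = energy (x t) - \<eta> * (V t \<bullet> T t)" for t
  define f' where "f' t = - k * (norm (V t))\<^sup>2 - \<eta> * (V t \<bullet> w t + v t \<bullet> T t)" for t
  define g where "g t = 2 * \<mu> * ((norm (V t))\<^sup>2 / 2 + (norm (T t))\<^sup>2 / 2)" for t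
  define g' where "g' t = 2 * \<mu> * (V t \<bullet> v t + T t \<bullet> w t)" for t
  have "(g \<longlongrightarrow> 0) at_top"
  proof (rule dissipation_tendsto_0[of t0 f f' g _ g'])
    fix t assume t: "t0 \<le> t"
    show "(f has_real_derivative f' t) (at t within {t0..})"
      unfolding f_def f'_def by (intro DERIV_diff DERIV_cmult derivative_energy derivative_inner dV dT t)
    show "(g has_real_derivative g' t) (at t within {t0..})"
      unfolding g_def g'_def by (intro DERIV_add DERIV_cmult derivative_half_norm_square dV dT t)
    show "0 \<le> g t" unfolding g_def using \<mu> by simp
    have Vw: "- (V t \<bullet> w t) \<le> c * (norm (V t))\<^sup>2"
    proof -
      have "\<bar>V t \<bullet> w t\<bar> \<le> norm (V t) * (c * norm (V t))"
        by (intro order_trans[OF Cauchy_Schwarz_ineq2] mult_left_mono w_le t norm_ge_zero)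
      then show ?thesis by (simp add: power2_eq_square algebra_simps)
    qed
    have vT: "- (v t \<bullet> T t) \<le> (B + k)\<^sup>2 / 2 * (norm (V t))\<^sup>2 - (norm (T t))\<^sup>2 / 2"
    proof -
      have "\<bar>(cross3 (a t) (V t) - k *\<^sub>R V t) \<bullet> T t\<bar> \<le> (B + k) * norm (V t) * norm (T t)"
        by (intro order_trans[OF Cauchy_Schwarz_ineq2] mult_right_mono drag_le t norm_ge_zero)
      moreover have "2 * ((B + k) * norm (V t) * norm (T t)) \<le> ((B + k) * norm (V t))\<^sup>2 + (norm (T t))\<^sup>2"
        using sum_squares_bound[of "(B + k) * norm (V t)" "norm (T t)"] by simp
      ultimately show ?thesis unfolding v_def inner_add_left
        by (simp add: power2_norm_eq_inner[of "T t", symmetric] power_mult_distrib)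
    qed
    have "f' t \<le> - k * (norm (V t))\<^sup>2 + \<eta> * (c * (norm (V t))\<^sup>2
        + ((B + k)\<^sup>2 / 2 * (norm (V t))\<^sup>2 - (norm (T t))\<^sup>2 / 2))"
    proof -
      have "\<eta> * (- (V t \<bullet> w t) - (v t \<bullet> T t)) \<le> \<eta> * (c * (norm (V t))\<^sup>2
        + ((B + k)\<^sup>2 / 2 * (norm (V t))\<^sup>2 - (norm (T t))\<^sup>2 / 2))"
        using \<eta> Vw vT by (intro mult_left_mono) auto
      then show ?thesis unfolding f'_def by (simp add: algebra_simps)
    qed
    also have "\<dots> = - k * (norm (V t))\<^sup>2 + (\<eta> * ((B + k)\<^sup>2 / 2 + c)) * (norm (V t))\<^sup>2 - \<eta> / 2 * (norm (T t))\<^sup>2"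
      by (simp add: algebra_simps)
    also have "\<dots> = - (k / 2 * (norm (V t))\<^sup>2 + \<eta> / 2 * (norm (T t))\<^sup>2)"
      unfolding \<eta> by (simp add: algebra_simps)
    also have "\<dots> \<le> - (\<mu> * (norm (V t))\<^sup>2 + \<mu> * (norm (T t))\<^sup>2)"
      using mult_right_mono[OF \<mu>(2), of "(norm (V t))\<^sup>2"] mult_right_mono[OF \<mu>(3), of "(norm (T t))\<^sup>2"] by simp
    also have "\<dots> = - g t" unfolding g_def by (simp add: algebra_simps)
    finally show "f' t \<le> - g t" .
    have "\<bar>V t \<bullet> T t\<bar> \<le> M * (2 * c2)"
      using Cauchy_Schwarz_ineq2[of "V t" "T t"] mult_mono[OF V_le[OF t] T_le[OF t] M0] by simp
    then have "\<eta> * (V t \<bullet> T t) \<le> \<eta> * (M * (2 * c2))" using \<eta> by (intro mult_left_mono) auto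
    moreover have "0 \<le> energy (x t)" using energy_nonneg sol_rotation[OF t] unfolding Q_def by simp
    ultimately show "- (\<eta> * (M * (2 * c2))) \<le> f t" unfolding f_def by linarith
    have "norm (v t) \<le> (B + k) * M + 2 * c2"
    proof -
      have "norm (v t) \<le> (B + k) * norm (V t) + 2 * c2"
        unfolding v_def by (rule order_trans[OF norm_triangle_ineq]) (intro add_mono drag_le T_le t)
      also have "\<dots> \<le> (B + k) * M + 2 * c2"
        using V_le[OF t] B_nonneg k_pos by (intro add_right_mono mult_left_mono) auto
      finally show ?thesis .
    qed
    then have 1: "\<bar>V t \<bullet> v t\<bar> \<le> M * ((B + k) * M + 2 * c2)"
      using order_trans[OF Cauchy_Schwarz_ineq2[of "V t" "v t"] mult_mono[OF V_le[OF t] _ M0 norm_ge_zero]]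
      by simp
    have "norm (w t) \<le> c * M" using w_le[OF t] V_le[OF t] c by (simp add: order_trans[OF _ mult_left_mono])
    then have 2: "\<bar>T t \<bullet> w t\<bar> \<le> (2 * c2) * (c * M)"
      using order_trans[OF Cauchy_Schwarz_ineq2[of "T t" "w t"] mult_mono[OF T_le[OF t] _ _ norm_ge_zero]] c2
      by simp
    have "\<bar>V t \<bullet> v t + T t \<bullet> w t\<bar> \<le> M * ((B + k) * M + 2 * c2) + (2 * c2) * (c * M)"
      using 1 2 by linarith
    then show "\<bar>g' t\<bar> \<le> 2 * \<mu> * (M * ((B + k) * M + 2 * c2) + (2 * c2) * (c * M))"
      unfolding g'_def abs_mult using \<mu> by (simp add: mult_left_mono)
  qed
  then have sq: "((\<lambda>t. (norm (V t))\<^sup>2 + (norm (T t))\<^sup>2) \<longlongrightarrow> 0) at_top"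
    using tendsto_mult_left[of g 0 at_top "1 / \<mu>"] \<mu> by (simp add: g_def algebra_simps)
  have "((\<lambda>t. (norm (V t))\<^sup>2) \<longlongrightarrow> 0) at_top"
    by (rule tendsto_sandwich[OF _ _ tendsto_const sq]) auto
  then show "(V \<longlongrightarrow> 0) at_top" by (simp add: tendsto_norm_zero_iff)
  have "((\<lambda>t. (norm (T t))\<^sup>2) \<longlongrightarrow> 0) at_top"
    by (rule tendsto_sandwich[OF _ _ tendsto_const sq]) auto
  then show "((\<lambda>t. torque l (Q t)) \<longlongrightarrow> 0) at_top" by (simp add: tendsto_norm_zero_iff T_def)
qed

text \<open>
  Every accumulation point of \<open>Q t\<close> is a rotation of torque zero, hence the identity or a half-turn,
  and its potential is the limit \<open>E\<close> of the energy. Only one of the four candidates has this potential.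
\<close>

lemma sol_converges:
  assumes "t0 \<ge> 0"
  shows "(x \<longlongrightarrow> (mat 1, 0)) at_top \<or> (\<exists>m. (x \<longlongrightarrow> (D m, 0)) at_top)"
proof -
  note lims = velocity_and_torque_vanish[OF assms]
  obtain E where E: "((\<lambda>t. energy (x t)) \<longlongrightarrow> E) at_top"
    using tendsto_bounded_antimono[of t0 "\<lambda>t. energy (x t)" 0] energy_antimono
      energy_nonneg sol_rotation unfolding Q_def by metis
  have "((\<lambda>t. energy (x t) - (norm (V t))\<^sup>2 / 2) \<longlongrightarrow> E - (norm (0 :: real^3))\<^sup>2 / 2) at_top"
    by (intro tendsto_intros E lims) auto
  then have pot: "((\<lambda>t. potential l (Q t)) \<longlongrightarrow> E) at_top"
    by (simp add: energy_def Q_def V_def)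
  define f where "f P = norm (torque l P) + \<bar>potential l P - E\<bar>" for P
  have "((\<lambda>t. f (Q t)) \<longlongrightarrow> norm (0 :: real^3) + \<bar>E - E\<bar>) at_top"
    unfolding f_def by (intro tendsto_intros lims pot)
  then have lim: "((\<lambda>t. f (Q t)) \<longlongrightarrow> 0) at_top" by simp
  have cont: "continuous_on {P. rotation_matrix P} f"
    unfolding f_def
    by (intro continuous_intros continuous_on_potential bounded_linear.continuous_on[OF bounded_linear_torque])
  have ev: "\<forall>\<^sub>F t in at_top. Q t \<in> {P. rotation_matrix P}"
    unfolding eventually_at_top_linorder using sol_rotation by blast
  obtain q where q: "rotation_matrix q" "f q = 0"
  proof (rule ccontr)
    \<comment> \<open>if \<open>f\<close> had no zero, then \<open>Q t\<close> would converge to everything\<close>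
    assume "\<not> thesis"
    then have "(Q \<longlongrightarrow> q) at_top" for q
      using that by (intro compact_tendsto_zero[OF compact_rotations cont _ ev lim]) auto
    then have "mat 1 = D 1" using tendsto_unique[OF trivial_limit_at_top_linorder] by blast
    from arg_cong[OF this, of "\<lambda>A. A $ 2 $ 2"] show False by (simp add: D_component)
  qed
  have f0: "torque l P = 0 \<and> potential l P = E" if "f P = 0" for P
    using that norm_ge_zero[of "torque l P"] unfolding f_def by (simp add: add_nonneg_eq_0_iff)
  have crit: "P = mat 1 \<or> (\<exists>m. P = D m)" if "rotation_matrix P" "f P = 0" for P
    using equilibrium_rotations[OF that(1) l_pos l_distinct] f0[OF that(2)] by blast
  have pot_D_pos: "potential l (D m) > 0" for m
    unfolding potential_D using l_pos[of 1] l_pos[of 2] l_pos[of 3] exhaust_3[of m] by auto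
  \<comment> \<open>the critical values of the potential are distinct\<close>
  have "P = q" if "P \<in> {P. rotation_matrix P}" "f P = 0" for P
  proof -
    have eq: "potential l P = potential l q" using f0 that q by simp
    have "rotation_matrix P" using that by simp
    from crit[OF this that(2)] crit[OF q] show ?thesis
    proof (elim disjE exE)
      fix m assume "P = mat 1" "q = D m"
      then show ?thesis using eq pot_D_pos[of m] by (simp add: potential_one)
    next
      fix m assume "P = D m" "q = mat 1"
      then show ?thesis using eq pot_D_pos[of m] by (simp add: potential_one)
    next
      fix m m' assume "P = D m" "q = D m'"
      then show ?thesis using eq l_distinct[of m m'] by (auto simp: potential_D)
    qed auto
  qed
  then have "(Q \<longlongrightarrow> q) at_top" by (rule compact_tendsto_zero[OF compact_rotations cont _ ev lim])
  then have "((\<lambda>t. (Q t, V t)) \<longlongrightarrow> (q, 0)) at_top" by (intro tendsto_Pair lims)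
  then show ?thesis using crit[OF q] by (auto simp: Q_def V_def)
qed

end

lemma sol_cong: "(\<And>t. t \<ge> t0 \<Longrightarrow> x t = y t) \<Longrightarrow> sol t0 x \<longleftrightarrow> sol t0 y"
proof -
  have "sol t0 y" if "sol t0 x" "\<And>t. t \<ge> t0 \<Longrightarrow> x t = y t" for x y
    unfolding sol_def
  proof (intro allI impI conjI)
    fix t assume t: "t \<ge> t0"
    note s = sol_rotation[OF that(1) refl refl t] sol_Q[OF that(1) refl refl t] sol_V[OF that(1) refl refl t]
    show "rotation_matrix (fst (y t))" using s that(2)[OF t] by simp
    show "((\<lambda>t. fst (y t)) has_vector_derivative - (fst (y t) ** skew (snd (y t)))) (at t within {t0..})"
      by (rule has_vector_derivative_transform[OF _ _ s(2)[unfolded that(2)[OF t]]]) (use t that(2) in auto)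
    show "((\<lambda>t. snd (y t)) has_vector_derivative cross3 (a t) (snd (y t)) - k *\<^sub>R snd (y t) + torque l (fst (y t)))
        (at t within {t0..})"
      by (rule has_vector_derivative_transform[OF _ _ s(3)[unfolded that(2)[OF t]]]) (use t that(2) in auto)
  qed
  then show "(\<And>t. t \<ge> t0 \<Longrightarrow> x t = y t) \<Longrightarrow> sol t0 x \<longleftrightarrow> sol t0 y" by metis
qed

lemma sol_equilibrium:
  assumes "rotation_matrix q" "torque l q = 0"
  shows "sol t0 (\<lambda>t. (q, 0))"
  unfolding sol_def using assms
  by (simp add: bounded_bilinear.zero_right[OF bounded_bilinear_mult_skew])

text \<open>
  A constant body-frame velocity turns into a rotating \<open>V\<close>, so an equilibrium of the original
  variables is known to be constant only in \<open>Q\<close> here; this already forces \<open>V\<close> to vanish.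
\<close>

lemma sol_constant_rotation:
  assumes sol: "sol t0 (\<lambda>t. (q, V t))"
  shows "rotation_matrix q" "V t0 = 0" "torque l q = 0"
proof -
  note s = sol_rotation[OF sol refl refl] sol_Q[OF sol refl refl] sol_V[OF sol refl refl]
  have nontriv: "at t within {t0..} \<noteq> bot" if "t \<ge> t0" for t
  proof
    assume "at t within {t0..} = bot"
    moreover have "at_right t \<le> at t within {t0..}" by (rule at_le) (use that in auto)
    ultimately show False using trivial_limit_at_right_real[of t] by (simp add: bot_unique)
  qed
  show rot: "rotation_matrix q" using s(1)[of t0] by simp
  have V0: "V t = 0" if "t \<ge> t0" for t
  proof -
    have "((\<lambda>t. q) has_vector_derivative - (q ** skew (V t))) (at t within {t0..})" using s(2)[OF that] by simp
    then have "- (q ** skew (V t)) = 0"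
      by (rule vector_derivative_unique_within[OF nontriv[OF that] _ has_vector_derivative_const])
    then have "transpose q ** (q ** skew (V t)) = 0"
      by (simp add: bounded_bilinear.zero_right[OF bounded_bilinear_matrix_mult])
    then have "skew (V t) = 0" by (simp add: matrix_mul_assoc rotation_matrix_mult_transpose[OF rot])
    then have "skew (V t) $ 3 $ 2 = 0" "skew (V t) $ 1 $ 3 = 0" "skew (V t) $ 2 $ 1 = 0" by simp_all
    then show ?thesis by (simp add: vec_eq_iff forall_3)
  qed
  show "V t0 = 0" by (rule V0) simp
  have "((\<lambda>t. V t) has_vector_derivative torque l q) (at t0 within {t0..})" using s(3)[of t0] V0[of t0] by simp
  moreover have "((\<lambda>t. V t) has_vector_derivative 0) (at t0 within {t0..})"
    by (rule has_vector_derivative_transform[OF _ _ has_vector_derivative_const[of 0]]) (use V0 in auto)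
  ultimately show "torque l q = 0" using vector_derivative_unique_within[OF nontriv] by blast
qed

end

section \<open>Stability of the identity and instability of the half-turns\<close>

text \<open>
  The half-turn \<open>D m\<close> followed by a further rotation about its axis, by an angle with cosine \<open>c\<close> and
  sine \<open>s\<close>. Along this circle through \<open>D m\<close> the potential has a maximum at \<open>D m\<close>.
\<close>

definition tilt :: "3 \<Rightarrow> real \<Rightarrow> real \<Rightarrow> real^3^3" where
  "tilt m c s =
     (if m = 1 then vector [vector [1, 0, 0], vector [0, - c, - s], vector [0, s, - c]]
      else if m = 2 then vector [vector [- c, 0, - s], vector [0, 1, 0], vector [s, 0, - c]]
      else vector [vector [- c, - s, 0], vector [s, - c, 0], vector [0, 0, 1]])"

lemma rotation_matrix_tilt:
  assumes "c * c + s * s = 1"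
  shows "rotation_matrix (tilt m c s)"
  using assms unfolding rotation_matrix_def orthogonal_matrix det_3
  by (auto simp: tilt_def vec_eq_iff forall_3 matrix3_mult_component algebra_simps)

lemma norm_tilt_diff:
  assumes "c * c + s * s = 1"
  shows "(norm (tilt m c s - D m))\<^sup>2 = 4 * (1 - c)"
  unfolding power2_norm_eq_inner inner_matrix3 using assms exhaust_3[of m]
  by (auto simp: tilt_def D_component algebra_simps)

lemma potential_tilt: "potential l (tilt m c s) = potential l (D m) - (1 - c) * (l$1 + l$2 + l$3 - l$m)"
  using exhaust_3[of m] unfolding potential_D
  by (auto simp: potential_def sum_3 tilt_def algebra_simps)

lemma potential_descent_near_D:
  assumes pos: "\<And>i. l $ i > 0" and "d > 0"
  obtains Q where "rotation_matrix Q" "dist Q (D m) < d" "potential l Q < potential l (D m)"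
proof
  define e where "e = min (1/2) (d\<^sup>2 / 8)"
  have e: "0 < e" "e < 1" "8 * e \<le> d\<^sup>2" unfolding e_def using assms by auto
  define c where "c = 1 - e"
  have c: "0 < c" "c < 1" unfolding c_def using e by auto
  have cd: "4 * (1 - c) < d\<^sup>2" unfolding c_def using e by simp
  define s where "s = sqrt (1 - c * c)"
  have "c * c < 1 * 1" by (intro mult_strict_mono) (use c in auto)
  then have cs: "c * c + s * s = 1" unfolding s_def by simp
  show "rotation_matrix (tilt m c s)" by (rule rotation_matrix_tilt[OF cs])
  show "dist (tilt m c s) (D m) < d"
    using cd norm_tilt_diff[OF cs, of m] power2_less_imp_less[of "norm (tilt m c s - D m)" d] assms
    by (simp add: dist_norm)
  have "l$1 + l$2 + l$3 - l$m > 0"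
    using pos[of 1] pos[of 2] pos[of 3] exhaust_3[of m] by auto
  then show "potential l (tilt m c s) < potential l (D m)"
    unfolding potential_tilt using c by simp
qed

text \<open>
  Distinct equilibria differ by \<open>2\<close> in some diagonal entry.
\<close>

lemma dist_D_ge:
  assumes "q = mat 1 \<or> q = D m'" "q \<noteq> D m"
  shows "dist q (D m) \<ge> 2"
proof -
  obtain i where "\<bar>(q - D m) $ i $ i\<bar> = 2"
  proof (cases "q = mat 1")
    case True
    obtain i where "i \<noteq> m" using exhaust_3[of m] by (metis zero_neq_one)
    then show ?thesis using that[of i] True by (simp add: D_component)
  next
    case False
    then have "q = D m'" "m' \<noteq> m" using assms by auto
    then show ?thesis using that[of m'] by (simp add: D_component)
  qed
  moreover have "\<bar>(q - D m) $ i $ i\<bar> \<le> norm (q - D m)" for i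
    using component_le_norm_cart[of "(q - D m) $ i" i] Finite_Cartesian_Product.norm_nth_le[of "q - D m" i] by linarith
  ultimately show ?thesis by (metis dist_norm)
qed

context attitude_error_system
begin

lemma potential_D_pos: "potential l (D m) > 0"
  unfolding potential_D using l_pos[of 1] l_pos[of 2] l_pos[of 3] exhaust_3[of m] by auto

lemma energy_limit_le:
  assumes "sol t0 x" "(x \<longlongrightarrow> q) at_top"
  shows "energy q \<le> energy (x t0)"
proof (rule tendsto_upperbound)
  show "((\<lambda>t. energy (x t)) \<longlongrightarrow> energy q) at_top"
    using continuous_on_tendsto_compose[OF continuous_on_energy[of UNIV] assms(2)] by simp
  show "\<forall>\<^sub>F t in at_top. energy (x t) \<le> energy (x t0)"
    unfolding eventually_at_top_linorder using energy_antimono[OF assms(1) refl refl order_refl] by blast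
qed simp

lemma energy_small_near_identity:
  assumes "e > 0"
  obtains d where "d > 0" "\<And>z. dist z (mat 1, 0) < d \<Longrightarrow> energy z < e"
proof -
  have "energy (mat 1, 0) = 0" by (simp add: energy_def potential_one)
  moreover obtain d where "d > 0" "\<And>z. dist z (mat 1, 0) < d \<Longrightarrow> dist (energy z) (energy (mat 1, 0)) < e"
    using continuous_on_energy[of UNIV] assms unfolding continuous_on_iff by (meson UNIV_I)
  ultimately show ?thesis using that[of d] by (force simp: dist_norm)
qed

text \<open>
  The energy bounds the squared distance to the equilibrium from above up to a factor, is continuous, vanishes
  at the equilibrium and does not increase.
\<close>

lemma lyapunov_stable_identity: "lyapunov_stable (sol t0) t0 (mat 1, 0)"
  unfolding lyapunov_stable_def
proof (intro allI impI)
  fix e :: real assume "e > 0"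
  obtain c where c: "c > 0" "\<And>i. c \<le> l $ i" using vec3_lower_bound[of l] l_pos by blast
  define b where "b = min c 1 / 2"
  have b: "b > 0" "b \<le> c / 2" "b \<le> 1 / 2" unfolding b_def using c by auto
  have low: "b * (dist z (mat 1, 0))\<^sup>2 \<le> energy z" if "rotation_matrix (fst z)" for z
  proof -
    have "(dist z (mat 1, 0))\<^sup>2 = (norm (fst z - mat 1))\<^sup>2 + (norm (snd z))\<^sup>2"
      by (simp add: dist_prod_def dist_norm)
    then have "b * (dist z (mat 1, 0))\<^sup>2 = b * (norm (fst z - mat 1))\<^sup>2 + b * (norm (snd z))\<^sup>2"
      by (simp add: algebra_simps)
    also have "\<dots> \<le> c / 2 * (norm (fst z - mat 1))\<^sup>2 + 1 / 2 * (norm (snd z))\<^sup>2"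
      using b by (intro add_mono mult_right_mono) auto
    also have "\<dots> \<le> energy z"
      unfolding energy_def using potential_lower_bound[OF that c(2)] by simp
    finally show ?thesis .
  qed
  obtain d where d: "d > 0" "\<And>z. dist z (mat 1, 0) < d \<Longrightarrow> energy z < b * e\<^sup>2"
    using energy_small_near_identity[of "b * e\<^sup>2"] b \<open>e > 0\<close> by auto
  have "dist (x t) (mat 1, 0) < e" if "sol t0 x" "dist (x t0) (mat 1, 0) < d" "t \<ge> t0" for x t
  proof -
    have "b * (dist (x t) (mat 1, 0))\<^sup>2 \<le> energy (x t)"
      using low sol_rotation[OF that(1) refl refl that(3)] by simp
    also have "\<dots> \<le> energy (x t0)" by (rule energy_antimono[OF that(1) refl refl order_refl that(3)])
    also have "\<dots> < b * e\<^sup>2" by (rule d(2)[OF that(2)])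
    finally have "(dist (x t) (mat 1, 0))\<^sup>2 < e\<^sup>2" using b by simp
    then show ?thesis using \<open>e > 0\<close> by (simp add: power2_less_imp_less)
  qed
  then show "\<exists>d>0. \<forall>x. sol t0 x \<and> dist (x t0) (mat 1, 0) < d \<longrightarrow> (\<forall>t\<ge>t0. dist (x t) (mat 1, 0) < e)"
    using d(1) by blast
qed

text \<open>
  A trajectory whose initial energy is below the potential of every half-turn cannot converge to one of them.
\<close>

lemma locally_attractive_identity:
  assumes "t0 \<ge> 0"
  shows "\<exists>c>0. \<forall>x0\<in>state_space. dist x0 (mat 1, 0) < c \<longrightarrow> converges_from (sol t0) t0 (mat 1, 0) x0"
proof -
  define p where "p = Min (range (\<lambda>m. potential l (D m)))"
  have p: "p > 0" "p \<le> potential l (D m)" for m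
    unfolding p_def using potential_D_pos by (auto simp: Min_gr_iff)
  obtain d where d: "d > 0" "\<And>z. dist z (mat 1, 0) < d \<Longrightarrow> energy z < p"
    using energy_small_near_identity[OF p(1)] by blast
  have "converges_from (sol t0) t0 (mat 1, 0) x0" if "x0 \<in> state_space" "dist x0 (mat 1, 0) < d" for x0
    unfolding converges_from_def
  proof
    show "\<exists>x. sol t0 x \<and> x t0 = x0"
      using solution_exists[OF assms, of "fst x0" "snd x0"] that(1) by (auto simp: state_space_def)
    show "\<forall>x. sol t0 x \<and> x t0 = x0 \<longrightarrow> (x \<longlongrightarrow> (mat 1, 0)) at_top"
    proof (intro allI impI, elim conjE)
      fix x assume x: "sol t0 x" "x t0 = x0"
      have "\<not> (x \<longlongrightarrow> (D m, 0)) at_top" for m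
      proof
        assume "(x \<longlongrightarrow> (D m, 0)) at_top"
        then have "energy (D m, 0) \<le> energy x0" using energy_limit_le[OF x(1)] x(2) by simp
        moreover have "energy (D m, 0) = potential l (D m)" by (simp add: energy_def)
        ultimately show False using d(2)[OF that(2)] p(2)[of m] by linarith
      qed
      then show "(x \<longlongrightarrow> (mat 1, 0)) at_top" using sol_converges[OF x(1) refl refl assms] by blast
    qed
  qed
  then show ?thesis using d(1) by blast
qed

text \<open>
  A trajectory that starts at rest with smaller potential than \<open>D m\<close> cannot converge to \<open>D m\<close>, so its
  limit is another equilibrium, which is at distance at least \<open>2\<close>.
\<close>

lemma D_unstable:
  assumes "t0 \<ge> 0"
  shows "\<not> lyapunov_stable (sol t0) t0 (D m, 0)"
proof
  assume "lyapunov_stable (sol t0) t0 (D m, 0)"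
  then obtain d where d: "d > 0"
    "\<And>x t. sol t0 x \<Longrightarrow> dist (x t0) (D m, 0) < d \<Longrightarrow> t \<ge> t0 \<Longrightarrow> dist (x t) (D m, 0) < 1"
    unfolding lyapunov_stable_def by (meson zero_less_one)
  obtain Q where Q: "rotation_matrix Q" "dist Q (D m) < d" "potential l Q < potential l (D m)"
    using potential_descent_near_D[of l d m] l_pos d(1) by blast
  obtain x where x: "sol t0 x" "x t0 = (Q, 0)" using solution_exists[OF assms Q(1)] by blast
  have near: "dist (x t) (D m, 0) < 1" if "t \<ge> t0" for t
    by (rule d(2)[OF x(1) _ that]) (use Q x in \<open>simp add: dist_prod_def\<close>)
  obtain q where q: "(x \<longlongrightarrow> (q, 0)) at_top" "q = mat 1 \<or> (\<exists>m'. q = D m')"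
    using sol_converges[OF x(1) refl refl assms] by blast
  have "dist (q, 0 :: real^3) (D m, 0) \<le> 1"
  proof (rule tendsto_upperbound)
    show "((\<lambda>t. dist (x t) (D m, 0)) \<longlongrightarrow> dist (q, 0 :: real^3) (D m, 0)) at_top"
      by (intro tendsto_intros q)
    show "\<forall>\<^sub>F t in at_top. dist (x t) (D m, 0) \<le> 1"
      unfolding eventually_at_top_linorder using near less_imp_le by blast
  qed simp
  then have "dist q (D m) \<le> 1" by (simp add: dist_prod_def)
  then have "q = D m" using dist_D_ge[of q _ m] q(2) by fastforce
  then have "energy (D m, 0) \<le> energy (Q, 0)" using energy_limit_le[OF x(1) q(1)] x(2) by simp
  then show False using Q(3) by (simp add: energy_def)
qed

end

section \<open>Pairs of trajectories near a half-turn\<close>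

lemma other_indices_3:
  obtains i j :: 3 where "i \<noteq> m" "j \<noteq> m" "i \<noteq> j" "UNIV = {m, i, j}"
proof -
  have U: "UNIV = {2, 1, 3 :: 3}" "UNIV = {3, 1, 2 :: 3}" "UNIV = {1, 2, 3 :: 3}"
    unfolding UNIV_3 by auto
  consider "m = 1" | "m = 2" | "m = 3" using exhaust_3[of m] by blast
  then show ?thesis
  proof cases
    case 1 then show ?thesis using that[of 2 3] U(3) by simp
  next
    case 2 then show ?thesis using that[of 1 3] U(1) by simp
  next
    case 3 then show ?thesis using that[of 1 2] U(2) by simp
  qed
qed

context attitude_error_system
begin

lemma stiffness_self_neg: "stiffness l m m < 0"
  using exhaust_3[of m] l_pos[of 1] l_pos[of 2] l_pos[of 3]
  by (auto simp: stiffness_def sum_UNIV_minus_3)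

lemma stiffness_nonzero: "stiffness l m i \<noteq> 0"
  using exhaust_3[of m] exhaust_3[of i] l_pos[of 1] l_pos[of 2] l_pos[of 3]
    l_distinct[of 1 2] l_distinct[of 1 3] l_distinct[of 2 3]
  by (auto simp: stiffness_def sum_UNIV_minus_3)

definition torque_chart :: "3 \<Rightarrow> real \<Rightarrow> real \<Rightarrow> bool" where
  "torque_chart m c e \<longleftrightarrow> 0 < c \<and> 0 < e \<and>
     (\<forall>P Q. rotation_matrix P \<longrightarrow> rotation_matrix Q \<longrightarrow> norm (P - D m) \<le> e \<longrightarrow> norm (Q - D m) \<le> e
        \<longrightarrow> norm (P - Q) \<le> c * norm (torque l (P - Q)))"

text \<open>
  The torque is a coordinate system on the rotations near \<open>D m\<close>. If \<open>A = P - Q\<close> is a difference of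
  rotations, then \<open>P P\<^sup>T = Q Q\<^sup>T\<close> shows that \<open>A D + D A\<^sup>T\<close> is small compared to \<open>A\<close>; and the linear map that
  sends \<open>A\<close> to its torque together with \<open>A D + D A\<^sup>T\<close> is injective.
\<close>

lemma torque_chart_exists: "\<exists>c e. torque_chart m c e"
proof -
  define F where "F A = (torque l A, A ** D m + D m ** transpose A)" for A
  have linF: "linear F"
    unfolding F_def linear_conv_bounded_linear
    by (intro bounded_linear_Pair bounded_linear_torque bounded_linear_add
        bounded_bilinear.bounded_linear_left[OF bounded_bilinear_matrix_mult]
        bounded_linear_compose[OF bounded_bilinear.bounded_linear_right[OF bounded_bilinear_matrix_mult]
          bounded_linear_transpose])
  have "A = 0" if "F A = 0" for A
  proof -
    have t: "l$3 * A$3$2 = l$2 * A$2$3" "l$1 * A$1$3 = l$3 * A$3$1" "l$2 * A$2$1 = l$1 * A$1$2"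
      using that by (simp_all add: F_def zero_prod_def vec_eq_iff forall_3)
    have d: "(A ** D m + D m ** transpose A) $ i $ j = 0" for i j
      using that by (simp add: F_def zero_prod_def)
    show ?thesis
    proof -
      have pair: "x = 0 \<and> y = 0" if "p * x = q * y" "x = y \<or> x = - y" "p > 0" "q > 0" "p \<noteq> q"
        for x y p q :: real
      proof -
        have "(p - q) * y = 0 \<or> (p + q) * y = 0" using that(1,2) by (auto simp: algebra_simps)
        then show ?thesis using that by auto
      qed
      have diag: "A $ i $ i = 0" for i
        using d[of i i] by (simp add: mult_D_component split: if_splits)
      have off: "A $ i $ j = A $ j $ i \<or> A $ i $ j = - A $ j $ i" for i j
        using d[of i j] by (auto simp: mult_D_component split: if_splits)
      show ?thesis
        using pair[OF t(1) off l_pos l_pos] pair[OF t(2) off l_pos l_pos] pair[OF t(3) off l_pos l_pos]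
          l_distinct[of 1 2] l_distinct[of 1 3] l_distinct[of 2 3] diag
        by (simp add: vec_eq_iff forall_3)
    qed
  qed
  then have "inj F" using linear_injective_0[OF linF] by blast
  then obtain b where b: "b > 0" "\<And>A. b * norm A \<le> norm (F A)"
    using linear_inj_bounded_below_pos[OF linF] by blast
  obtain c1 where c1: "c1 > 0" "\<And>(X :: real^3^3) (Y :: real^3^3). norm (X ** Y) \<le> norm X * norm Y * c1"
    using bounded_bilinear.pos_bounded[OF bounded_bilinear_matrix_mult] by blast
  obtain c2 where c2: "c2 > 0" "\<And>A :: real^3^3. norm (transpose A) \<le> norm A * c2"
    using bounded_linear.pos_bounded[OF bounded_linear_transpose] by blast
  \<comment> \<open>with this radius, \<open>A D + D A\<^sup>T\<close> is bounded by half of the lower bound of \<open>F\<close> at \<open>A\<close>\<close>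
  define e where "e = b / (4 * (c1 * c2))"
  have e: "e > 0" "2 * (e * c1 * c2) = b / 2" unfolding e_def using b c1 c2 by (auto simp: field_simps)
  have "norm (P - Q) \<le> 2 / b * norm (torque l (P - Q))"
    if P: "rotation_matrix P" "norm (P - D m) \<le> e" and Q: "rotation_matrix Q" "norm (Q - D m) \<le> e" for P Q
  proof -
    let ?A = "P - Q"
    have "P ** transpose P - Q ** transpose Q = 0"
      using P Q by (simp add: rotation_matrix_mult_transpose)
    moreover have "?A ** D m + D m ** transpose ?A + (?A ** transpose (P - D m) + (Q - D m) ** transpose ?A)
        = P ** transpose P - Q ** transpose Q"
    proof -
      have "transpose (D m) = D m" by (simp add: vec_eq_iff D_component)
      then show ?thesis
        by (simp add: linear_diff[OF bounded_linear.linear[OF bounded_linear_transpose]] matrix_mult_simps)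
    qed
    ultimately have "?A ** D m + D m ** transpose ?A = - (?A ** transpose (P - D m) + (Q - D m) ** transpose ?A)"
      by (subst eq_neg_iff_add_eq_0) (simp only:)
    then have "norm (?A ** D m + D m ** transpose ?A)
        \<le> norm (?A ** transpose (P - D m)) + norm ((Q - D m) ** transpose ?A)"
      by (simp only: norm_minus_cancel norm_triangle_ineq)
    also have "\<dots> \<le> norm ?A * (e * c2) * c1 + e * (norm ?A * c2) * c1"
    proof (intro add_mono)
      have "norm (transpose (P - D m)) \<le> e * c2"
        by (rule order_trans[OF c2(2)]) (use P c2 in \<open>auto intro: mult_right_mono\<close>)
      then show "norm (?A ** transpose (P - D m)) \<le> norm ?A * (e * c2) * c1"
        by (intro order_trans[OF c1(2)] mult_right_mono mult_left_mono) (use c1 in auto)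
      show "norm ((Q - D m) ** transpose ?A) \<le> e * (norm ?A * c2) * c1"
        by (intro order_trans[OF c1(2)] mult_right_mono mult_mono c2(2) Q) (use c1 e in auto)
    qed
    also have "\<dots> = 2 * (e * c1 * c2) * norm ?A" by (simp add: algebra_simps)
    also have "\<dots> = b / 2 * norm ?A" by (simp only: e)
    finally have "norm (F ?A) \<le> norm (torque l ?A) + b / 2 * norm ?A"
      unfolding F_def by (intro order_trans[OF norm_Pair_le] add_left_mono)
    with b(2)[of ?A] have "b / 2 * norm ?A \<le> norm (torque l ?A)" by simp
    then have "2 / b * (b / 2 * norm ?A) \<le> 2 / b * norm (torque l ?A)" using b by (intro mult_left_mono) auto
    then show ?thesis using b by simp
  qed
  then have "torque_chart m (2 / b) e" unfolding torque_chart_def using b e by simp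
  then show ?thesis by blast
qed

context
  fixes t0 x y Q1 V1 Q2 V2 A v u
  assumes x: "sol t0 x" and y: "sol t0 y" and t0: "t0 \<ge> 0"
    and Q1_def: "Q1 = (\<lambda>t. fst (x t))" and V1_def: "V1 = (\<lambda>t. snd (x t))"
    and Q2_def: "Q2 = (\<lambda>t. fst (y t))" and V2_def: "V2 = (\<lambda>t. snd (y t))"
    and A_def: "A = (\<lambda>t. Q1 t - Q2 t)" and v_def: "v = (\<lambda>t. V1 t - V2 t)"
    and u_def: "u = (\<lambda>t. torque l (A t))"
begin

lemma derivative_A:
  assumes "t \<ge> t0"
  shows "(A has_vector_derivative - (A t ** skew (V1 t) + Q2 t ** skew (v t))) (at t within {t0..})"
  unfolding A_def v_def
  by (rule has_vector_derivative_eq_rhs[OF has_vector_derivative_diff[OF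
        sol_Q[OF x Q1_def V1_def assms] sol_Q[OF y Q2_def V2_def assms]]])
     (simp add: matrix_mult_simps skew_diff)

lemma derivative_v:
  assumes "t \<ge> t0"
  shows "(v has_vector_derivative cross3 (a t) (v t) - k *\<^sub>R v t + u t) (at t within {t0..})"
  unfolding v_def u_def A_def
  by (rule has_vector_derivative_eq_rhs[OF has_vector_derivative_diff[OF
        sol_V[OF x Q1_def V1_def assms] sol_V[OF y Q2_def V2_def assms]]])
     (simp add: torque_diff bounded_bilinear.diff_right[OF bounded_bilinear_cross3] algebra_simps)

lemma dist_solutions: "(dist (x t) (y t))\<^sup>2 = (norm (A t))\<^sup>2 + (norm (v t))\<^sup>2"
  by (simp add: dist_prod_def dist_norm A_def v_def Q1_def Q2_def V1_def V2_def)

end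

text \<open>
  Gronwall's inequality in reversed time. The terms of the difference dynamics that could grow with the velocities are orthogonal to
  the differences, so that \<open>G\<close> does not depend on the trajectories.
\<close>

lemma backward_lipschitz:
  obtains G where "\<And>t0 x y T. t0 \<ge> 0 \<Longrightarrow> sol t0 x \<Longrightarrow> sol t0 y \<Longrightarrow> t0 \<le> T \<Longrightarrow>
    dist (x t0) (y t0) \<le> exp (G * (T - t0)) * dist (x T) (y T)"
proof -
  obtain c1 where c1: "c1 > 0" "\<And>(A :: real^3^3) w. norm (A ** skew w) \<le> norm A * norm w * c1"
    using bounded_bilinear.pos_bounded[OF bounded_bilinear_mult_skew] by blast
  obtain c2 where c2: "c2 > 0" "\<And>A. norm (torque l A) \<le> norm A * c2"
    using bounded_linear.pos_bounded[OF bounded_linear_torque] by blast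
  define G where "G = 2 * c1 + c2 + 2 * k"
  have "dist (x t0) (y t0) \<le> exp (G / 2 * (T - t0)) * dist (x T) (y T)"
    if t0: "t0 \<ge> 0" and x: "sol t0 x" and y: "sol t0 y" and T: "t0 \<le> T" for t0 x y T
  proof -
    define Q1 V1 Q2 V2 where def12: "Q1 = (\<lambda>t. fst (x t))" "V1 = (\<lambda>t. snd (x t))"
      "Q2 = (\<lambda>t. fst (y t))" "V2 = (\<lambda>t. snd (y t))"
    define A v where def_diff: "A = (\<lambda>t. Q1 t - Q2 t)" "v = (\<lambda>t. V1 t - V2 t)"
    define u where u_def: "u = (\<lambda>t. torque l (A t))"
    note difference = x y t0 def12 def_diff u_def
    define f where "f t = (norm (A t))\<^sup>2 / 2 + (norm (v t))\<^sup>2 / 2" for t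
    define f' where "f' t = A t \<bullet> - (A t ** skew (V1 t) + Q2 t ** skew (v t))
      + v t \<bullet> (cross3 (a t) (v t) - k *\<^sub>R v t + u t)" for t
    define g where "g t = - (f t * exp (G * (t - t0)))" for t
    define g' where "g' t = - (f' t * exp (G * (t - t0)) + G * exp (G * (t - t0)) * f t)" for t
    have "g T \<le> g t0"
    proof (rule antimono_if_derivative_nonpos[of t0 g g'])
      fix t assume t: "t \<ge> t0"
      have "(f has_real_derivative f' t) (at t within {t0..})"
        unfolding f_def f'_def
        by (intro DERIV_add derivative_half_norm_square derivative_A[OF difference t]
            derivative_v[OF difference t])
      moreover have "((\<lambda>t. exp (G * (t - t0))) has_real_derivative G * exp (G * (t - t0))) (at t within {t0..})"
        by (auto intro!: derivative_eq_intros)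
      ultimately show "(g has_real_derivative g' t) (at t within {t0..})"
        unfolding g_def g'_def by (intro DERIV_minus DERIV_mult)
      have "norm (Q2 t) \<le> 2"
        unfolding def12 using norm_rotation_le sol_rotation[OF y refl refl t] by simp
      then have "norm (Q2 t ** skew (v t)) \<le> 2 * norm (v t) * c1"
        by (intro order_trans[OF c1(2)] mult_right_mono) (use c1 in auto)
      then have 1: "A t \<bullet> (Q2 t ** skew (v t)) \<le> norm (A t) * (2 * norm (v t) * c1)"
        by (intro order_trans[OF norm_cauchy_schwarz] mult_left_mono) auto
      have 2: "- (v t \<bullet> u t) \<le> norm (v t) * (norm (A t) * c2)"
        using Cauchy_Schwarz_ineq2[of "v t" "u t"] mult_left_mono[OF c2(2)[of "A t"] norm_ge_zero[of "v t"]]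
        unfolding u_def by linarith
      have "- f' t \<le> (2 * c1 + c2) * (norm (A t) * norm (v t)) + k * (norm (v t))\<^sup>2"
        using 1 2 unfolding f'_def
        by (simp add: inner_add_right inner_diff_right inner_mult_skew_self power2_norm_eq_inner algebra_simps)
      also have "\<dots> \<le> (2 * c1 + c2) * f t + 2 * k * f t"
      proof (intro add_mono mult_left_mono)
        show "norm (A t) * norm (v t) \<le> f t"
          using sum_squares_bound[of "norm (A t)" "norm (v t)"] unfolding f_def by simp
        have "(norm (v t))\<^sup>2 \<le> 2 * f t" unfolding f_def by simp
        then have "k * (norm (v t))\<^sup>2 \<le> k * (2 * f t)" using k_pos by (intro mult_left_mono) auto
        then show "k * (norm (v t))\<^sup>2 \<le> 2 * k * f t" by simp
      qed (use c1 c2 in auto)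
      also have "\<dots> = G * f t" unfolding G_def by (simp add: algebra_simps)
      finally have "0 \<le> (f' t + G * f t) * exp (G * (t - t0))" by simp
      then show "g' t \<le> 0" unfolding g'_def by (simp add: algebra_simps)
    qed (use T in auto)
    then have le: "f t0 \<le> f T * exp (G * (T - t0))" unfolding g_def by simp
    have sq: "(dist (x t) (y t))\<^sup>2 = 2 * f t" for t
      unfolding f_def using dist_solutions[OF difference] by simp
    have "(exp (G / 2 * (T - t0)))\<^sup>2 = exp (G * (T - t0))" by (simp flip: exp_double)
    then have "(dist (x t0) (y t0))\<^sup>2 \<le> (exp (G / 2 * (T - t0)) * dist (x T) (y T))\<^sup>2"
      unfolding power_mult_distrib sq using le by (simp add: mult.commute)
    then show ?thesis by (rule power2_le_imp_le) simp
  qed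
  then show ?thesis using that by blast
qed

end

context attitude_error_system
begin

text \<open>
  The second-order part of the energy near \<open>D m\<close>, with the torque \<open>u\<close> as coordinate for the rotation, so that the
  potential has the coefficients \<open>1 / stiffness l m i\<close>. The cross term has the same purpose as in
  \<open>velocity_and_torque_vanish\<close>, namely to dissipate \<open>(norm u)\<^sup>2\<close> as well.
\<close>

definition pair_form :: "3 \<Rightarrow> real \<Rightarrow> real^3 \<Rightarrow> real^3 \<Rightarrow> real" where
  "pair_form m \<eta> u v = (norm v)\<^sup>2 / 2 + (u \<bullet> (\<chi> i. u $ i / stiffness l m i)) / 2 - \<eta> * (v \<bullet> u)"

definition settles :: "real \<Rightarrow> 3 \<Rightarrow> real \<Rightarrow> real \<Rightarrow> (real \<Rightarrow> (real^3^3) \<times> (real^3)) \<Rightarrow> bool" where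
  "settles t0 m e T x \<longleftrightarrow>
     sol t0 x \<and> (x \<longlongrightarrow> (D m, 0)) at_top \<and> (\<forall>t\<ge>T. dist (x t) (D m, 0) \<le> e)"

text \<open>
  For the linearization at \<open>D m\<close>, the form dissipates a multiple of \<open>(norm u)\<^sup>2 + (norm v)\<^sup>2\<close>. The
  difference of two nonlinear trajectories obeys the linearization up to a remainder \<open>r\<close> that is \<open>e\<close> times a
  bounded multiple of \<open>norm u + norm v\<close>, so the form still decreases if \<open>e\<close> is small. It tends to zero, hence it was
  nonnegative.
\<close>

lemma pair_form_nonneg:
  obtains e \<eta> where "e > 0" "\<eta> > 0" "\<eta> \<le> 1 / (2 * \<bar>stiffness l m m\<bar>)"
    "\<And>t0 x y T. t0 \<ge> 0 \<Longrightarrow> t0 \<le> T \<Longrightarrow> settles t0 m e T x \<Longrightarrow> settles t0 m e T y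
       \<Longrightarrow> 0 \<le> pair_form m \<eta> (torque l (fst (x T) - fst (y T))) (snd (x T) - snd (y T))"
proof -
  obtain c1 where c1: "c1 > 0" "\<And>(A :: real^3^3) w. norm (A ** skew w) \<le> norm A * norm w * c1"
    using bounded_bilinear.pos_bounded[OF bounded_bilinear_mult_skew] by blast
  obtain c2 where c2: "c2 > 0" "\<And>A. norm (torque l A) \<le> norm A * c2"
    using bounded_linear.pos_bounded[OF bounded_linear_torque] by blast
  obtain c e0 where chart: "torque_chart m c e0" using torque_chart_exists by blast
  then have c: "c > 0" and e0: "e0 > 0" unfolding torque_chart_def by auto
  define s where "s u = (\<chi> i. u $ i / stiffness l m i)" for u :: "real^3"
  have bls: "bounded_linear s"
    unfolding linear_conv_bounded_linear[symmetric] s_def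
    by (rule linearI) (simp_all add: vec_eq_iff add_divide_distrib)
  obtain cs where cs: "cs > 0" "\<And>u. norm (s u) \<le> norm u * cs"
    using bounded_linear.pos_bounded[OF bls] by blast
  have s_sym: "u \<bullet> s w = w \<bullet> s u" for u w by (simp add: s_def inner_vec3 mult.commute)
  have s_inv: "s u \<bullet> torque l (D m ** skew w) = u \<bullet> w" for u w
    using stiffness_nonzero by (simp add: torque_D_skew s_def inner_vec3)
  define H where "H = norm (D m) * c1 * c2"
  have H: "norm (torque l (D m ** skew w)) \<le> H * norm w" for w
  proof -
    have "norm (torque l (D m ** skew w)) \<le> (norm (D m) * norm w * c1) * c2"
      by (rule order_trans[OF c2(2)]) (intro mult_right_mono c1(2) less_imp_le c2(1))
    then show ?thesis unfolding H_def by (simp add: algebra_simps)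
  qed
  have H0: "H \<ge> 0" unfolding H_def using c1 c2 by simp
  define N where "N = H + (B + k)\<^sup>2 / 2"
  have N: "N > 0" unfolding N_def using H0 k_pos B_nonneg by (simp add: add_nonneg_pos)
  \<comment> \<open>the first bound limits the loss of damping to one half; the second one is for \<open>pair_form_nonneg_bound\<close>\<close>
  define \<eta> where "\<eta> = min (k / (2 * N)) (1 / (2 * \<bar>stiffness l m m\<bar>))"
  have \<eta>: "\<eta> > 0" "\<eta> * N \<le> k / 2" "\<eta> \<le> 1 / (2 * \<bar>stiffness l m m\<bar>)"
  proof -
    show "\<eta> > 0" unfolding \<eta>_def using N k_pos stiffness_nonzero by simp
    have "\<eta> * N \<le> k / (2 * N) * N" unfolding \<eta>_def using N by (intro mult_right_mono) auto
    then show "\<eta> * N \<le> k / 2" using N by simp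
    show "\<eta> \<le> 1 / (2 * \<bar>stiffness l m m\<bar>)" unfolding \<eta>_def by simp
  qed
  define \<mu> where "\<mu> = min k \<eta> / 2"
  have \<mu>: "\<mu> > 0" "\<mu> \<le> k / 2" "\<mu> \<le> \<eta> / 2" unfolding \<mu>_def using k_pos \<eta> by auto
  define c3 where "c3 = c1 * c2 * (1 + c)"
  have c3: "c3 > 0" unfolding c3_def using c1 c2 c by (simp add: add_pos_pos)
  \<comment> \<open>at this distance the remainder uses up at most the dissipation \<open>\<mu>\<close>\<close>
  define e where "e = min e0 (\<mu> / (2 * ((cs + \<eta>) * c3)))"
  have e: "e > 0" "e \<le> e0" "(cs + \<eta>) * c3 * e * 2 \<le> \<mu>"
  proof -
    have pos: "(cs + \<eta>) * c3 > 0" using cs \<eta> c3 by simp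
    show "e > 0" unfolding e_def using e0 \<mu> pos by simp
    show "e \<le> e0" unfolding e_def by simp
    have "2 * ((cs + \<eta>) * c3) * e \<le> 2 * ((cs + \<eta>) * c3) * (\<mu> / (2 * ((cs + \<eta>) * c3)))"
      unfolding e_def using pos by (intro mult_left_mono) auto
    also have "\<dots> = \<mu>" using cs \<eta> c3 by simp
    finally show "(cs + \<eta>) * c3 * e * 2 \<le> \<mu>" by (simp add: algebra_simps)
  qed
  have "0 \<le> pair_form m \<eta> (torque l (fst (x T) - fst (y T))) (snd (x T) - snd (y T))"
    if t0: "t0 \<ge> 0" and T: "t0 \<le> T" and settles: "settles t0 m e T x" "settles t0 m e T y" for t0 x y T
  proof -
    have x: "sol t0 x" and y: "sol t0 y"
      and lim: "(x \<longlongrightarrow> (D m, 0)) at_top" "(y \<longlongrightarrow> (D m, 0)) at_top"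
      and near: "\<And>t. t \<ge> T \<Longrightarrow> dist (x t) (D m, 0) \<le> e" "\<And>t. t \<ge> T \<Longrightarrow> dist (y t) (D m, 0) \<le> e"
      using settles unfolding settles_def by auto
    define Q1 V1 Q2 V2 where def12: "Q1 = (\<lambda>t. fst (x t))" "V1 = (\<lambda>t. snd (x t))"
      "Q2 = (\<lambda>t. fst (y t))" "V2 = (\<lambda>t. snd (y t))"
    define A v where def_diff: "A = (\<lambda>t. Q1 t - Q2 t)" "v = (\<lambda>t. V1 t - V2 t)"
    define u where u_def: "u = (\<lambda>t. torque l (A t))"
    note difference = x y t0 def12 def_diff u_def
    define z where "z t = cross3 (a t) (v t) - k *\<^sub>R v t" for t
    define r where "r t = torque l ((Q1 t - D m) ** skew (v t) + A t ** skew (V2 t))" for t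
    define hv where "hv t = torque l (D m ** skew (v t))" for t
    define f where "f t = (norm (v t))\<^sup>2 / 2 + (u t \<bullet> s (u t)) / 2 - \<eta> * (v t \<bullet> u t)" for t
    define f' where "f' t = v t \<bullet> (z t + u t)
      + (u t \<bullet> s (- (hv t + r t)) + - (hv t + r t) \<bullet> s (u t)) / 2
      - \<eta> * (v t \<bullet> - (hv t + r t) + (z t + u t) \<bullet> u t)" for t
    have f_eq: "f t = pair_form m \<eta> (torque l (fst (x t) - fst (y t))) (snd (x t) - snd (y t))" for t
      unfolding f_def pair_form_def s_def u_def def_diff def12 by simp
    have du: "(u has_vector_derivative - (hv t + r t)) (at t within {t0..})" if t: "t \<ge> t0" for t
    proof -
      have "A t ** skew (V1 t) + Q2 t ** skew (v t)
          = D m ** skew (v t) + ((Q1 t - D m) ** skew (v t) + A t ** skew (V2 t))"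
        unfolding def_diff
        by (simp add: matrix_mult_simps skew_diff)
      then have "- (hv t + r t) = torque l (- (A t ** skew (V1 t) + Q2 t ** skew (v t)))"
        unfolding hv_def r_def by (simp only: torque_minus linear_add[OF bounded_linear.linear[OF bounded_linear_torque]])
      then show ?thesis unfolding u_def
        using bounded_linear.has_vector_derivative[OF bounded_linear_torque derivative_A[OF difference t]] by simp
    qed
    have dv: "(v has_vector_derivative z t + u t) (at t within {t0..})" if t: "t \<ge> t0" for t
      unfolding z_def using derivative_v[OF difference t] .
    have df: "(f has_real_derivative f' t) (at t within {T..})" if "t \<ge> T" for t
    proof -
      have t: "t \<ge> t0" using that T by simp
      have "(f has_real_derivative f' t) (at t within {t0..})"
        unfolding f_def f'_def
        by (intro DERIV_diff DERIV_add DERIV_cmult DERIV_cdivide derivative_half_norm_square derivative_inner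
            du dv t bounded_linear.has_vector_derivative[OF bls])
      then show ?thesis by (rule DERIV_subset) (use T in auto)
    qed
    have f'_le: "f' t \<le> 0" if "t \<ge> T" for t
    proof -
      have t: "t \<ge> t0" using that T by simp
      have n1: "norm (Q1 t - D m) \<le> e" "norm (Q2 t - D m) \<le> e" "norm (V2 t) \<le> e"
        using order_trans[OF norm_fst_component_le near(1)[OF that, unfolded dist_norm]]
          order_trans[OF norm_fst_component_le near(2)[OF that, unfolded dist_norm]]
          order_trans[OF norm_snd_component_le near(2)[OF that, unfolded dist_norm]]
        unfolding def12 by simp_all
      have "norm (A t) \<le> c * norm (u t)"
        unfolding u_def def_diff
        by (rule chart[unfolded torque_chart_def, THEN conjunct2, THEN conjunct2, rule_format])
          (use n1 e sol_rotation[OF x refl refl t] sol_rotation[OF y refl refl t] in \<open>auto simp: def12\<close>)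
      then have r_le: "norm (r t) \<le> c3 * e * (norm (u t) + norm (v t))"
      proof -
        assume Au: "norm (A t) \<le> c * norm (u t)"
        have "norm ((Q1 t - D m) ** skew (v t) + A t ** skew (V2 t))
            \<le> norm (Q1 t - D m) * norm (v t) * c1 + norm (A t) * norm (V2 t) * c1"
          by (rule order_trans[OF norm_triangle_ineq]) (intro add_mono c1)
        also have "\<dots> \<le> e * norm (v t) * c1 + (c * norm (u t)) * e * c1"
          by (intro add_mono mult_right_mono mult_mono n1 Au) (use c1 c e in auto)
        also have "\<dots> = c1 * e * (norm (v t) + c * norm (u t))" by (simp add: algebra_simps)
        also have "\<dots> \<le> c1 * e * ((1 + c) * (norm (u t) + norm (v t)))"
          using c1 c e by (intro mult_left_mono) (auto simp: algebra_simps)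
        finally have "norm ((Q1 t - D m) ** skew (v t) + A t ** skew (V2 t)) * c2
            \<le> c1 * e * ((1 + c) * (norm (u t) + norm (v t))) * c2" using c2 by (intro mult_right_mono) auto
        then show ?thesis unfolding r_def c3_def by (intro order_trans[OF c2(2)]) (simp add: algebra_simps)
      qed
      have "norm (z t) \<le> (B + k) * norm (v t)"
      proof -
        have "norm (cross3 (a t) (v t)) \<le> B * norm (v t)"
          by (rule order_trans[OF norm_cross3_le]) (use a_bound t0 t in \<open>auto intro: mult_right_mono\<close>)
        then show ?thesis using norm_triangle_ineq4[of "cross3 (a t) (v t)" "k *\<^sub>R v t"] k_pos
          unfolding z_def by (simp add: algebra_simps)
      qed
      then have "\<bar>z t \<bullet> u t\<bar> \<le> (B + k) * norm (v t) * norm (u t)"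
        by (intro order_trans[OF Cauchy_Schwarz_ineq2] mult_right_mono) auto
      moreover have "2 * ((B + k) * norm (v t) * norm (u t)) \<le> ((B + k) * norm (v t))\<^sup>2 + (norm (u t))\<^sup>2"
        using sum_squares_bound[of "(B + k) * norm (v t)" "norm (u t)"] by simp
      ultimately have zu: "- (z t \<bullet> u t) \<le> (B + k)\<^sup>2 / 2 * (norm (v t))\<^sup>2 + (norm (u t))\<^sup>2 / 2"
        by (simp add: power_mult_distrib)
      have vh: "v t \<bullet> hv t \<le> H * (norm (v t))\<^sup>2"
      proof -
        have "v t \<bullet> hv t \<le> norm (v t) * (H * norm (v t))"
          unfolding hv_def by (intro order_trans[OF norm_cauchy_schwarz] mult_left_mono H) auto
        then show ?thesis by (simp add: power2_eq_square algebra_simps)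
      qed
      have vr: "\<bar>v t \<bullet> r t\<bar> \<le> norm (v t) * norm (r t)" by (rule Cauchy_Schwarz_ineq2)
      have sr: "\<bar>s (u t) \<bullet> r t\<bar> \<le> norm (u t) * cs * norm (r t)"
        by (intro order_trans[OF Cauchy_Schwarz_ineq2] mult_right_mono cs) auto
      have vz: "v t \<bullet> z t = - k * (norm (v t))\<^sup>2"
        unfolding z_def by (simp add: inner_diff_right power2_norm_eq_inner)
      \<comment> \<open>\<open>s\<close> inverts the linearized torque, so that its share of the derivative cancels \<open>v t \<bullet> u t\<close>\<close>
      have su: "(u t \<bullet> s (- (hv t + r t)) + - (hv t + r t) \<bullet> s (u t)) / 2 = - (u t \<bullet> v t) - s (u t) \<bullet> r t"
      proof -
        define X where "X = - (hv t + r t)"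
        have "(u t \<bullet> s X + X \<bullet> s (u t)) / 2 = s (u t) \<bullet> X"
          using s_sym[of "u t" X] inner_commute[of X "s (u t)"] by simp
        also have "\<dots> = - (s (u t) \<bullet> hv t) - s (u t) \<bullet> r t"
          unfolding X_def by (simp add: inner_add_right inner_diff_right)
        finally show ?thesis unfolding X_def using s_inv[of "u t" "v t"] unfolding hv_def by simp
      qed
      have "f' t = - k * (norm (v t))\<^sup>2 - s (u t) \<bullet> r t
          + \<eta> * (v t \<bullet> hv t + v t \<bullet> r t - z t \<bullet> u t - (norm (u t))\<^sup>2)"
        unfolding f'_def su inner_add_right vz
        by (simp add: inner_add_left inner_add_right inner_commute power2_norm_eq_inner[of "u t"] algebra_simps)
      also have "\<dots> \<le> - k * (norm (v t))\<^sup>2 + norm (u t) * cs * norm (r t)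
          + \<eta> * (H * (norm (v t))\<^sup>2 + norm (v t) * norm (r t)
            + ((B + k)\<^sup>2 / 2 * (norm (v t))\<^sup>2 + (norm (u t))\<^sup>2 / 2) - (norm (u t))\<^sup>2)"
        using sr vr vh zu \<eta>(1) by (intro add_mono mult_left_mono) auto
      also have "\<dots> = - k * (norm (v t))\<^sup>2 + \<eta> * N * (norm (v t))\<^sup>2 - \<eta> / 2 * (norm (u t))\<^sup>2
          + (cs * norm (u t) + \<eta> * norm (v t)) * norm (r t)"
        unfolding N_def by (simp add: algebra_simps)
      also have "\<dots> \<le> - k * (norm (v t))\<^sup>2 + k / 2 * (norm (v t))\<^sup>2 - \<mu> * (norm (u t))\<^sup>2
          + \<mu> * ((norm (u t))\<^sup>2 + (norm (v t))\<^sup>2)"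
      proof -
        have "(cs * norm (u t) + \<eta> * norm (v t)) * norm (r t)
            \<le> ((cs + \<eta>) * (norm (u t) + norm (v t))) * (c3 * e * (norm (u t) + norm (v t)))"
          using cs \<eta> c3 e r_le by (intro mult_mono) (auto simp: algebra_simps)
        also have "\<dots> = (cs + \<eta>) * c3 * e * (norm (u t) + norm (v t))\<^sup>2"
          by (simp add: power2_eq_square)
        also have "\<dots> \<le> (cs + \<eta>) * c3 * e * (2 * ((norm (u t))\<^sup>2 + (norm (v t))\<^sup>2))"
          using cs \<eta> c3 e sum_squares_bound[of "norm (u t)" "norm (v t)"]
          by (intro mult_left_mono) (auto simp: power2_sum)
        also have "\<dots> = ((cs + \<eta>) * c3 * e * 2) * ((norm (u t))\<^sup>2 + (norm (v t))\<^sup>2)" by (simp add: mult.assoc)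
        also have "\<dots> \<le> \<mu> * ((norm (u t))\<^sup>2 + (norm (v t))\<^sup>2)"
          using e by (intro mult_right_mono) auto
        finally have 1: "(cs * norm (u t) + \<eta> * norm (v t)) * norm (r t) \<le> \<mu> * ((norm (u t))\<^sup>2 + (norm (v t))\<^sup>2)" .
        have 2: "\<mu> * (norm (u t))\<^sup>2 \<le> \<eta> / 2 * (norm (u t))\<^sup>2" using \<mu>(3) by (rule mult_right_mono) simp
        have 3: "\<eta> * N * (norm (v t))\<^sup>2 \<le> k / 2 * (norm (v t))\<^sup>2" using \<eta>(2) by (rule mult_right_mono) simp
        show ?thesis by (intro add_mono diff_mono order_refl 1 2 3)
      qed
      also have "\<dots> = (\<mu> - k / 2) * (norm (v t))\<^sup>2" by (simp add: algebra_simps)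
      also have "\<dots> \<le> 0" using \<mu> by (intro mult_nonpos_nonneg) auto
      finally show ?thesis .
    qed
    have le: "f t \<le> f T" if "t \<ge> T" for t
      by (rule antimono_if_derivative_nonpos[OF df f'_le]) (use that in auto)
    have lim12: "(Q1 \<longlongrightarrow> D m) at_top" "(V1 \<longlongrightarrow> 0) at_top" "(Q2 \<longlongrightarrow> D m) at_top" "(V2 \<longlongrightarrow> 0) at_top"
      unfolding def12 using tendsto_fst[OF lim(1)] tendsto_snd[OF lim(1)] tendsto_fst[OF lim(2)] tendsto_snd[OF lim(2)]
      by simp_all
    have limA: "(A \<longlongrightarrow> D m - D m) at_top" and limv: "(v \<longlongrightarrow> 0 - 0) at_top"
      unfolding def_diff by (intro tendsto_diff lim12)+
    have limu: "(u \<longlongrightarrow> torque l (D m - D m)) at_top"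
      unfolding u_def by (rule bounded_linear.tendsto[OF bounded_linear_torque limA])
    have "(f \<longlongrightarrow> (norm (0 - 0 :: real^3))\<^sup>2 / 2 + (torque l (D m - D m) \<bullet> s (torque l (D m - D m))) / 2
        - \<eta> * ((0 - 0) \<bullet> torque l (D m - D m))) at_top"
      unfolding f_def by (intro tendsto_intros limu limv bounded_linear.tendsto[OF bls]) auto
    then have "(f \<longlongrightarrow> 0) at_top" by (simp add: linear_0[OF bounded_linear.linear[OF bls]] linear_0[OF bounded_linear.linear[OF bounded_linear_torque]])
    then have "0 \<le> f T"
      by (rule tendsto_upperbound) (use le in \<open>auto simp: eventually_at_top_linorder\<close>)
    then show ?thesis unfolding f_eq .
  qed
  then show ?thesis using that[of e \<eta>] e(1) \<eta> by blast
qed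

end

section \<open>The exceptional initial states form a null set\<close>

context attitude_error_system
begin

definition trapped :: "real \<Rightarrow> 3 \<Rightarrow> real \<Rightarrow> real \<Rightarrow> ((real^3^3) \<times> (real^3)) set" where
  "trapped t0 m e T = {x t0 |x. settles t0 m e T x}"

text \<open>
  Since \<open>stiffness l m m < 0\<close>, nonnegativity bounds \<open>(u $ m)\<^sup>2\<close> by the remaining terms; the bound on \<open>\<eta>\<close> lets the
  part of the cross term that contains \<open>u $ m\<close> be absorbed.
\<close>

lemma pair_form_nonneg_bound:
  assumes P: "0 \<le> pair_form m \<eta> u v" and \<eta>: "\<eta> > 0" "\<eta> \<le> 1 / (2 * \<bar>stiffness l m m\<bar>)"
    and ij: "i \<noteq> m" "j \<noteq> m" "i \<noteq> j" "UNIV = {m, i, j}"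
  shows "(norm u)\<^sup>2 \<le> (2 * \<bar>stiffness l m m\<bar> * (1 + 1 / \<bar>stiffness l m i\<bar> + 1 / \<bar>stiffness l m j\<bar> + \<eta>) + 1)
    * ((u $ i)\<^sup>2 + (u $ j)\<^sup>2 + (norm v)\<^sup>2)"
proof -
  define h where "h = \<bar>stiffness l m m\<bar>"
  have h: "h > 0" "stiffness l m m = - h" unfolding h_def using stiffness_self_neg[of m] by auto
  define W where "W = 1 / \<bar>stiffness l m i\<bar> + 1 / \<bar>stiffness l m j\<bar>"
  define R where "R = (u $ i)\<^sup>2 + (u $ j)\<^sup>2 + (norm v)\<^sup>2"
  have sum_ij: "(\<Sum>n\<in>UNIV. f n) = f m + f i + f j" for f :: "3 \<Rightarrow> real"
    unfolding ij(4) using ij(1-3) by (simp add: add.assoc)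
  have nu: "(norm u)\<^sup>2 = (u $ m)\<^sup>2 + (u $ i)\<^sup>2 + (u $ j)\<^sup>2"
    unfolding power2_norm_eq_inner inner_vec_def sum_ij by (simp add: power2_eq_square)
  have us: "u \<bullet> (\<chi> n. u $ n / stiffness l m n)
      = - ((u $ m)\<^sup>2 / h) + (u $ i)\<^sup>2 / stiffness l m i + (u $ j)\<^sup>2 / stiffness l m j"
    unfolding inner_vec_def sum_ij h(2)[symmetric] by (simp add: power2_eq_square h(2))
  have W_le: "z\<^sup>2 / stiffness l m n \<le> W * z\<^sup>2" if "n = i \<or> n = j" for z n
  proof -
    have "z\<^sup>2 / stiffness l m n \<le> \<bar>z\<^sup>2 / stiffness l m n\<bar>" by (rule abs_ge_self)
    also have "\<dots> = 1 / \<bar>stiffness l m n\<bar> * z\<^sup>2" by simp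
    also have "\<dots> \<le> W * z\<^sup>2" unfolding W_def using that by (intro mult_right_mono) auto
    finally show ?thesis .
  qed
  have vu: "- (v \<bullet> u) \<le> ((norm v)\<^sup>2 + (norm u)\<^sup>2) / 2"
  proof -
    have "norm v * norm u \<le> ((norm v)\<^sup>2 + (norm u)\<^sup>2) / 2"
      using sum_squares_bound[of "norm v" "norm u"] by simp
    then show ?thesis using Cauchy_Schwarz_ineq2[of v u] by (meson abs_le_D2 order_trans)
  qed
  have "(u $ m)\<^sup>2 / (2 * h) \<le> (norm v)\<^sup>2 / 2 + ((u $ i)\<^sup>2 / stiffness l m i + (u $ j)\<^sup>2 / stiffness l m j) / 2
      + \<eta> * - (v \<bullet> u)"
    using P unfolding pair_form_def us by (simp add: field_simps)
  also have "\<dots> \<le> (norm v)\<^sup>2 / 2 + (W * (u $ i)\<^sup>2 + W * (u $ j)\<^sup>2) / 2 + \<eta> * (((norm v)\<^sup>2 + (norm u)\<^sup>2) / 2)"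
    using \<eta>(1) vu W_le by (intro add_mono divide_right_mono mult_left_mono order_refl) auto
  also have "\<dots> = (norm v)\<^sup>2 / 2 + W / 2 * ((u $ i)\<^sup>2 + (u $ j)\<^sup>2) + \<eta> / 2 * R + \<eta> / 2 * (u $ m)\<^sup>2"
    unfolding nu R_def by (simp add: algebra_simps add_divide_distrib)
  also have "\<dots> \<le> R / 2 + W / 2 * R + \<eta> / 2 * R + 1 / (4 * h) * (u $ m)\<^sup>2"
  proof (intro add_mono order_refl)
    show "(norm v)\<^sup>2 / 2 \<le> R / 2" unfolding R_def by simp
    show "W / 2 * ((u $ i)\<^sup>2 + (u $ j)\<^sup>2) \<le> W / 2 * R"
      unfolding R_def W_def by (intro mult_left_mono) auto
    have "\<eta> / 2 \<le> 1 / (4 * h)" using \<eta>(2) unfolding h_def by simp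
    then show "\<eta> / 2 * (u $ m)\<^sup>2 \<le> 1 / (4 * h) * (u $ m)\<^sup>2" by (rule mult_right_mono) simp
  qed
  finally have "(u $ m)\<^sup>2 / (4 * h) \<le> (1 + W + \<eta>) * R / 2"
    by (simp add: algebra_simps add_divide_distrib)
  then have "4 * h * ((u $ m)\<^sup>2 / (4 * h)) \<le> 4 * h * ((1 + W + \<eta>) * R / 2)"
    using h by (intro mult_left_mono) auto
  moreover have "4 * h * ((u $ m)\<^sup>2 / (4 * h)) = (u $ m)\<^sup>2" using h by simp
  moreover have "4 * h * ((1 + W + \<eta>) * R / 2) = 2 * h * (1 + W + \<eta>) * R" by (simp add: field_simps)
  ultimately have "(u $ m)\<^sup>2 \<le> 2 * h * (1 + W + \<eta>) * R" by (simp only:)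
  moreover have "(u $ i)\<^sup>2 + (u $ j)\<^sup>2 \<le> R" unfolding R_def by simp
  ultimately have "(norm u)\<^sup>2 \<le> (2 * h * (1 + W + \<eta>) + 1) * R"
    unfolding nu by (simp add: algebra_simps)
  then show ?thesis unfolding h_def W_def R_def by (simp add: add.assoc)
qed

text \<open>
  Two trapped trajectories have nonnegative pair form at time \<open>T\<close>, so their distance at time \<open>T\<close> is
  bounded by that of five coordinates, and so is their distance at time \<open>t0\<close> by \<open>backward_lipschitz\<close>.
\<close>

lemma hausdorff_null_trapped:
  obtains e where "e > 0" "\<And>t0 T. t0 \<ge> 0 \<Longrightarrow> t0 \<le> T \<Longrightarrow> hausdorff_null 6 (trapped t0 m e T)"
proof -
  obtain e1 \<eta> where e1: "e1 > 0" and \<eta>: "\<eta> > 0" "\<eta> \<le> 1 / (2 * \<bar>stiffness l m m\<bar>)"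
    and pair: "\<And>t0 x y T. t0 \<ge> 0 \<Longrightarrow> t0 \<le> T \<Longrightarrow> settles t0 m e1 T x \<Longrightarrow> settles t0 m e1 T y
       \<Longrightarrow> 0 \<le> pair_form m \<eta> (torque l (fst (x T) - fst (y T))) (snd (x T) - snd (y T))"
    using pair_form_nonneg[of m] by metis
  obtain c e2 where chart: "torque_chart m c e2" using torque_chart_exists by blast
  then have e2: "e2 > 0" unfolding torque_chart_def by auto
  obtain G where G: "\<And>t0 x y T. t0 \<ge> 0 \<Longrightarrow> sol t0 x \<Longrightarrow> sol t0 y \<Longrightarrow> t0 \<le> T \<Longrightarrow>
    dist (x t0) (y t0) \<le> exp (G * (T - t0)) * dist (x T) (y T)"
    using backward_lipschitz by blast
  obtain c2 where c2: "c2 > 0" "\<And>A. norm (torque l A) \<le> norm A * c2"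
    using bounded_linear.pos_bounded[OF bounded_linear_torque] by blast
  obtain i j where ij: "i \<noteq> m" "j \<noteq> m" "i \<noteq> j" "UNIV = {m, i, j}" using other_indices_3[of m] by metis
  define e where "e = min e1 e2"
  have e: "e > 0" "e \<le> e1" "e \<le> e2" unfolding e_def using e1 e2 by auto
  define L where "L = 2 * \<bar>stiffness l m m\<bar> * (1 + 1 / \<bar>stiffness l m i\<bar> + 1 / \<bar>stiffness l m j\<bar> + \<eta>) + 1"
  have L0: "L \<ge> 0" unfolding L_def using \<eta> by simp
  have "hausdorff_null 6 (trapped t0 m e T)" if t0: "t0 \<ge> 0" and T: "t0 \<le> T" for t0 T
  proof -
    have "\<forall>x0\<in>trapped t0 m e T. \<exists>x. settles t0 m e T x \<and> x t0 = x0" unfolding trapped_def by blast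
    then obtain X where X: "\<And>x0. x0 \<in> trapped t0 m e T \<Longrightarrow> settles t0 m e T (X x0) \<and> X x0 t0 = x0" by metis
    \<comment> \<open>five coordinates of the state at time \<open>T\<close>, the unstable one being left out\<close>
    define f where "f x0 = (torque l (fst (X x0 T)) $ i, torque l (fst (X x0 T)) $ j, snd (X x0 T))" for x0
    show ?thesis
    proof (rule hausdorff_null_co_lipschitz[where f = f])
      fix x0 assume x0: "x0 \<in> trapped t0 m e T"
      have rot: "rotation_matrix (fst (X x0 T))"
        using X[OF x0] sol_rotation[of t0 "X x0"] T unfolding settles_def by blast
      have tq: "norm (torque l (fst (X x0 T))) \<le> 2 * c2"
        by (rule order_trans[OF c2(2)]) (use c2 norm_rotation_le[OF rot] in \<open>auto intro: mult_right_mono\<close>)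
      have "norm (snd (X x0 T)) \<le> e"
        using X[OF x0] norm_snd_component_le[of "X x0 T - (D m, 0)"] T unfolding settles_def
        by (force simp: dist_norm)
      moreover have "norm (torque l (fst (X x0 T)) $ n) \<le> 2 * c2" for n
        using Finite_Cartesian_Product.norm_nth_le[of "torque l (fst (X x0 T))" n] tq by linarith
      ultimately show "norm (f x0) \<le> 2 * c2 + (2 * c2 + e)"
        unfolding f_def by (intro order_trans[OF norm_Pair_le] add_mono) auto
    next
      fix x0 y0 assume x0: "x0 \<in> trapped t0 m e T" and y0: "y0 \<in> trapped t0 m e T"
      let ?x = "X x0" and ?y = "X y0"
      have x: "sol t0 ?x" "?x t0 = x0" "(?x \<longlongrightarrow> (D m, 0)) at_top" "\<And>t. t \<ge> T \<Longrightarrow> dist (?x t) (D m, 0) \<le> e"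
        and y: "sol t0 ?y" "?y t0 = y0" "(?y \<longlongrightarrow> (D m, 0)) at_top" "\<And>t. t \<ge> T \<Longrightarrow> dist (?y t) (D m, 0) \<le> e"
        using X[OF x0] X[OF y0] unfolding settles_def by auto
      define A where "A = fst (?x T) - fst (?y T)"
      define v where "v = snd (?x T) - snd (?y T)"
      define u where "u = torque l A"
      have "0 \<le> pair_form m \<eta> u v" unfolding u_def A_def v_def
        by (rule pair[OF t0 T]) (use x y e(2) in \<open>auto simp: settles_def intro: order_trans\<close>)
      then have u_le: "(norm u)\<^sup>2 \<le> L * ((u $ i)\<^sup>2 + (u $ j)\<^sup>2 + (norm v)\<^sup>2)"
        unfolding L_def by (rule pair_form_nonneg_bound[OF _ \<eta> ij])
      have r: "(dist (f x0) (f y0))\<^sup>2 = (u $ i)\<^sup>2 + (u $ j)\<^sup>2 + (norm v)\<^sup>2"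
        by (simp add: f_def dist_prod_def dist_norm u_def A_def v_def torque_diff)
      have nearD: "norm (fst (?x T) - D m) \<le> e2" "norm (fst (?y T) - D m) \<le> e2"
        using x(4)[of T] y(4)[of T] norm_fst_component_le[of "?x T - (D m, 0)"]
          norm_fst_component_le[of "?y T - (D m, 0)"] e by (auto simp: dist_norm)
      have "norm A \<le> c * norm u" unfolding u_def A_def
        by (rule chart[unfolded torque_chart_def, THEN conjunct2, THEN conjunct2, rule_format])
          (use nearD sol_rotation[OF x(1) refl refl T] sol_rotation[OF y(1) refl refl T] in auto)
      then have "(norm A)\<^sup>2 \<le> c\<^sup>2 * (norm u)\<^sup>2"
        using power_mono[of "norm A" "c * norm u" 2] by (simp add: power_mult_distrib)
      also have "\<dots> \<le> c\<^sup>2 * (L * (dist (f x0) (f y0))\<^sup>2)"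
        unfolding r using u_le by (intro mult_left_mono) auto
      finally have "(norm A)\<^sup>2 \<le> c\<^sup>2 * (L * (dist (f x0) (f y0))\<^sup>2)" .
      then have "(dist (?x T) (?y T))\<^sup>2 \<le> c\<^sup>2 * (L * (dist (f x0) (f y0))\<^sup>2) + (dist (f x0) (f y0))\<^sup>2"
      proof -
        assume A_le: "(norm A)\<^sup>2 \<le> c\<^sup>2 * (L * (dist (f x0) (f y0))\<^sup>2)"
        have "(dist (?x T) (?y T))\<^sup>2 = (norm A)\<^sup>2 + (norm v)\<^sup>2"
          by (simp add: dist_prod_def dist_norm A_def v_def)
        moreover have "(norm v)\<^sup>2 \<le> (dist (f x0) (f y0))\<^sup>2" unfolding r by simp
        ultimately show ?thesis using A_le by (simp only: add_mono)
      qed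
      also have "\<dots> = (sqrt (c\<^sup>2 * L + 1) * dist (f x0) (f y0))\<^sup>2"
        using L0 by (simp add: power_mult_distrib algebra_simps)
      finally have "dist (?x T) (?y T) \<le> sqrt (c\<^sup>2 * L + 1) * dist (f x0) (f y0)"
        by (rule power2_le_imp_le) (use L0 in simp)
      then have "exp (G * (T - t0)) * dist (?x T) (?y T)
          \<le> exp (G * (T - t0)) * (sqrt (c\<^sup>2 * L + 1) * dist (f x0) (f y0))" by (rule mult_left_mono) simp
      from order_trans[OF G[OF t0 x(1) y(1) T] this]
      show "dist x0 y0 \<le> exp (G * (T - t0)) * sqrt (c\<^sup>2 * L + 1) * dist (f x0) (f y0)"
        unfolding x(2) y(2) by (simp only: mult.assoc)
    qed simp
  qed
  then show ?thesis using that e by blast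
qed

theorem identity_almost_globally_asymptotically_stable:
  assumes "t0 \<ge> 0"
  shows "almost_globally_asymptotically_stable 6 state_space (sol t0) t0 (mat 1, 0)"
proof -
  have "\<exists>e. \<forall>m. e m > 0 \<and> (\<forall>t0 T. t0 \<ge> 0 \<longrightarrow> t0 \<le> T \<longrightarrow> hausdorff_null 6 (trapped t0 m (e m) T))"
    using hausdorff_null_trapped by (intro choice) metis
  then obtain e where e: "\<And>m. e m > 0"
    "\<And>m t0 T. t0 \<ge> 0 \<Longrightarrow> t0 \<le> T \<Longrightarrow> hausdorff_null 6 (trapped t0 m (e m) T)" by blast
  let ?S = "\<lambda>(m, N :: nat). trapped t0 m (e m) (t0 + real N)"
  have "hausdorff_null 6 (\<Union>p\<in>UNIV. ?S p)"
    by (rule hausdorff_null_UN_countable) (use e assms in auto)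
  moreover have "{x0 \<in> state_space. \<not> converges_from (sol t0) t0 (mat 1, 0) x0} \<subseteq> (\<Union>p\<in>UNIV. ?S p)"
  proof
    fix x0 assume "x0 \<in> {x0 \<in> state_space. \<not> converges_from (sol t0) t0 (mat 1, 0) x0}"
    then have x0: "x0 \<in> state_space" "\<not> converges_from (sol t0) t0 (mat 1, 0) x0" by auto
    have "\<exists>x. sol t0 x \<and> x t0 = x0"
      using solution_exists[OF assms, of "fst x0" "snd x0"] x0(1) by (auto simp: state_space_def)
    then obtain x where x: "sol t0 x" "x t0 = x0" "\<not> (x \<longlongrightarrow> (mat 1, 0)) at_top"
      using x0(2) unfolding converges_from_def by blast
    then obtain m where m: "(x \<longlongrightarrow> (D m, 0)) at_top" using sol_converges[OF x(1) refl refl assms] by blast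
    obtain T where T: "\<And>t. t \<ge> T \<Longrightarrow> dist (x t) (D m, 0) < e m"
      using tendstoD[OF m e(1)[of m]] unfolding eventually_at_top_linorder by blast
    obtain N :: nat where "T - t0 \<le> real N" using real_arch_simple by blast
    then have "\<forall>t\<ge>t0 + real N. dist (x t) (D m, 0) \<le> e m" using T by (intro allI impI less_imp_le) auto
    then have "x0 \<in> trapped t0 m (e m) (t0 + real N)" unfolding trapped_def settles_def using x m by blast
    then show "x0 \<in> (\<Union>p\<in>UNIV. ?S p)" by (intro UN_I[of "(m, N)"]) auto
  qed
  ultimately have "hausdorff_null 6 {x0 \<in> state_space. \<not> converges_from (sol t0) t0 (mat 1, 0) x0}"
    by (rule hausdorff_null_subset)
  then show ?thesis
    unfolding almost_globally_asymptotically_stable_def asymptotically_stable_def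
    using lyapunov_stable_identity locally_attractive_identity[OF assms] by blast
qed

end

section \<open>Conjugation by time-dependent isometries\<close>

lemma hausdorff_null_isometric_image:
  assumes null: "hausdorff_null d S" and iso: "\<And>x y. dist (g x) (g y) = dist x y"
  shows "hausdorff_null d (g ` S)"
proof -
  have diam: "diameter (g ` C) = diameter C" for C
  proof -
    have "(\<lambda>(x, y). dist x y) ` (g ` C \<times> g ` C) = (\<lambda>(x, y). dist x y) ` (C \<times> C)"
      unfolding image_paired_Times[symmetric] image_image by (simp add: case_prod_unfold iso)
    then show ?thesis unfolding diameter_def by (simp add: case_prod_unfold)
  qed
  have bdd: "bounded (g ` C)" if "bounded C" for C
    using that unfolding bounded_two_points by (auto simp: iso)
  show ?thesis
    unfolding hausdorff_null_def
  proof (intro allI impI)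
    fix e :: real assume "e > 0"
    then obtain C where "S \<subseteq> (\<Union>i. C i)" "\<And>i. bounded (C i)" "summable (\<lambda>i. diameter (C i) ^ d)"
      "(\<Sum>i. diameter (C i) ^ d) < e"
      using null unfolding hausdorff_null_def by blast
    moreover from this have "g ` S \<subseteq> (\<Union>i. g ` C i)" by blast
    ultimately show "\<exists>C. g ` S \<subseteq> (\<Union>i. C i) \<and> (\<forall>i. bounded (C i)) \<and>
        summable (\<lambda>i. diameter (C i) ^ d) \<and> (\<Sum>i. diameter (C i) ^ d) < e"
      by (intro exI[of _ "\<lambda>i. g ` C i"]) (auto simp: diam bdd)
  qed
qed

text \<open>
  Two systems whose trajectories correspond under bijective isometries \<open>h t\<close> that may depend on time. Distances to
  points that correspond to each other at all times agree, hence so do all stability notions.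
\<close>

locale isometric_conjugacy =
  fixes sol :: "(real \<Rightarrow> 'x::metric_space) \<Rightarrow> bool" and sol' :: "(real \<Rightarrow> 'y::metric_space) \<Rightarrow> bool"
    and h :: "real \<Rightarrow> 'x \<Rightarrow> 'y" and h' :: "real \<Rightarrow> 'y \<Rightarrow> 'x" and X X' t0
  assumes iso: "dist (h t x) (h t y) = dist x y"
    and inv: "h' t (h t x) = x" "h t (h' t w) = w"
    and sol_iff: "sol z \<longleftrightarrow> sol' (\<lambda>t. h t (z t))"
    and states: "x \<in> X \<longleftrightarrow> h t0 x \<in> X'"
begin

lemma sol'_iff: "sol' w \<longleftrightarrow> sol (\<lambda>t. h' t (w t))"
  unfolding sol_iff inv ..

lemma iso': "dist (h' t x) (h' t y) = dist x y"
  using iso[of t "h' t x" "h' t y"] unfolding inv by simp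

context
  fixes p q assumes fixed: "\<And>t. h t p = q"
begin

lemma dist_eq: "dist (h t x) q = dist x p"
  using iso[of t x p] unfolding fixed .

lemma lyapunov_stable_iff: "lyapunov_stable sol t0 p \<longleftrightarrow> lyapunov_stable sol' t0 q"
proof -
  have "(\<forall>z. sol z \<and> dist (z t0) p < d \<longrightarrow> (\<forall>t\<ge>t0. dist (z t) p < e)) \<longleftrightarrow>
      (\<forall>w. sol' w \<and> dist (w t0) q < d \<longrightarrow> (\<forall>t\<ge>t0. dist (w t) q < e))" for d e
  proof safe
    fix w t assume "\<forall>z. sol z \<and> dist (z t0) p < d \<longrightarrow> (\<forall>t\<ge>t0. dist (z t) p < e)"
      "sol' w" "dist (w t0) q < d" "t0 \<le> t"
    then show "dist (w t) q < e"
      using dist_eq[of t "h' t (w t)"] dist_eq[of t0 "h' t0 (w t0)"] unfolding sol'_iff inv by force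
  next
    fix z t assume "\<forall>w. sol' w \<and> dist (w t0) q < d \<longrightarrow> (\<forall>t\<ge>t0. dist (w t) q < e)"
      "sol z" "dist (z t0) p < d" "t0 \<le> t"
    then show "dist (z t) p < e"
      unfolding sol_iff using dist_eq by (metis (no_types, lifting))
  qed
  then show ?thesis unfolding lyapunov_stable_def by simp
qed

lemma tendsto_iff_conjugate: "(z \<longlongrightarrow> p) F \<longleftrightarrow> ((\<lambda>t. h t (z t)) \<longlongrightarrow> q) F"
  unfolding tendsto_dist_iff[of z] tendsto_dist_iff[of "\<lambda>t. h t (z t)"] dist_eq ..

lemma converges_from_iff: "converges_from sol t0 p x0 \<longleftrightarrow> converges_from sol' t0 q (h t0 x0)"
proof -
  have "(\<exists>z. sol z \<and> z t0 = x0) \<longleftrightarrow> (\<exists>w. sol' w \<and> w t0 = h t0 x0)"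
  proof safe
    fix z assume "sol z" "x0 = z t0"
    then show "\<exists>w. sol' w \<and> w t0 = h t0 (z t0)" using sol_iff by blast
  next
    fix w assume "sol' w" "w t0 = h t0 x0"
    then have "sol (\<lambda>t. h' t (w t))" "h' t0 (w t0) = x0" using sol'_iff inv(1)[of t0 x0] by auto
    then show "\<exists>z. sol z \<and> z t0 = x0" by blast
  qed
  moreover have "(\<forall>z. sol z \<and> z t0 = x0 \<longrightarrow> (z \<longlongrightarrow> p) at_top) \<longleftrightarrow>
      (\<forall>w. sol' w \<and> w t0 = h t0 x0 \<longrightarrow> (w \<longlongrightarrow> q) at_top)"
  proof safe
    fix w assume a: "\<forall>z. sol z \<and> z t0 = x0 \<longrightarrow> (z \<longlongrightarrow> p) at_top" "sol' w" "w t0 = h t0 x0"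
    then have "((\<lambda>t. h' t (w t)) \<longlongrightarrow> p) at_top" using sol'_iff[of w] inv(1)[of t0 x0] by auto
    then show "(w \<longlongrightarrow> q) at_top" unfolding tendsto_iff_conjugate inv .
  next
    fix z assume "\<forall>w. sol' w \<and> w t0 = h t0 (z t0) \<longrightarrow> (w \<longlongrightarrow> q) at_top" "sol z" "x0 = z t0"
    then show "(z \<longlongrightarrow> p) at_top" unfolding tendsto_iff_conjugate sol_iff by simp
  qed
  ultimately show ?thesis unfolding converges_from_def by simp
qed

lemma almost_globally_asymptotically_stable_transfer:
  assumes "almost_globally_asymptotically_stable d X' sol' t0 q"
  shows "almost_globally_asymptotically_stable d X sol t0 p"
proof -
  have "{x \<in> X. \<not> converges_from sol t0 p x} = h' t0 ` {y \<in> X'. \<not> converges_from sol' t0 q y}"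
  proof safe
    fix x assume "x \<in> X" "\<not> converges_from sol t0 p x"
    then show "x \<in> h' t0 ` {y \<in> X'. \<not> converges_from sol' t0 q y}"
      using states converges_from_iff inv(1)[of t0 x] by (intro image_eqI[of _ _ "h t0 x"]) auto
  qed (use states converges_from_iff inv in auto)
  moreover have "hausdorff_null d (h' t0 ` {y \<in> X'. \<not> converges_from sol' t0 q y})"
    by (rule hausdorff_null_isometric_image)
       (use assms iso' in \<open>auto simp: almost_globally_asymptotically_stable_def\<close>)
  moreover obtain c where "c > 0" "\<forall>y\<in>X'. dist y q < c \<longrightarrow> converges_from sol' t0 q y"
    using assms unfolding almost_globally_asymptotically_stable_def asymptotically_stable_def by blast
  then have "\<forall>x\<in>X. dist x p < c \<longrightarrow> converges_from sol t0 p x"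
    using states converges_from_iff dist_eq by metis
  ultimately show ?thesis
    using assms \<open>c > 0\<close> lyapunov_stable_iff
    unfolding almost_globally_asymptotically_stable_def asymptotically_stable_def by auto
qed

end

end

section \<open>The first follower of the network\<close>

text \<open>
  The hypothesis says that the weighted directions have second moments \<open>diag l\<close>; the sum of cross
  products is linear in these moments.
\<close>

lemma sum_weighted_cross3:
  assumes "\<And>i j. (\<Sum>c\<in>S. g c * (b c $ i * b c $ j)) = (if i = j then l $ i else 0)"
  shows "(\<Sum>c\<in>S. g c *\<^sub>R cross3 (transpose Q *v b c) (b c)) = torque l Q"
proof -
  have *: "(\<Sum>c\<in>S. g c * ((A $ 1 * b c $ 1 + A $ 2 * b c $ 2 + A $ 3 * b c $ 3) * b c $ j
      - (B $ 1 * b c $ 1 + B $ 2 * b c $ 2 + B $ 3 * b c $ 3) * b c $ i)) = l $ j * A $ j - l $ i * B $ i"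
    for A B :: "real^3" and i j
  proof -
    have "(\<Sum>c\<in>S. g c * ((A $ 1 * b c $ 1 + A $ 2 * b c $ 2 + A $ 3 * b c $ 3) * b c $ j
        - (B $ 1 * b c $ 1 + B $ 2 * b c $ 2 + B $ 3 * b c $ 3) * b c $ i))
      = (\<Sum>n\<in>UNIV. A $ n * (\<Sum>c\<in>S. g c * (b c $ n * b c $ j)))
        - (\<Sum>n\<in>UNIV. B $ n * (\<Sum>c\<in>S. g c * (b c $ n * b c $ i)))"
      unfolding sum_3 sum_distrib_left sum.distrib[symmetric] sum_subtractf[symmetric]
      by (rule sum.cong) (simp_all add: algebra_simps)
    also have "\<dots> = l $ j * A $ j - l $ i * B $ i"
      unfolding assms by (simp add: if_distrib cong: if_cong)
    finally show ?thesis .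
  qed
  define col where "col i = (\<chi> n. Q $ n $ i)" for i
  show ?thesis
    using *[of "col 2" 3 "col 3" 2] *[of "col 3" 1 "col 1" 3] *[of "col 1" 2 "col 2" 1]
    by (simp add: vec_eq_iff forall_3 matrix3_mult_vec_component col_def)
qed

lemma sum_weighted_deviation:
  assumes K: "\<And>i j. (\<Sum>c\<in>S. g c * (b c $ i * b c $ j)) = (if i = j then l $ i else 0)"
    and rot: "rotation_matrix Q"
  shows "(1/2) * (\<Sum>c\<in>S. g c * (norm (Q *v b c - b c))\<^sup>2) = potential l Q"
proof -
  have sq: "(norm (Q *v v - v))\<^sup>2 = 2 * (v \<bullet> v - v \<bullet> (Q *v v))" for v :: "real^3"
  proof -
    have "(Q *v v) \<bullet> (Q *v v) = v \<bullet> v"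
      using norm_rotation_mult_vec[OF rot, of v] by (simp flip: power2_norm_eq_inner)
    then show ?thesis unfolding power2_norm_eq_inner
      by (simp add: inner_diff_left inner_diff_right inner_commute)
  qed
  have "(1/2) * (\<Sum>c\<in>S. g c * (norm (Q *v b c - b c))\<^sup>2)
      = (\<Sum>c\<in>S. g c * (b c \<bullet> b c - b c \<bullet> (Q *v b c)))"
    unfolding sq sum_distrib_left by (rule sum.cong) simp_all
  also have "\<dots> = (\<Sum>i\<in>UNIV. (\<Sum>c\<in>S. g c * (b c $ i * b c $ i)))
      - (\<Sum>i\<in>UNIV. \<Sum>j\<in>UNIV. Q $ i $ j * (\<Sum>c\<in>S. g c * (b c $ i * b c $ j)))"
    unfolding sum_3 sum_distrib_left sum.distrib[symmetric] sum_subtractf[symmetric]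
    by (rule sum.cong) (simp_all add: inner_vec3 matrix3_mult_vec_component algebra_simps)
  also have "\<dots> = potential l Q"
    unfolding K potential_def by (simp add: sum_3 algebra_simps)
  finally show ?thesis .
qed

lemma coplanar_orthogonal_complement:
  fixes u :: "real^3"
  assumes "u \<noteq> 0"
  shows "coplanar {x. u \<bullet> x = 0}"
proof -
  obtain B where B: "B \<subseteq> {x. u \<bullet> x = 0}" "independent B" "{x. u \<bullet> x = 0} \<subseteq> span B"
    "card B = dim {x. u \<bullet> x = 0}"
    by (rule basis_exists)
  have "card B = 2" using B(4) dim_hyperplane[OF assms] by simp
  then obtain p q where "B = {p, q}" unfolding card_2_iff by blast
  moreover have "span (insert 0 {p, q}) = affine hull (insert 0 {p, q})"
    using affine_hull_span_0[of "{0, p, q}"] by (simp add: hull_inc)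
  ultimately have "{x. u \<bullet> x = 0} \<subseteq> affine hull {0, p, q}"
    using B(3) by simp
  then show ?thesis unfolding coplanar_def by blast
qed

lemma coplanar_mono: "coplanar T \<Longrightarrow> S \<subseteq> T \<Longrightarrow> coplanar S"
  unfolding coplanar_def by (meson order_trans)

locale first_follower =
  fixes net :: network and kw :: real and U :: "real^3^3" and l :: "real^3"
  assumes net: "twin_leader_follower net" and kw: "kw > 0" and U: "rotation_matrix U"
    and K_eq: "K net (Plain 3) = U ** diag l ** transpose U"
begin

abbreviation "follower \<equiv> Plain 3"
abbreviation "R \<equiv> orient net follower"
abbreviation "\<omega> \<equiv> angvel net follower"
abbreviation "weight \<equiv> gain net follower"
abbreviation "constraints \<equiv> constrs net follower"

lemma follower_in: "follower \<in> agents net" "3 \<in> {3..num_plain net}"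
  using net unfolding twin_leader_follower_def agents_def by auto

lemma rotation_orient: "t \<ge> 0 \<Longrightarrow> rotation_matrix (R t)"
  using net follower_in(1) unfolding twin_leader_follower_def by blast

lemma derivative_orient: "t \<ge> 0 \<Longrightarrow>
    (R has_vector_derivative R t ** skew (\<omega> t)) (at t within {0..})"
  using net follower_in(1) unfolding twin_leader_follower_def by blast

lemma angvel_bounded: "\<exists>b. \<forall>t\<ge>0. norm (\<omega> t) \<le> b"
  using net follower_in(1) unfolding twin_leader_follower_def by blast

lemma continuous_angvel: "continuous_on {0..} (\<omega>)"
proof -
  have "\<exists>w' b. \<forall>t\<ge>0. (\<omega> has_vector_derivative w' t) (at t within {0..}) \<and> norm (w' t) \<le> b"
    using net follower_in(1) unfolding twin_leader_follower_def by blast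
  then show ?thesis
    by (meson atLeast_iff continuous_on_eq_continuous_within has_vector_derivative_continuous)
qed

lemma follower_constraints:
  "card (nbrs net follower) \<ge> 2" "\<And>c. c \<in> constraints \<Longrightarrow> weight c > 0"
  "\<not> coplanar (insert 0 (constr_dir net follower ` constraints))"
  "card (eigenvalues (K net follower)) = 3"
  using net follower_in(2) unfolding twin_leader_follower_def Let_def by blast+

lemma finite_constrs: "finite (constraints)"
proof -
  have "finite (nbrs net follower)"
    using follower_constraints(1) by (metis card.infinite not_numeral_le_zero)
  then show ?thesis unfolding constrs_def by simp
qed

definition principal_dir :: "constr \<Rightarrow> real^3" where
  "principal_dir c = transpose U *v constr_dir net follower c"

text \<open>
  The entries of \<open>U\<^sup>T K U = diag l\<close>.
\<close>

lemma principal_moments: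
  "(\<Sum>c\<in>constraints. weight c * (principal_dir c $ i * principal_dir c $ j)) = (if i = j then l $ i else 0)"
proof -
  have lin: "linear (\<lambda>X :: real^3^3. transpose U ** X ** U)"
    by (rule linearI) (simp_all add: matrix_mult_simps bounded_bilinear.scaleR_left[OF bounded_bilinear_matrix_mult]
        bounded_bilinear.scaleR_right[OF bounded_bilinear_matrix_mult])
  have "transpose U ** outer v v ** U = outer (transpose U *v v) (transpose U *v v)" for v
    using outer_mult[of "transpose U" v] by simp
  then have "transpose U ** K net follower ** U
      = (\<Sum>c\<in>constraints. weight c *\<^sub>R outer (principal_dir c) (principal_dir c))"
    unfolding K_def linear_sum[OF lin] linear_scale[OF lin] principal_dir_def by simp
  moreover have "transpose U ** K net follower ** U = diag l"
    unfolding K_eq by (simp add: matrix_mul_assoc rotation_matrix_mult_transpose[OF U] rotation_cancel[OF U])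
  ultimately have "diag l $ i $ j = (\<Sum>c\<in>constraints. weight c *\<^sub>R outer (principal_dir c) (principal_dir c)) $ i $ j"
    by simp
  then show ?thesis by (simp add: sum_component outer_def diag_def)
qed

text \<open>
  \<open>l $ i\<close> is the weighted sum of the squared components of the directions along the \<open>i\<close>-th column of \<open>U\<close>. Were it
  zero, all directions would lie in the plane orthogonal to this column.
\<close>

lemma l_pos: "l $ i > 0"
proof (rule ccontr)
  assume np: "\<not> l $ i > 0"
  have nonneg: "weight c * (principal_dir c $ i * principal_dir c $ i) \<ge> 0" if "c \<in> constraints" for c
    using follower_constraints(2)[OF that] by simp
  have "(\<Sum>c\<in>constraints. weight c * (principal_dir c $ i * principal_dir c $ i)) = 0"
  proof (rule antisym)
    show "0 \<le> (\<Sum>c\<in>constraints. weight c * (principal_dir c $ i * principal_dir c $ i))"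
      by (rule sum_nonneg) (rule nonneg)
  qed (use principal_moments[of i i] np in simp)
  then have "\<forall>c\<in>constraints. weight c * (principal_dir c $ i * principal_dir c $ i) = 0"
    using sum_nonneg_eq_0_iff[OF finite_constrs nonneg] by simp
  then have zero: "principal_dir c $ i = 0" if "c \<in> constraints" for c
    using follower_constraints(2)[OF that] that by auto
  let ?u = "U *v axis i 1"
  have "?u \<bullet> x = (transpose U *v x) $ i" for x
    by (simp add: inner_vec3 matrix3_mult_vec_component axis_def)
       (use exhaust_3[of i] in \<open>auto simp: algebra_simps\<close>)
  then have "insert 0 (constr_dir net follower ` constraints) \<subseteq> {x. ?u \<bullet> x = 0}"
    using zero unfolding principal_dir_def by auto
  moreover have "?u \<noteq> 0"
    using norm_rotation_mult_vec[OF U, of "axis i 1"] by (metis norm_axis_1 norm_zero zero_neq_one)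
  ultimately show False
    using coplanar_orthogonal_complement coplanar_mono follower_constraints(3) by blast
qed

text \<open>
  Every eigenvalue of \<open>K\<close> is one of the \<open>l $ i\<close>, and there are three of them.
\<close>

lemma l_distinct: "i \<noteq> j \<Longrightarrow> l $ i \<noteq> l $ j"
proof -
  have "eigenvalues (K net follower) \<subseteq> range (($) l)"
  proof
    fix e assume "e \<in> eigenvalues (K net follower)"
    then obtain v where v: "v \<noteq> 0" "K net follower *v v = e *\<^sub>R v" unfolding eigenvalues_def by blast
    let ?w = "transpose U *v v"
    have "?w \<noteq> 0" using v(1) rotation_cancel(4)[OF U, of v] by (metis matrix_vector_mult_0_right)
    then obtain i where i: "?w $ i \<noteq> 0" by (metis vec_eq_iff zero_index)
    have "diag l *v ?w = transpose U *v (K net follower *v v)"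
      unfolding K_eq by (simp add: matrix_vector_mul_assoc matrix_mul_assoc rotation_matrix_mult_transpose[OF U])
    also have "\<dots> = e *\<^sub>R ?w" unfolding v(2) by (simp add: matrix_vec_mult_simps)
    finally have "(diag l *v ?w) $ i = e * ?w $ i" by simp
    moreover have "(diag l *v ?w) $ i = l $ i * ?w $ i"
      unfolding matrix3_mult_vec_component[of "diag l"] using exhaust_3[of i]
      by (auto simp: diag_def)
    ultimately have "e = l $ i" using i by simp
    then show "e \<in> range (($) l)" by blast
  qed
  then have "3 \<le> card (range (($) l))"
    using follower_constraints(4) by (metis card_mono finite_code finite_imageI finite)
  then have "card (range (($) l)) = card (UNIV :: 3 set)"
    using card_image_le[of "UNIV :: 3 set" "($) l"] by simp
  then have "inj (($) l)" by (intro eq_card_imp_inj_on) auto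
  then show "i \<noteq> j \<Longrightarrow> l $ i \<noteq> l $ j" by (auto dest: injD)
qed

text \<open>
  The orientation is a rotation only from time \<open>0\<close> on; holding it constant before makes the change
  of coordinates an isometry at every time.
\<close>

definition frame :: "real \<Rightarrow> real^3^3" where
  "frame t = transpose U ** R (max 0 t)"

lemma rotation_frame: "rotation_matrix (frame t)"
  unfolding frame_def using U rotation_orient by (intro rotation_matrix_mul) (simp_all add: rotation_matrix_transpose)

lemma derivative_frame:
  assumes "t0 \<ge> 0" "t \<ge> t0"
  shows "(frame has_vector_derivative frame t ** skew (\<omega> t)) (at t within {t0..})"
proof -
  have "(R has_vector_derivative R t ** skew (\<omega> t)) (at t within {t0..})"
    using derivative_orient[of t] assms by (rule_tac has_vector_derivative_within_subset[of _ _ _ "{0..}"]) auto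
  from bounded_linear.has_vector_derivative[OF bounded_bilinear.bounded_linear_right[OF bounded_bilinear_matrix_mult] this, of "transpose U"]
  have "((\<lambda>t. transpose U ** R t) has_vector_derivative frame t ** skew (\<omega> t)) (at t within {t0..})"
    using assms by (simp add: frame_def matrix_mul_assoc)
  then show ?thesis
    by (rule has_vector_derivative_transform[rotated 2]) (use assms in \<open>auto simp: frame_def\<close>)
qed

text \<open>
  Some bound, chosen so that the interpretation below has a term for it.
\<close>

definition angvel_bound :: real where
  "angvel_bound = (SOME b. \<forall>t\<ge>0. norm (\<omega> t) \<le> b)"

sublocale error: attitude_error_system l "\<lambda>t. frame t *v \<omega> t" kw angvel_bound
proof
  show "continuous_on {0..} (\<lambda>t. frame t *v \<omega> t)"
  proof (rule bounded_bilinear.continuous_on[OF bounded_bilinear_matrix_vec_mult _ continuous_angvel])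
    show "continuous_on {0..} frame"
      using derivative_frame[of 0] by (meson atLeast_iff continuous_on_eq_continuous_within has_vector_derivative_continuous order_refl)
  qed
  show "norm (frame t *v \<omega> t) \<le> angvel_bound" if "t \<ge> 0" for t
    unfolding norm_rotation_mult_vec[OF rotation_frame]
    using someI_ex[OF angvel_bounded] that unfolding angvel_bound_def by blast
qed (use kw l_pos l_distinct in auto)

text \<open>
  Both factors of the cross products are body-frame vectors, that is images under \<open>transpose (frame t)\<close> of vectors in
  the eigenbasis, and rotations preserve cross products; the rest is \<open>sum_weighted_cross3\<close>.
\<close>

lemma innovation_eq:
  assumes "t \<ge> 0"
  shows "innovation net follower t P = transpose (frame t) *v torque l (transpose U ** P ** transpose (frame t))"
proof -
  let ?F = "frame t" and ?Q = "transpose U ** P ** transpose (frame t)"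
  have F: "R t = U ** ?F"
    using assms by (simp add: frame_def matrix_mul_assoc rotation_matrix_mult_transpose[OF U])
  have b: "body_dir net follower t c = transpose ?F *v principal_dir c" for c
    unfolding body_dir_def principal_dir_def F
    by (simp add: matrix_transpose_mul matrix_vector_mul_assoc)
  have P: "transpose P *v constr_dir net follower c = transpose ?F *v (transpose ?Q *v principal_dir c)" for c
    unfolding principal_dir_def
    by (simp add: matrix_transpose_mul matrix_vector_mul_assoc matrix_mul_assoc
        rotation_matrix_mult_transpose[OF U] rotation_matrix_mult_transpose[OF rotation_frame]
        rotation_cancel[OF U] rotation_cancel[OF rotation_frame])
  have "innovation net follower t P
      = (\<Sum>c\<in>constraints. weight c *\<^sub>R (transpose ?F *v cross3 (transpose ?Q *v principal_dir c) (principal_dir c)))"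
    unfolding innovation_def b P
    using cross_rotation_matrix[of "transpose ?F"] rotation_frame[of t] by (simp add: rotation_matrix_transpose)
  also have "\<dots> = transpose ?F *v (\<Sum>c\<in>constraints. weight c *\<^sub>R cross3 (transpose ?Q *v principal_dir c) (principal_dir c))"
    unfolding linear_sum[OF matrix_vector_mul_linear] linear_scale[OF matrix_vector_mul_linear] ..
  also have "\<dots> = transpose ?F *v torque l ?Q"
    unfolding sum_weighted_cross3[OF principal_moments] ..
  finally show ?thesis .
qed

definition to_error :: "real \<Rightarrow> (real^3^3) \<times> (real^3) \<Rightarrow> (real^3^3) \<times> (real^3)" where
  "to_error t z = (transpose U ** fst z ** U, frame t *v snd z)"

definition from_error :: "real \<Rightarrow> (real^3^3) \<times> (real^3) \<Rightarrow> (real^3^3) \<times> (real^3)" where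
  "from_error t z = (U ** fst z ** transpose U, transpose (frame t) *v snd z)"

lemma to_error_inverse: "from_error t (to_error t z) = z" "to_error t (from_error t z) = z"
  unfolding to_error_def from_error_def
  by (simp_all add: matrix_mul_assoc rotation_matrix_mult_transpose[OF U] rotation_cancel[OF U]
      rotation_cancel[OF rotation_frame])

lemma dist_to_error: "dist (to_error t y) (to_error t z) = dist y z"
proof -
  have "norm (transpose U ** fst y ** U - transpose U ** fst z ** U) = norm (transpose U ** (fst y - fst z) ** U)"
    by (simp add: matrix_mult_simps)
  also have "\<dots> = norm (fst y - fst z)"
    using norm_mult_rotation(1)[OF U] norm_mult_rotation(2)[of "transpose U"] U
    by (simp add: rotation_matrix_transpose)
  finally have 1: "norm (transpose U ** fst y ** U - transpose U ** fst z ** U) = norm (fst y - fst z)" .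
  have "norm (frame t *v snd y - frame t *v snd z) = norm (snd y - snd z)"
    using norm_rotation_mult_vec[OF rotation_frame, of t "snd y - snd z"] by (simp add: matrix_vec_mult_simps)
  with 1 show ?thesis unfolding to_error_def by (simp add: dist_prod_def dist_norm)
qed

lemma rotation_conjugate_iff: "rotation_matrix (transpose U ** Q ** U) \<longleftrightarrow> rotation_matrix Q"
proof
  assume "rotation_matrix (transpose U ** Q ** U)"
  from rotation_matrix_mul[OF rotation_matrix_mul[OF U this], of "transpose U"]
  have "rotation_matrix (U ** (transpose U ** Q ** U) ** transpose U)"
    using U by (simp add: rotation_matrix_transpose)
  then show "rotation_matrix Q"
    by (simp add: matrix_mul_assoc rotation_matrix_mult_transpose[OF U] rotation_cancel[OF U])
qed (use U in \<open>auto intro!: rotation_matrix_mul simp: rotation_matrix_transpose\<close>)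

text \<open>
  The true angular velocity cancels in \<open>Q'\<close>. In \<open>V'\<close> it survives as the term \<open>a \<times> V\<close>, because the
  estimator integrates its velocity in the moving body frame.
\<close>

lemma error_solution_imp_sol:
  assumes t0: "t0 \<ge> 0" and x: "error_solution net follower kw t0 x"
  shows "error.sol t0 (\<lambda>t. to_error t (x t))"
proof -
  obtain P W where est: "estimator_solution net follower kw t0 P W"
    and xP: "\<And>t. t \<ge> t0 \<Longrightarrow> x t = (P t ** transpose (R t), W t)"
    using x unfolding error_solution_def by blast
  have P: "rotation_matrix (P t)" "(P has_vector_derivative P t ** skew (\<omega> t - W t)) (at t within {t0..})"
    "(W has_vector_derivative - kw *\<^sub>R W t + innovation net follower t (P t)) (at t within {t0..})" if "t \<ge> t0" for t
    using est that unfolding estimator_solution_def by auto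
  define Q where "Q t = transpose U ** P t ** transpose (frame t)" for t
  define V where "V t = frame t *v W t" for t
  have "to_error t (x t) = (Q t, V t)" if "t \<ge> t0" for t
    using that t0 unfolding to_error_def xP[OF that] Q_def V_def
    by (simp add: frame_def matrix_transpose_mul matrix_mul_assoc)
  moreover have "error.sol t0 (\<lambda>t. (Q t, V t))"
    unfolding error.sol_def fst_conv snd_conv
  proof (intro allI impI conjI)
    fix t assume t: "t \<ge> t0"
    then have t': "t \<ge> 0" using t0 by simp
    let ?F = "frame t"
    note dF = derivative_frame[OF t0 t]
    show "rotation_matrix (Q t)"
      unfolding Q_def using U P(1)[OF t] rotation_frame
      by (intro rotation_matrix_mul) (simp_all add: rotation_matrix_transpose)
    have "(Q has_vector_derivative (transpose U ** P t) ** transpose (?F ** skew (\<omega> t))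
        + (transpose U ** (P t ** skew (\<omega> t - W t))) ** transpose ?F) (at t within {t0..})" (is "(_ has_vector_derivative ?d) _")
      unfolding Q_def
      by (intro vector_derivative_mult vector_derivative_transpose dF P(2)[OF t]
          bounded_linear.has_vector_derivative[OF bounded_bilinear.bounded_linear_right[OF bounded_bilinear_matrix_mult]])
    also have "?d
        = - (transpose U ** P t ** (skew (W t) ** transpose ?F))"
      by (simp add: matrix_transpose_mul transpose_skew skew_diff matrix_mult_simps matrix_mul_assoc)
    also have "\<dots> = - (Q t ** skew (V t))"
      unfolding Q_def V_def by (simp add: matrix_mul_assoc flip: skew_mult_rotation_transpose[OF rotation_frame])
    finally show "(Q has_vector_derivative - (Q t ** skew (V t))) (at t within {t0..})" .
    have "(V has_vector_derivative ?F *v (- kw *\<^sub>R W t + innovation net follower t (P t))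
        + (?F ** skew (\<omega> t)) *v W t) (at t within {t0..})" (is "(_ has_vector_derivative ?d) _")
      unfolding V_def by (intro vector_derivative_mult_vec dF P(3)[OF t])
    also have "?d
        = cross3 (?F *v \<omega> t) (V t) - kw *\<^sub>R V t + torque l (Q t)"
      unfolding innovation_eq[OF t'] V_def Q_def
      by (simp add: matrix_vec_mult_simps rotation_cancel[OF rotation_frame] cross_rotation_matrix[OF rotation_frame] flip: matrix_vector_mul_assoc)
    finally show "(V has_vector_derivative cross3 (?F *v \<omega> t) (V t) - kw *\<^sub>R V t + torque l (Q t)) (at t within {t0..})" .
  qed
  ultimately show ?thesis using error.sol_cong[of t0 "\<lambda>t. to_error t (x t)" "\<lambda>t. (Q t, V t)"] by simp
qed

lemma sol_imp_error_solution:
  assumes t0: "t0 \<ge> 0" and sol: "error.sol t0 (\<lambda>t. to_error t (x t))"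
  shows "error_solution net follower kw t0 x"
proof -
  define Q where "Q t = fst (to_error t (x t))" for t
  define V where "V t = snd (to_error t (x t))" for t
  have QV: "Q = (\<lambda>t. fst (to_error t (x t)))" "V = (\<lambda>t. snd (to_error t (x t)))"
    unfolding Q_def V_def by auto
  note s = error.sol_rotation[OF sol QV] error.sol_Q[OF sol QV] error.sol_V[OF sol QV]
  define P where "P t = U ** Q t ** frame t" for t
  define W where "W t = transpose (frame t) *v V t" for t
  have "x t = (P t ** transpose (R t), W t)" if "t \<ge> t0" for t
  proof -
    have "x t = from_error t (Q t, V t)" unfolding Q_def V_def by (simp add: to_error_inverse)
    moreover have "frame t ** transpose (R t) = transpose U"
      using t0 that rotation_cancel(1)[OF rotation_orient, of t "transpose U"] by (simp add: frame_def)
    ultimately show ?thesis unfolding from_error_def P_def W_def by (simp flip: matrix_mul_assoc)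
  qed
  moreover have "estimator_solution net follower kw t0 P W"
    unfolding estimator_solution_def
  proof (intro allI impI conjI)
    fix t assume t: "t \<ge> t0"
    then have t': "t \<ge> 0" using t0 by simp
    let ?F = "frame t"
    note dF = derivative_frame[OF t0 t]
    have FW: "V t = ?F *v W t" unfolding W_def by (simp add: rotation_cancel[OF rotation_frame])
    show "rotation_matrix (P t)"
      unfolding P_def using U s(1)[OF t] rotation_frame by (intro rotation_matrix_mul)
    have "(P has_vector_derivative (U ** Q t) ** (?F ** skew (\<omega> t)) + (U ** - (Q t ** skew (V t))) ** ?F) (at t within {t0..})" (is "(_ has_vector_derivative ?d) _")
      unfolding P_def
      by (intro vector_derivative_mult dF s(2)[OF t]
          bounded_linear.has_vector_derivative[OF bounded_bilinear.bounded_linear_right[OF bounded_bilinear_matrix_mult]])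
    also have "?d
        = U ** Q t ** (?F ** skew (\<omega> t)) - U ** Q t ** (skew (V t) ** ?F)"
      by (simp add: matrix_mult_simps matrix_mul_assoc)
    also have "\<dots> = P t ** skew (\<omega> t - W t)"
      unfolding FW rotation_mult_skew[OF rotation_frame, symmetric] P_def
      by (simp add: skew_diff matrix_mult_simps matrix_mul_assoc)
    finally show "(P has_vector_derivative P t ** skew (\<omega> t - W t)) (at t within {t0..})" .
    have "(W has_vector_derivative transpose ?F *v (cross3 (?F *v \<omega> t) (V t) - kw *\<^sub>R V t + torque l (Q t))
        + transpose (?F ** skew (\<omega> t)) *v V t) (at t within {t0..})" (is "(_ has_vector_derivative ?d) _")
      unfolding W_def by (intro vector_derivative_mult_vec vector_derivative_transpose dF s(3)[OF t])
    also have "?d = - kw *\<^sub>R W t + transpose ?F *v torque l (Q t)"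
      unfolding FW
      by (simp add: matrix_vec_mult_simps matrix_transpose_mul transpose_skew rotation_cancel[OF rotation_frame]
          cross_rotation_matrix[OF rotation_frame] flip: matrix_vector_mul_assoc)
    also have "transpose ?F *v torque l (Q t) = innovation net follower t (P t)"
      unfolding innovation_eq[OF t'] P_def
      by (simp add: matrix_mul_assoc rotation_matrix_mult_transpose[OF U] rotation_cancel[OF rotation_frame])
    finally show "(W has_vector_derivative - kw *\<^sub>R W t + innovation net follower t (P t)) (at t within {t0..})" .
  qed
  ultimately show ?thesis unfolding error_solution_def by blast
qed

lemma isometric_conjugacy_to_error:
  assumes "t0 \<ge> 0"
  shows "isometric_conjugacy (error_solution net follower kw t0) (error.sol t0) to_error from_error state_space state_space t0"
proof
  show "error_solution net follower kw t0 z \<longleftrightarrow> error.sol t0 (\<lambda>t. to_error t (z t))" for z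
    using error_solution_imp_sol sol_imp_error_solution assms by blast
  show "x \<in> state_space \<longleftrightarrow> to_error t0 x \<in> state_space" for x
    by (cases x) (simp add: state_space_def to_error_def rotation_conjugate_iff)
qed (simp_all add: dist_to_error to_error_inverse)

lemma to_error_equilibrium:
  "to_error t (U ** q ** transpose U, 0) = (q, 0)"
  unfolding to_error_def
  by (simp add: matrix_mul_assoc rotation_matrix_mult_transpose[OF U] rotation_cancel[OF U])

lemma equilibria_eq:
  "equilibria net follower kw = {(Q, W). (Q = mat 1 \<or> (\<exists>m. Q = U ** D m ** transpose U)) \<and> W = 0}"
proof safe
  fix Q W assume "(Q, W) \<in> equilibria net follower kw"
  then have "error.sol 0 (\<lambda>t. (transpose U ** Q ** U, frame t *v W))"
    using error_solution_imp_sol[of 0 "\<lambda>t. (Q, W)"] unfolding equilibria_def to_error_def by simp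
  note c = error.sol_constant_rotation[OF this]
  have "W = transpose (frame 0) *v (frame 0 *v W)" by (simp add: rotation_cancel[OF rotation_frame])
  then show "W = 0" unfolding c(2) by simp
  have Q: "Q = U ** (transpose U ** Q ** U) ** transpose U"
    by (simp add: matrix_mul_assoc rotation_matrix_mult_transpose[OF U] rotation_cancel[OF U])
  assume no: "\<nexists>m. Q = U ** D m ** transpose U"
  then have "transpose U ** Q ** U = mat 1"
    using equilibrium_rotations[OF c(1) l_pos l_distinct c(3)] Q by metis
  then show "Q = mat 1" using Q by (simp add: rotation_matrix_mult_transpose[OF U])
next
  have eq: "(U ** q ** transpose U, 0) \<in> equilibria net follower kw" if "rotation_matrix q" "torque l q = 0" for q
    unfolding equilibria_def
    using sol_imp_error_solution[of 0 "\<lambda>t. (U ** q ** transpose U, 0)"] error.sol_equilibrium[OF that]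
    by (simp add: to_error_equilibrium)
  show "(mat 1, 0) \<in> equilibria net follower kw"
    using eq[OF rotation_matrix_one torque_one] by (simp add: rotation_matrix_mult_transpose[OF U])
  show "(U ** D m ** transpose U, 0) \<in> equilibria net follower kw" for m
    by (rule eq[OF rotation_matrix_D torque_D])
qed

text \<open>
  The body directions cancel the true orientation, so the error function depends on \<open>Q\<close> only.
\<close>

lemma error_function_eq:
  assumes "t \<ge> 0" and Q: "rotation_matrix Q"
  shows "error_function net follower t (Q ** R t) = potential l (transpose U ** Q ** U)"
proof -
  let ?Q = "transpose U ** Q ** U"
  have "norm ((Q ** R t) *v body_dir net follower t c - constr_dir net follower c)
      = norm (?Q *v principal_dir c - principal_dir c)" for c
  proof -
    have "(Q ** R t) *v body_dir net follower t c = Q *v constr_dir net follower c"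
      unfolding body_dir_def
      by (simp add: rotation_cancel[OF rotation_orient[OF assms(1)]] flip: matrix_vector_mul_assoc)
    moreover have "?Q *v principal_dir c - principal_dir c = transpose U *v (Q *v constr_dir net follower c - constr_dir net follower c)"
      unfolding principal_dir_def
      by (simp add: matrix_vec_mult_simps rotation_cancel[OF U] flip: matrix_vector_mul_assoc)
    ultimately show ?thesis
      using norm_rotation_mult_vec[of "transpose U"] U by (simp add: rotation_matrix_transpose)
  qed
  then show ?thesis
    unfolding error_function_def
    using sum_weighted_deviation[OF principal_moments, of ?Q] Q by (simp add: rotation_conjugate_iff)
qed

lemma error_function_minimum:
  assumes "t \<ge> 0" "rotation_matrix Q" "Q \<noteq> mat 1"
  shows "error_function net follower t (mat 1 ** R t) < error_function net follower t (Q ** R t)"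
proof -
  have "transpose U ** Q ** U \<noteq> mat 1"
  proof
    assume eq: "transpose U ** Q ** U = mat 1"
    have "Q = U ** (transpose U ** Q ** U) ** transpose U"
      by (simp add: matrix_mul_assoc rotation_matrix_mult_transpose[OF U] rotation_cancel[OF U])
    then show False using assms(3) unfolding eq by (simp add: rotation_matrix_mult_transpose[OF U])
  qed
  then have "potential l (transpose U ** Q ** U) > 0"
    using potential_pos[of _ l] assms(2) l_pos by (simp add: rotation_conjugate_iff)
  then show ?thesis
    unfolding error_function_eq[OF assms(1) assms(2)] error_function_eq[OF assms(1) rotation_matrix_one]
    by (simp add: rotation_matrix_mult_transpose[OF U] potential_one)
qed

lemma estimator_stability:
  assumes t0: "t0 \<ge> 0"
  shows "almost_globally_asymptotically_stable 6 state_space (error_solution net follower kw t0) t0 (mat 1, 0)"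
    "\<not> lyapunov_stable (error_solution net follower kw t0) t0 (U ** D m ** transpose U, 0)"
proof -
  interpret conj: isometric_conjugacy "error_solution net follower kw t0" "error.sol t0" to_error from_error state_space state_space t0
    by (rule isometric_conjugacy_to_error[OF t0])
  have "to_error t (mat 1, 0) = (mat 1, 0)" for t
    using to_error_equilibrium[of t "mat 1"] by (simp add: rotation_matrix_mult_transpose[OF U])
  then show "almost_globally_asymptotically_stable 6 state_space (error_solution net follower kw t0) t0 (mat 1, 0)"
    by (rule conj.almost_globally_asymptotically_stable_transfer)
       (rule error.identity_almost_globally_asymptotically_stable[OF t0])
  show "\<not> lyapunov_stable (error_solution net follower kw t0) t0 (U ** D m ** transpose U, 0)"
    using conj.lyapunov_stable_iff[OF to_error_equilibrium] error.D_unstable[OF t0] by blast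
qed

end

theorem theorem1:
  fixes net :: network and kw :: real and U :: "real^3^3" and l :: "real^3"
  assumes "twin_leader_follower net"
    and "kw > 0"
    and "orthogonal_matrix U"
    and "K net (Plain 3) = U ** diag l ** transpose U"
  shows "equilibria net (Plain 3) kw =
           {(Q, W). Q \<in> {mat 1, U ** D 1 ** transpose U, U ** D 2 ** transpose U,
                          U ** D 3 ** transpose U} \<and> W = 0}
         \<and> (\<forall>t0\<ge>0. almost_globally_asymptotically_stable 6 state_space
                (error_solution net (Plain 3) kw t0) t0 (mat 1, 0))
         \<and> (\<forall>t\<ge>0. \<forall>Q. rotation_matrix Q \<and> Q \<noteq> mat 1 \<longrightarrow>
                error_function net (Plain 3) t (mat 1 ** orient net (Plain 3) t)
                  < error_function net (Plain 3) t (Q ** orient net (Plain 3) t))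
         \<and> (\<forall>t0\<ge>0. \<forall>m. \<not> lyapunov_stable (error_solution net (Plain 3) kw t0) t0
                (U ** D m ** transpose U, 0))"
proof -
  \<comment> \<open>\<open>U\<close> and \<open>- U\<close> diagonalize \<open>K\<close> alike, and one of them is a rotation.\<close>
  obtain s :: real where s: "s = 1 \<or> s = -1" "rotation_matrix (s *\<^sub>R U)"
  proof -
    have "det (- U) = - det U" by (simp add: det_3)
    moreover have "orthogonal_matrix (- U)"
      using assms(3) unfolding orthogonal_matrix_def
      by (simp add: linear_neg[OF bounded_linear.linear[OF bounded_linear_transpose]] matrix_mult_simps)
    ultimately show ?thesis
      using that[of 1] that[of "-1"] assms(3) det_orthogonal_matrix[OF assms(3)]
      unfolding rotation_matrix_def by auto
  qed
  have conj: "(s *\<^sub>R U) ** A ** transpose (s *\<^sub>R U) = U ** A ** transpose U" for A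
    using s(1) by (auto simp: linear_neg[OF bounded_linear.linear[OF bounded_linear_transpose]] matrix_mult_simps)
  interpret first_follower net kw "s *\<^sub>R U" l
    by unfold_locales (use assms s conj in auto)
  have "(\<exists>m. Q = U ** D m ** transpose U) \<longleftrightarrow>
      Q \<in> {U ** D 1 ** transpose U, U ** D 2 ** transpose U, U ** D 3 ** transpose U}" for Q
  proof
    assume "\<exists>m. Q = U ** D m ** transpose U"
    then obtain m where "Q = U ** D m ** transpose U" ..
    then show "Q \<in> {U ** D 1 ** transpose U, U ** D 2 ** transpose U, U ** D 3 ** transpose U}"
      using exhaust_3[of m] by auto
  qed blast
  then have "equilibria net (Plain 3) kw =
      {(Q, W). Q \<in> {mat 1, U ** D 1 ** transpose U, U ** D 2 ** transpose U, U ** D 3 ** transpose U} \<and> W = 0}"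
    using equilibria_eq[unfolded conj] by auto
  then show ?thesis
    using estimator_stability[unfolded conj] error_function_minimum by blast
qed

end
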